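(* Let $(A,\widetilde{A})$ be a dual pair of closed operators on a Hilbert space $\mathcal{H}$ having the common core property, where $A$ is dissipative, let $\mathcal{D}\subset\mathcal{D}(A)\cap\mathcal{D}(\widetilde{A})$ be a common core for $A$ and $\widetilde{A}$, let $V:=\frac{A-\widetilde{A}}{2i}$ with domain $\mathcal{D}$ (a non-negative symmetric operator), and let $V_K$ be its Kreĭn–von Neumann extension. Assume in addition that $\dim\mathcal{D}(\widetilde{A}^* )/\mathcal{D}(A)<\infty$. Let $\mathcal{W}:=(\mathcal{D}(\widetilde{A}^* )//\mathcal{D}(A))\cap\mathcal{D}(V_K^{1/2})$, let $q$ be the quadratic form with domain $\mathcal{W}$ given by $$q(w):=\operatorname{Im}\langle w,\widetilde{A}^*w\rangle-\|V_K^{1/2}w\|^2,\qquad w\in\mathcal{W},$$ and let $M$ be the selfadjoint operator on the finite-dimensional space $\mathcal{W}$ associated to the unique sesquilinear form induced by $q$ by polarization, i.e. $q(w)=\langle w,Mw\rangle$. Decompose $\mathcal{W}=\mathcal{W}_+\oplus\mathcal{W}_0\oplus\mathcal{W}_-$, where $\mathcal{W}_+$ denotes the positive spectral subspace of $M$, $\mathcal{W}_0=\ker M$, and $\mathcal{W}_-$ denotes the negative spectral subspace of $M$. Define $M_\pm:=\pm MP_{\mathcal{W}_\pm}$, where $P_{\mathcal{W}_\pm}$ is the orthogonal projection of $\mathcal{W}$ onto $\mathcal{W}_\pm$, so that $M=M_+-M_-$; $M_+$ and $M_-$ are positive and invertible on $\mathcal{W}_+$, resp. on $\mathcal{W}_-$.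 Then there is a one-one correspondence between all pairs $(\mathfrak{M},C)$, where $\mathfrak{M}$ is a subspace of $\mathcal{W}_+\oplus\mathcal{W}_0$ and $C$ is a contraction ($\|C\|\le 1$) from $\mathcal{W}_+$ into $\mathcal{W}_-$ with domain $\mathcal{D}(C)=P_{\mathcal{W}_+}\mathfrak{M}$, and all proper dissipative extensions of $A$ (i.e. of the dual pair $(A,\widetilde{A})$), via $$\mathcal{D}(A_{\mathfrak{M},C})=\mathcal{D}(A)\dot{+}\left\{w+\sqrt{M_-}^{\,-1}C\sqrt{M_+}\,w:\ w\in\mathfrak{M}\right\},\qquad A_{\mathfrak{M},C}=\widetilde{A}^*\upharpoonright_{\mathcal{D}(A_{\mathfrak{M},C})}.$$ Moreover, for an extension $A_{\mathfrak{M},C}$ to be maximally dissipative, it is necessary that $\mathfrak{M}=\mathcal{W}_+\oplus\mathcal{W}_0$.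
   Context: The inner product $\langle\cdot,\cdot\rangle$ of the Hilbert space $\mathcal{H}$ is antilinear in the first and linear in the second argument; $\mathcal{W}$ carries the inner product of $\mathcal{H}$. $\sqrt{M_-}^{\,-1}$ is the inverse of $\sqrt{M_-}$ on $\mathcal{W}_-$. Dissipative: an operator $A$ is dissipative if it is densely defined and $\operatorname{Im}\langle f,Af\rangle\ge 0$ for all $f\in\mathcal{D}(A)$. A dissipative operator is maximally dissipative if it has no dissipative extension other than itself. Dual pair: a pair $(A,\widetilde{A})$ of densely defined closable operators with $A\subset\widetilde{A}^*$ (equivalently $\widetilde{A}\subset A^*$). A proper extension of $(A,\widetilde A)$ is an operator $A'$ with $A\subset A'\subset\widetilde{A}^*$. Common core property: a dual pair $(A,\widetilde A)$ of closed operators has the common core property if $A=\overline{A\upharpoonright_{\mathcal{D}(A)\cap\mathcal{D}(\widetilde{A})}}$ and $\widetilde{A}=\overline{\widetilde{A}\upharpoonright_{\mathcal{D}(A)\cap\mathcal{D}(\widetilde{A})}}$. A subspace $\mathcal{D}\subset\mathcal{D}(A)\cap\mathcal{D}(\widetilde A)$ is a common core if $A=\overline{A\upharpoonright_{\mathcal{D}}}$ and $\widetilde{A}=\overline{\widetilde{A}\upharpoonright_{\mathcal{D}}}$. Complementary subspaces: for linear spaces $\mathcal{M}\subset\mathcal{N}$ (not necessarily closed), $\mathcal{N}//\mathcal{M}$ denotes any (fixed) subspace of $\mathcal{N}$ with $(\mathcal{N}//\mathcal{M})+\mathcal{M}=\mathcal{N}$ and $(\mathcal{N}//\mathcal{M})\cap\mathcal{M}=\{0\}$.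 Kreĭn–von Neumann extension: for a densely defined non-negative symmetric operator $V$, $V_K$ denotes its smallest non-negative selfadjoint extension, i.e. $0\le V_K\le\widehat V$ for every non-negative selfadjoint extension $\widehat V$ of $V$ (it exists and is unique). Here, for non-negative selfadjoint $S,T$, $S\le T$ means $\mathcal{D}(S^{1/2})\supset\mathcal{D}(T^{1/2})$ and $\|S^{1/2}f\|\le\|T^{1/2}f\|$ for all $f\in\mathcal{D}(T^{1/2})$.
   Formalization: The domain of C is taken to be √M₊ P_{W₊}𝔐 instead of P_{W₊}𝔐, since C is applied to √M₊w; with the stated domain C√M₊w can be undefined (e.g. M₊ = diag(1,4), 𝔐 = span(1,1)). The two domains agree when P_{W₊}𝔐 is M-invariant. *)

theory Defs
  imports "HOL-Analysis.Analysis" "HOL-Library.Set_Algebras"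
begin

text \<open>The inner product is antilinear in the first and linear in the second argument
  (antilinearity follows from \<open>cinner_commute\<close>). Completeness comes from \<^class>\<open>banach\<close>.\<close>

class complex_hilbert_space = banach +
  fixes scaleC :: "complex \<Rightarrow> 'a \<Rightarrow> 'a"  (infixr "*\<^sub>C" 75)
    and cinner :: "'a \<Rightarrow> 'a \<Rightarrow> complex"
  assumes scaleC_add_right: "a *\<^sub>C (x + y) = a *\<^sub>C x + a *\<^sub>C y"
    and scaleC_add_left: "(a + b) *\<^sub>C x = a *\<^sub>C x + b *\<^sub>C x"
    and scaleC_scaleC: "a *\<^sub>C (b *\<^sub>C x) = (a * b) *\<^sub>C x"
    and scaleR_scaleC: "scaleR r x = complex_of_real r *\<^sub>C x"
    and cinner_commute: "cinner x y = cnj (cinner y x)"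
    and cinner_add_right: "cinner x (y + z) = cinner x y + cinner x z"
    and cinner_scaleC_right: "cinner x (a *\<^sub>C y) = a * cinner x y"
    and cinner_self: "cinner x x = complex_of_real ((norm x)\<^sup>2)"

global_interpretation complex_vector:
  vector_space "scaleC :: complex \<Rightarrow> 'a \<Rightarrow> 'a::complex_hilbert_space"
proof
  fix x :: 'a
  show "1 *\<^sub>C x = x"
    using scaleR_scaleC[of 1 x] by simp
qed (simp_all add: scaleC_add_right scaleC_add_left scaleC_scaleC)

text \<open>An operator is represented by its graph. So extension of operators is inclusion of graphs,
  the closure of an operator is the topological closure of its graph, an operator is closed iff
  its graph is closed, and composition is composition of relations.\<close>

type_synonym 'a op = "('a \<times> 'a) set"

definition linear_operator :: "'a::complex_hilbert_space op \<Rightarrow> bool" where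
  "linear_operator A \<longleftrightarrow>
     single_valued A \<and> (0, 0) \<in> A \<and>
     (\<forall>(f, g)\<in>A. \<forall>(f', g')\<in>A. (f + f', g + g') \<in> A) \<and>
     (\<forall>c. \<forall>(f, g)\<in>A. (c *\<^sub>C f, c *\<^sub>C g) \<in> A)"

definition op_apply :: "'a op \<Rightarrow> 'a \<Rightarrow> 'a" where
  "op_apply A f = (THE g. (f, g) \<in> A)"

definition op_restrict :: "'a op \<Rightarrow> 'a set \<Rightarrow> 'a op" where
  "op_restrict A D = {(f, g) \<in> A. f \<in> D}"

definition densely_defined :: "'a::complex_hilbert_space op \<Rightarrow> bool" where
  "densely_defined A \<longleftrightarrow> closure (Domain A) = UNIV"

definition closable :: "'a::complex_hilbert_space op \<Rightarrow> bool" where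
  "closable A \<longleftrightarrow> single_valued (closure A)"

text \<open>Adjoint of an operator in the Hilbert space \<open>W\<close>, a closed subspace of the ambient space.\<close>

definition adjoint_on :: "'a::complex_hilbert_space set \<Rightarrow> 'a op \<Rightarrow> 'a op" where
  "adjoint_on W A = {(g, h). g \<in> W \<and> h \<in> W \<and> (\<forall>(f, k)\<in>A. cinner g k = cinner h f)}"

abbreviation op_adjoint :: "'a::complex_hilbert_space op \<Rightarrow> 'a op" where
  "op_adjoint A \<equiv> adjoint_on UNIV A"

definition nonneg_selfadjoint_on :: "'a::complex_hilbert_space set \<Rightarrow> 'a op \<Rightarrow> bool" where
  "nonneg_selfadjoint_on W T \<longleftrightarrow>
     linear_operator T \<and> T \<subseteq> W \<times> W \<and> W \<subseteq> closure (Domain T) \<and> adjoint_on W T = T \<and>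
     (\<forall>(f, g)\<in>T. cinner f g \<in> \<real>\<^sub>\<ge>\<^sub>0)"

definition op_sqrt_on :: "'a::complex_hilbert_space set \<Rightarrow> 'a op \<Rightarrow> 'a op" where
  "op_sqrt_on W S = (THE R. nonneg_selfadjoint_on W R \<and> R O R = S)"

abbreviation op_sqrt :: "'a::complex_hilbert_space op \<Rightarrow> 'a op" where
  "op_sqrt S \<equiv> op_sqrt_on UNIV S"

definition form_le :: "'a::complex_hilbert_space op \<Rightarrow> 'a op \<Rightarrow> bool" where
  "form_le S T \<longleftrightarrow>
     Domain (op_sqrt T) \<subseteq> Domain (op_sqrt S) \<and>
     (\<forall>f\<in>Domain (op_sqrt T). norm (op_apply (op_sqrt S) f) \<le> norm (op_apply (op_sqrt T) f))"

definition krein_von_neumann :: "'a::complex_hilbert_space op \<Rightarrow> 'a op" where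
  "krein_von_neumann V =
     (THE T. nonneg_selfadjoint_on UNIV T \<and> V \<subseteq> T \<and>
             (\<forall>T'. nonneg_selfadjoint_on UNIV T' \<and> V \<subseteq> T' \<longrightarrow> form_le T T'))"

definition dissipative :: "'a::complex_hilbert_space op \<Rightarrow> bool" where
  "dissipative A \<longleftrightarrow>
     linear_operator A \<and> densely_defined A \<and> (\<forall>f\<in>Domain A. Im (cinner f (op_apply A f)) \<ge> 0)"

definition maximally_dissipative :: "'a::complex_hilbert_space op \<Rightarrow> bool" where
  "maximally_dissipative A \<longleftrightarrow> dissipative A \<and> (\<forall>B. dissipative B \<and> A \<subseteq> B \<longrightarrow> B = A)"

definition dual_pair :: "'a::complex_hilbert_space op \<Rightarrow> 'a op \<Rightarrow> bool" where
  "dual_pair A At \<longleftrightarrow>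
     linear_operator A \<and> densely_defined A \<and> closable A \<and>
     linear_operator At \<and> densely_defined At \<and> closable At \<and>
     A \<subseteq> op_adjoint At"

definition proper_extension :: "'a::complex_hilbert_space op \<Rightarrow> 'a op \<Rightarrow> 'a op \<Rightarrow> bool" where
  "proper_extension A At A' \<longleftrightarrow> linear_operator A' \<and> A \<subseteq> A' \<and> A' \<subseteq> op_adjoint At"

definition common_core_property :: "'a::complex_hilbert_space op \<Rightarrow> 'a op \<Rightarrow> bool" where
  "common_core_property A At \<longleftrightarrow>
     A = closure (op_restrict A (Domain A \<inter> Domain At)) \<and>
     At = closure (op_restrict At (Domain A \<inter> Domain At))"

definition common_core :: "'a::complex_hilbert_space op \<Rightarrow> 'a op \<Rightarrow> 'a set \<Rightarrow> bool" where
  "common_core A At D \<longleftrightarrow>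
     complex_vector.subspace D \<and> D \<subseteq> Domain A \<inter> Domain At \<and>
     A = closure (op_restrict A D) \<and> At = closure (op_restrict At D)"

definition imaginary_part :: "'a::complex_hilbert_space op \<Rightarrow> 'a op \<Rightarrow> 'a set \<Rightarrow> 'a op" where
  "imaginary_part A At D =
     {(f, (1 / (2 * \<i>)) *\<^sub>C (op_apply A f - op_apply At f)) | f. f \<in> D}"

text \<open>\<open>K\<close> is an algebraic complement of \<open>M\<close> in \<open>N\<close>, i.e. a possible choice of \<open>N // M\<close>.\<close>

definition complement_in :: "'a::complex_hilbert_space set \<Rightarrow> 'a set \<Rightarrow> 'a set \<Rightarrow> bool" where
  "complement_in N M K \<longleftrightarrow>
     complex_vector.subspace K \<and> K \<subseteq> N \<and> K + M = N \<and> K \<inter> M = {0}"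

text \<open>The quotient \<open>N / M\<close> has finite dimension: it is spanned by the classes of
  finitely many vectors of \<open>N\<close>.\<close>

definition finite_dim_quotient :: "'a::complex_hilbert_space set \<Rightarrow> 'a set \<Rightarrow> bool" where
  "finite_dim_quotient N M \<longleftrightarrow>
     (\<exists>B. finite B \<and> B \<subseteq> N \<and> N \<subseteq> M + complex_vector.span B)"

text \<open>The sesquilinear form (antilinear in the first argument) with diagonal \<open>q\<close>.\<close>

definition polarization ::
    "('a::complex_hilbert_space \<Rightarrow> real) \<Rightarrow> 'a \<Rightarrow> 'a \<Rightarrow> complex" where
  "polarization q v w =
     (1 / 4) * (\<Sum>k<4. (- \<i>) ^ k * complex_of_real (q (v + \<i> ^ k *\<^sub>C w)))"

definition form_operator ::
    "'a::complex_hilbert_space set \<Rightarrow> ('a \<Rightarrow> real) \<Rightarrow> 'a op" where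
  "form_operator W q =
     {(w, m). w \<in> W \<and> m \<in> W \<and> (\<forall>v\<in>W. cinner v m = polarization q v w)}"

text \<open>For a selfadjoint operator on a finite-dimensional space the spectral subspaces are the spans
  of the corresponding eigenvectors.\<close>

definition positive_spectral_subspace :: "'a::complex_hilbert_space op \<Rightarrow> 'a set" where
  "positive_spectral_subspace M =
     complex_vector.span {w. \<exists>r::real. r > 0 \<and> (w, complex_of_real r *\<^sub>C w) \<in> M}"

definition negative_spectral_subspace :: "'a::complex_hilbert_space op \<Rightarrow> 'a set" where
  "negative_spectral_subspace M =
     complex_vector.span {w. \<exists>r::real. r < 0 \<and> (w, complex_of_real r *\<^sub>C w) \<in> M}"

definition op_kernel :: "'a::complex_hilbert_space op \<Rightarrow> 'a set" where
  "op_kernel M = {w. (w, 0) \<in> M}"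

definition orth_proj :: "'a::complex_hilbert_space set \<Rightarrow> 'a \<Rightarrow> 'a" where
  "orth_proj S w = (THE p. p \<in> S \<and> (\<forall>s\<in>S. cinner s (w - p) = 0))"

text \<open>\<open>Rp\<close> stands for the square root of the positive part \<open>M\<^sub>+\<close> of \<open>M\<close>; \<open>Wp\<close>, \<open>W0\<close>, \<open>Wm\<close> for the
  positive spectral subspace, the kernel and the negative spectral subspace of \<open>M\<close>.
  In the formula for the extension, \<open>C\<close> is evaluated at the vectors \<open>Rp w\<close> with \<open>w \<in> MM\<close>. So the
  domain of \<open>C\<close> is \<open>Rp (P MM) = Rp MM\<close>, where \<open>P\<close> is the orthogonal projection onto \<open>Wp\<close>. This
  equals \<open>P MM\<close> if \<open>P MM\<close> is invariant under \<open>M\<close> (e.g. for \<open>MM = Wp + W0\<close>), but not in general,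
  and for a \<open>C\<close> with domain \<open>P MM\<close> the vector \<open>C (Rp w)\<close> need not be defined.\<close>

definition extension_parameters ::
    "'a::complex_hilbert_space set \<Rightarrow> 'a set \<Rightarrow> 'a set \<Rightarrow> 'a op \<Rightarrow> ('a set \<times> 'a op) set" where
  "extension_parameters Wp W0 Wm Rp =
     {(MM, C). complex_vector.subspace MM \<and> MM \<subseteq> Wp + W0 \<and>
               linear_operator C \<and> C \<subseteq> Wp \<times> Wm \<and>
               Domain C = op_apply Rp ` orth_proj Wp ` MM \<and>
               (\<forall>x\<in>Domain C. norm (op_apply C x) \<le> norm x)}"

end

theory Submission
  imports Defs "HOL-Computational_Algebra.Fundamental_Theorem_Algebra"
begin

text \<open>For \<open>f\<close> in the common core and \<open>v\<close> in the domain of the adjoint \<open>T\<close> of \<open>At\<close>,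
  \<open>Im (cinner (f + v) (A f + T v)) = cinner f (V f) + 2 Re (cinner v (V f)) + Im (cinner v (T v))\<close>.
  Replacing \<open>f\<close> by its complex multiples, this is non-negative for all \<open>f\<close> iff
  \<open>norm (cinner v (V f))^2 \<le> Im (cinner v (T v)) * cinner f (V f)\<close> for all \<open>f\<close>, which by the
  Ando-Nishio description of the form of the Krein-von Neumann extension means that \<open>v\<close> is in the
  domain of the square root of \<open>VK\<close> and \<open>q v \<ge> 0\<close>. So proper dissipative extensions correspond to
  subspaces of \<open>W\<close> on which \<open>q\<close> is non-negative. As \<open>q v = norm (Rp v)^2 - norm (Rm v)^2\<close>, such a
  subspace is a graph over its projection to \<open>Wp + W0\<close>, and \<open>Rp v \<mapsto> Rm v\<close> is a contraction. A
  contraction can be extended to all of \<open>Wp\<close> by an orthogonal projection, which gives maximality.\<close>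

section \<open>Elementary inequalities and the Riesz theorem\<close>

text \<open>\<open>op_sqrt\<close>, \<open>op_sqrt_on\<close> and \<open>krein_von_neumann\<close>
  are definite descriptions, so they denote the intended operators only after existence and
  uniqueness are both proved; much of the proof serves this. Unbounded operators are reached through
  bounded ones: a non-negative selfadjoint \<open>T\<close> is encoded by its resolvent
  \<open>S = (1 + T)^-1\<close>, a symmetric map with \<open>S^2 \<le> S\<close> and trivial kernel,
  and conversely every such \<open>S\<close> gives a \<open>T\<close>. Square roots of
  \<open>S\<close> and of \<open>1 - S\<close> come from a convergent iteration, which takes the
  place of the spectral theorem, and together they yield the square root of \<open>T\<close>. The
  Krein-von Neumann extension is also built from its resolvent. Its form is computed by a direct
  estimate, and minimality among all extensions is then a consequence of that formula instead of a
  part of the construction. On the finite-dimensional \<open>W\<close> all functions of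
  \<open>M\<close> are diagonal in one eigenbasis, so statements about roots, projections and
  inverses become statements about coefficients.\<close>

lemma cinner_add_left: "cinner (x + y) z = cinner x z + cinner (y::'a::complex_hilbert_space) z"
  by (metis cinner_commute cinner_add_right complex_cnj_add)

lemma cinner_scaleC_left: "cinner (a *\<^sub>C x) y = cnj a * cinner (x::'a::complex_hilbert_space) y"
  by (metis cinner_commute cinner_scaleC_right complex_cnj_mult)

lemma cinner_zero [simp]:
  "cinner (x::'a::complex_hilbert_space) 0 = 0" "cinner 0 (x::'a) = 0"
  using cinner_scaleC_right[of x 0 0] cinner_scaleC_left[of 0 0 x] by simp_all

lemma cinner_minus_right: "cinner x (- y) = - cinner (x::'a::complex_hilbert_space) y"
  using cinner_add_right[of x y "- y"] by (simp add: minus_unique)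

lemma cinner_minus_left: "cinner (- x) y = - cinner (x::'a::complex_hilbert_space) y"
  using cinner_add_left[of x "- x" y] by (simp add: minus_unique)

lemma cinner_diff_right: "cinner x (y - z) = cinner x y - cinner (x::'a::complex_hilbert_space) z"
  using cinner_add_right[of x y "- z"] by (simp add: cinner_minus_right)

lemma cinner_diff_left: "cinner (x - y) z = cinner x z - cinner (y::'a::complex_hilbert_space) z"
  using cinner_add_left[of x "- y" z] by (simp add: cinner_minus_left)

lemma cinner_scaleR_right: "cinner x (r *\<^sub>R y) = r *\<^sub>R cinner (x::'a::complex_hilbert_space) y"
  by (simp add: scaleR_scaleC cinner_scaleC_right scaleR_conv_of_real)

lemma cinner_scaleR_left: "cinner (r *\<^sub>R x) y = r *\<^sub>R cinner (x::'a::complex_hilbert_space) y"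
  by (simp add: scaleR_scaleC cinner_scaleC_left scaleR_conv_of_real)

lemmas cinner_algebra = cinner_add_left cinner_add_right cinner_diff_left cinner_diff_right
  cinner_scaleC_left cinner_scaleC_right cinner_scaleR_left cinner_scaleR_right
  cinner_minus_left cinner_minus_right

lemma Re_cinner_commute: "Re (cinner x y) = Re (cinner y (x::'a::complex_hilbert_space))"
  by (metis cinner_commute cnj.simps(1))

lemma Im_cinner_commute: "Im (cinner x y) = - Im (cinner y (x::'a::complex_hilbert_space))"
  by (metis cinner_commute cnj.simps(2))

lemma Re_cinner_self: "Re (cinner x x) = (norm (x::'a::complex_hilbert_space))\<^sup>2"
  by (simp add: cinner_self)

lemma norm_add_square:
  "(norm (x + y))\<^sup>2 = (norm x)\<^sup>2 + 2 * Re (cinner x y) + (norm (y::'a::complex_hilbert_space))\<^sup>2"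
  by (simp add: Re_cinner_self[symmetric] cinner_algebra Re_cinner_commute[of y x])

lemma norm_diff_square:
  "(norm (x - y))\<^sup>2 = (norm x)\<^sup>2 - 2 * Re (cinner x y) + (norm (y::'a::complex_hilbert_space))\<^sup>2"
  by (simp add: Re_cinner_self[symmetric] cinner_algebra Re_cinner_commute[of y x])

lemma norm_scaleC: "norm (a *\<^sub>C x) = norm a * norm (x::'a::complex_hilbert_space)"
proof -
  have "complex_of_real ((norm (a *\<^sub>C x))\<^sup>2) = a * cnj a * cinner x x"
    by (simp add: cinner_self[symmetric] cinner_algebra del: of_real_power)
  also have "\<dots> = complex_of_real ((norm a * norm x)\<^sup>2)"
    by (simp only: complex_norm_square[symmetric] cinner_self power_mult_distrib of_real_mult of_real_power)
  finally have "(norm (a *\<^sub>C x))\<^sup>2 = (norm a * norm x)\<^sup>2"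
    using of_real_eq_iff by blast
  then show ?thesis by (simp add: power2_eq_iff_nonneg)
qed

lemma real_quadratic_nonneg:
  fixes a b c :: real
  assumes "\<And>t. 0 \<le> a + 2 * t * b + t\<^sup>2 * c"
  shows "b\<^sup>2 \<le> a * c" and "0 \<le> a" and "0 \<le> c"
proof -
  show a: "0 \<le> a" using assms[of 0] by simp
  show c: "0 \<le> c"
  proof (rule ccontr)
    assume "\<not> 0 \<le> c"
    then have c: "c < 0" by simp
    \<comment> \<open>This \<open>t\<close> makes \<open>t * (- c)\<close> exceed
      \<open>a + 2 * \<bar>b\<bar>\<close> by \<open>- c\<close>. As \<open>t \<ge> 1\<close>, the
      quadratic term then outweighs the constant and the linear term together.\<close>
    define t where "t = 1 + (a + 2 * \<bar>b\<bar>) / (- c)"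
    have t1: "t \<ge> 1" using a c unfolding t_def
      by (smt (verit) divide_nonneg_pos)
    have "t * (- c) = - c + (a + 2 * \<bar>b\<bar>)" unfolding t_def using c by (simp add: field_simps)
    then have "t * (t * (- c)) > t * (a + 2 * \<bar>b\<bar>)" using t1 c
      by (smt (verit) mult_less_cancel_left_pos)
    moreover have "t * a \<ge> a" using t1 a by (simp add: mult_le_cancel_right1)
    moreover have "2 * t * b \<le> 2 * t * \<bar>b\<bar>" using t1 by simp
    ultimately show False using assms[of t] by (simp add: power2_eq_square algebra_simps)
  qed
  show "b\<^sup>2 \<le> a * c"
  proof (cases "c = 0")
    case True
    have "b = 0"
    proof (rule ccontr)
      assume "b \<noteq> 0"
      \<comment> \<open>With \<open>c = 0\<close> the expression is affine in \<open>t\<close>, and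
        at this point its value is -1.\<close>
      then show False using assms[of "- (a + 1) / (2 * b)"] True by (simp add: field_simps)
    qed
    then show ?thesis using True by simp
  next
    case False
    then have "c > 0" using c by simp
    then show ?thesis using assms[of "- b / c"]
      by (simp add: field_simps power2_eq_square)
  qed
qed

text \<open>Choosing the phase of \<open>z\<close> such that \<open>z * b\<close> is real reduces
  one direction to the real discriminant; the other is the inequality between arithmetic and
  geometric mean. With \<open>a = Im (cinner v (T v))\<close>, \<open>b = cinner v (V f)\<close> and
  \<open>c = cinner f (V f)\<close> it becomes the step from dissipativity to a bound on
  \<open>cinner v (V f)\<close>.\<close>

lemma complex_quadratic_nonneg:
  fixes a c :: real and b :: complex
  shows "(\<forall>z::complex. 0 \<le> a + 2 * Re (z * b) + (norm z)\<^sup>2 * c) \<longleftrightarrow> 0 \<le> a \<and> 0 \<le> c \<and> (norm b)\<^sup>2 \<le> a * c"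
proof
  assume *: "\<forall>z. 0 \<le> a + 2 * Re (z * b) + (norm z)\<^sup>2 * c"
  show "0 \<le> a \<and> 0 \<le> c \<and> (norm b)\<^sup>2 \<le> a * c"
  proof (cases "b = 0")
    case True
    have "0 \<le> a + 2 * t * 0 + t\<^sup>2 * c" for t
      using *[rule_format, of "of_real t"] True by simp
    from real_quadratic_nonneg[OF this] True show ?thesis by simp
  next
    case False
    have "0 \<le> a + 2 * t * norm b + t\<^sup>2 * c" for t
    proof -
      have "cnj (sgn b) * b = of_real (norm b)"
        using False complex_norm_square[of b]
        by (simp add: sgn_div_norm scaleR_conv_of_real power2_eq_square field_simps)
      then have "Re (of_real t * cnj (sgn b) * b) = t * norm b"
        by (simp add: mult.assoc)
      moreover have "norm (of_real t * cnj (sgn b)) = \<bar>t\<bar>"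
        using False by (simp add: norm_mult norm_sgn)
      ultimately show ?thesis using *[rule_format, of "of_real t * cnj (sgn b)"] by simp
    qed
    from real_quadratic_nonneg[OF this] show ?thesis by simp
  qed
next
  assume *: "0 \<le> a \<and> 0 \<le> c \<and> (norm b)\<^sup>2 \<le> a * c"
  show "\<forall>z. 0 \<le> a + 2 * Re (z * b) + (norm z)\<^sup>2 * c"
  proof
    fix z :: complex
    have "norm b \<le> sqrt a * sqrt c"
      using * by (simp add: real_le_rsqrt real_sqrt_mult[symmetric])
    then have "norm z * norm b \<le> norm z * (sqrt a * sqrt c)" by (simp add: mult_left_mono)
    moreover have "- (norm z * norm b) \<le> Re (z * b)"
      using abs_Re_le_cmod[of "z * b"] by (simp add: norm_mult)
    moreover have "0 \<le> (sqrt a - norm z * sqrt c)\<^sup>2" by simp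
    then have "0 \<le> a - 2 * (norm z * (sqrt a * sqrt c)) + (norm z)\<^sup>2 * c"
      using * by (simp add: power2_diff power_mult_distrib algebra_simps)
    ultimately show "0 \<le> a + 2 * Re (z * b) + (norm z)\<^sup>2 * c" by linarith
  qed
qed

text \<open>Cauchy-Schwarz is the discriminant condition for the squared norm of
  \<open>x + z *\<^sub>C y\<close> as a function of \<open>z\<close>.\<close>

lemma norm_cinner_le: "norm (cinner x y) \<le> norm x * norm (y::'a::complex_hilbert_space)"
proof -
  have "0 \<le> (norm x)\<^sup>2 + 2 * Re (z * cinner x y) + (norm z)\<^sup>2 * (norm y)\<^sup>2" for z
    using norm_add_square[of x "z *\<^sub>C y"] zero_le_power2[of "norm (x + z *\<^sub>C y)"]
    by (simp only: cinner_scaleC_right norm_scaleC power_mult_distrib)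
  then have "(norm (cinner x y))\<^sup>2 \<le> (norm x * norm y)\<^sup>2"
    using complex_quadratic_nonneg[of "(norm x)\<^sup>2" "cinner x y" "(norm y)\<^sup>2"]
    by (simp add: power_mult_distrib)
  then show ?thesis by (rule power2_le_imp_le) simp
qed

lemma bounded_bilinear_cinner:
  "bounded_bilinear (cinner :: 'a::complex_hilbert_space \<Rightarrow> 'a \<Rightarrow> complex)"
proof
  show "\<exists>K. \<forall>x y::'a. norm (cinner x y) \<le> norm x * norm y * K"
    using norm_cinner_le by (metis mult.right_neutral)
qed (simp_all add: cinner_algebra)

lemmas tendsto_cinner = bounded_bilinear.tendsto[OF bounded_bilinear_cinner]

lemma cinner_eq_zero_imp_eq:
  fixes x y :: "'a::complex_hilbert_space"
  assumes "\<And>z. cinner x z = cinner y z"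
  shows "x = y"
proof -
  have "cinner (x - y) (x - y) = 0" using assms[of "x - y"] by (simp add: cinner_diff_left)
  then show ?thesis by (simp add: cinner_self)
qed

lemma cinner_dense_eq:
  fixes x y :: "'a::complex_hilbert_space"
  assumes "closure S = UNIV" and "\<And>z. z \<in> S \<Longrightarrow> cinner x z = cinner y z"
  shows "x = y"
proof (rule cinner_eq_zero_imp_eq)
  fix z :: 'a
  have "z \<in> closure S" using assms by simp
  then obtain s where s: "\<And>n. s n \<in> S" "s \<longlonglongrightarrow> z" unfolding closure_sequential by blast
  have "(\<lambda>n. cinner x (s n)) \<longlonglongrightarrow> cinner x z" "(\<lambda>n. cinner y (s n)) \<longlonglongrightarrow> cinner y z"
    by (auto intro!: tendsto_cinner tendsto_const s)
  then show "cinner x z = cinner y z" using assms(2)[OF s(1)] LIMSEQ_unique by simp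
qed

text \<open>Minimising \<open>b p p - 2 \<phi> p\<close> over \<open>E\<close>; working with a minimising sequence instead of a
  minimiser gives the Riesz theorem without completeness of \<open>E\<close> under \<open>b\<close>.\<close>

lemma riesz_sequence:
  fixes b :: "'b::real_vector \<Rightarrow> 'b \<Rightarrow> real" and J :: "'b \<Rightarrow> 'a::banach"
  assumes E: "subspace E"
    and sym: "\<And>p r. p \<in> E \<Longrightarrow> r \<in> E \<Longrightarrow> b p r = b r p"
    and add: "\<And>p r s. p \<in> E \<Longrightarrow> r \<in> E \<Longrightarrow> s \<in> E \<Longrightarrow> b (p + r) s = b p s + b r s"
    and scale: "\<And>t p s. p \<in> E \<Longrightarrow> s \<in> E \<Longrightarrow> b (t *\<^sub>R p) s = t * b p s"
    and \<phi>add: "\<And>p r. p \<in> E \<Longrightarrow> r \<in> E \<Longrightarrow> \<phi> (p + r) = \<phi> p + \<phi> r"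
    and \<phi>scale: "\<And>t p. p \<in> E \<Longrightarrow> \<phi> (t *\<^sub>R p) = t * \<phi> p"
    and \<phi>bound: "\<And>p. p \<in> E \<Longrightarrow> (\<phi> p)\<^sup>2 \<le> c * b p p"
    and c: "0 \<le> c"
    and J: "linear J" and Jb: "\<And>p. p \<in> E \<Longrightarrow> (norm (J p))\<^sup>2 \<le> b p p"
  obtains p z where "\<And>j::nat. p j \<in> E" and "(\<lambda>j. J (p j)) \<longlonglongrightarrow> z"
    and "\<And>j r. r \<in> E \<Longrightarrow> (\<phi> r - b (p j) r)\<^sup>2 \<le> inverse (real (Suc j)) * b r r"
proof -
  have nonneg: "b p p \<ge> 0" if "p \<in> E" for p
    using Jb[OF that] by (meson order_trans zero_le_power2)
  \<comment> \<open>Completing the square bounds the functional from below, so the infimum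
    \<open>m\<close> is a genuine one.\<close>
  have below: "- c \<le> b p p - 2 * \<phi> p" if "p \<in> E" for p
  proof -
    have "\<bar>\<phi> p\<bar> \<le> sqrt c * sqrt (b p p)"
      using \<phi>bound[OF that] by (metis real_sqrt_abs real_sqrt_le_mono real_sqrt_mult)
    moreover have "0 \<le> (sqrt c - sqrt (b p p))\<^sup>2" by simp
    then have "0 \<le> c - 2 * (sqrt c * sqrt (b p p)) + b p p"
      using c nonneg[OF that] by (simp add: power2_diff)
    ultimately show ?thesis by linarith
  qed
  have expand: "b (p + t *\<^sub>R r) (p + t *\<^sub>R r) = b p p + 2 * t * b p r + t\<^sup>2 * b r r"
    if "p \<in> E" "r \<in> E" for p r t
  proof -
    have tr: "t *\<^sub>R r \<in> E" "p + t *\<^sub>R r \<in> E"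
      using E that by (auto simp: subspace_add subspace_scale)
    have "b (p + t *\<^sub>R r) (p + t *\<^sub>R r) = b p (p + t *\<^sub>R r) + t * b r (p + t *\<^sub>R r)"
      using add scale that tr by simp
    also have "b p (p + t *\<^sub>R r) = b p p + t * b p r"
      using sym[of p "p + t *\<^sub>R r"] add[of p "t *\<^sub>R r" p] scale[of r p t] sym[of r p] that tr by simp
    also have "b r (p + t *\<^sub>R r) = b p r + t * b r r"
      using sym[of r "p + t *\<^sub>R r"] add[of p "t *\<^sub>R r" r] scale[of r r t] that tr by simp
    finally show ?thesis by (simp add: algebra_simps power2_eq_square)
  qed
  define h where "h p = b p p - 2 * \<phi> p" for p
  define m where "m = Inf (h ` E)"
  have bdd: "bdd_below (h ` E)"
    using below unfolding h_def by (auto simp: bdd_below_def)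
  have m_le: "m \<le> h p" if "p \<in> E" for p
    unfolding m_def using bdd that by (simp add: cINF_lower)
  have "\<exists>p\<in>E. h p < m + inverse (real (Suc j))" for j
  proof -
    have "h ` E \<noteq> {}" using subspace_0[OF E] by auto
    moreover have "Inf (h ` E) < m + inverse (real (Suc j))" unfolding m_def by simp
    ultimately show ?thesis using cInf_less_iff[OF _ bdd, of "m + inverse (real (Suc j))"] by auto
  qed
  then obtain p where p: "\<And>j. p j \<in> E" "\<And>j. h (p j) < m + inverse (real (Suc j))"
    by metis
  \<comment> \<open>Moving from \<open>p j\<close> to \<open>p j + t *\<^sub>R r\<close> cannot
    lower the functional by more than \<open>1/(j+1)\<close>. As a quadratic condition in
    \<open>t\<close> this bounds the derivative in direction \<open>r\<close>, which is an
    approximate Euler-Lagrange equation.\<close>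
  have approx: "(\<phi> r - b (p j) r)\<^sup>2 \<le> inverse (real (Suc j)) * b r r" if r: "r \<in> E" for j r
  proof -
    have "0 \<le> inverse (real (Suc j)) + 2 * t * (b (p j) r - \<phi> r) + t\<^sup>2 * b r r" for t
    proof -
      have "t *\<^sub>R r \<in> E" "p j + t *\<^sub>R r \<in> E"
        using E p(1)[of j] r by (auto simp: subspace_add subspace_scale)
      then have "h (p j + t *\<^sub>R r) = h (p j) + 2 * t * (b (p j) r - \<phi> r) + t\<^sup>2 * b r r"
        using expand[OF p(1)[of j] r, of t] \<phi>add[OF p(1)[of j], of "t *\<^sub>R r"] \<phi>scale[OF r, of t]
        by (simp add: h_def algebra_simps)
      then show ?thesis using m_le[OF \<open>p j + t *\<^sub>R r \<in> E\<close>] p(2)[of j] by linarith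
    qed
    from real_quadratic_nonneg(1)[OF this] show ?thesis by (simp add: power2_commute)
  qed
  \<comment> \<open>Both \<open>b (p i) r\<close> and \<open>b (p j) r\<close> are close to
    \<open>\<phi> r\<close> for \<open>r = p i - p j\<close>. So \<open>b r r\<close> is at most
    twice the square root of \<open>b r r / (N+1)\<close>, which bounds \<open>b r r\<close>
    itself.\<close>
  have dist: "(norm (J (p i) - J (p j)))\<^sup>2 \<le> 4 * inverse (real (Suc N))" if "N \<le> i" "N \<le> j" for i j N
  proof -
    define r where "r = p i - p j"
    have r: "r \<in> E" using E p(1) unfolding r_def by (simp add: subspace_diff)
    have rr: "b r r = b (p i) r - b (p j) r"
      using add[OF r p(1)[of j] r] by (simp add: r_def)
    define x where "x = inverse (real (Suc N)) * b r r"
    have x0: "x \<ge> 0" unfolding x_def using nonneg[OF r] by simp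
    have le: "(\<phi> r - b (p k) r)\<^sup>2 \<le> x" if "N \<le> k" for k
    proof -
      have "inverse (real (Suc k)) \<le> inverse (real (Suc N))" using that by (simp add: inverse_eq_divide frac_le)
      then show ?thesis using approx[OF r, of k] nonneg[OF r] unfolding x_def
        by (meson mult_right_mono order_trans)
    qed
    have "\<bar>\<phi> r - b (p i) r\<bar> \<le> sqrt x" "\<bar>\<phi> r - b (p j) r\<bar> \<le> sqrt x"
      using real_sqrt_le_mono[OF le[OF that(1)]] real_sqrt_le_mono[OF le[OF that(2)]]
      by simp_all
    then have "b r r \<le> 2 * sqrt x" using rr by linarith
    then have "(b r r)\<^sup>2 \<le> (2 * sqrt x)\<^sup>2"
      by (rule power_mono) (rule nonneg[OF r])
    then have "b r r * b r r \<le> 4 * x"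
      using x0 by (simp only: power_mult_distrib real_sqrt_pow2 power2_eq_square[of "b r r"]) simp
    then have *: "b r r * b r r \<le> (4 * inverse (real (Suc N))) * b r r"
      unfolding x_def by (simp only: mult.assoc)
    have "b r r \<le> 4 * inverse (real (Suc N))"
    proof (cases "b r r = 0")
      case False
      then have "0 < b r r" using nonneg[OF r] by linarith
      then show ?thesis using * by (rule mult_right_le_imp_le[rotated])
    qed (simp del: of_nat_Suc)
    then show ?thesis using Jb[OF r] J by (simp add: r_def linear_diff)
  qed
  have "Cauchy (\<lambda>j. J (p j))"
  proof (rule CauchyI)
    fix e :: real assume "e > 0"
    then have "0 < e\<^sup>2 / 4" by simp
    from reals_Archimedean[OF this] obtain N where N: "inverse (real (Suc N)) < e\<^sup>2 / 4" ..
    have "norm (J (p i) - J (p j)) < e" if "N \<le> i" "N \<le> j" for i j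
    proof -
      have "(norm (J (p i) - J (p j)))\<^sup>2 < e\<^sup>2" using dist[OF that] N by linarith
      then show ?thesis using \<open>e > 0\<close> by (auto intro: power2_less_imp_less)
    qed
    then show "\<exists>N. \<forall>i\<ge>N. \<forall>j\<ge>N. norm (J (p i) - J (p j)) < e" by blast
  qed
  then obtain z where z: "(\<lambda>j. J (p j)) \<longlonglongrightarrow> z"
    unfolding convergent_eq_Cauchy[symmetric] ..
  show ?thesis by (rule that[OF p(1) z approx])
qed

lemma complex_subspace_imp_subspace:
  fixes S :: "'a::complex_hilbert_space set"
  assumes "complex_vector.subspace S"
  shows "subspace S"
  by (rule subspaceI; use assms in \<open>simp add: complex_vector.subspace_0 complex_vector.subspace_add
      scaleR_scaleC complex_vector.subspace_scale\<close>)

lemma complex_eqI_Re: "Re a = Re b \<Longrightarrow> Re (\<i> * a) = Re (\<i> * b) \<Longrightarrow> a = b"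
  by (simp add: complex_eq_iff)

text \<open>The real part of \<open>\<phi>\<close> is represented by the limit of the minimising
  sequence, and testing with \<open>\<i> *\<^sub>C s\<close> recovers the imaginary part.
  \<open>S\<close> may fail to be closed, so the representing vector lies in its closure.\<close>

lemma riesz_subspace:
  fixes S :: "'a::complex_hilbert_space set" and \<phi> :: "'a \<Rightarrow> complex"
  assumes S: "complex_vector.subspace S"
    and add: "\<And>x y. x \<in> S \<Longrightarrow> y \<in> S \<Longrightarrow> \<phi> (x + y) = \<phi> x + \<phi> y"
    and scale: "\<And>a x. x \<in> S \<Longrightarrow> \<phi> (a *\<^sub>C x) = a * \<phi> x"
    and bound: "\<And>x. x \<in> S \<Longrightarrow> norm (\<phi> x) \<le> c * norm x" and c: "0 \<le> c"
  obtains k where "k \<in> closure S" "\<And>s. s \<in> S \<Longrightarrow> \<phi> s = cinner k s" "norm k \<le> c"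
proof -
  have b: "(Re (\<phi> p))\<^sup>2 \<le> c\<^sup>2 * Re (cinner p p)" if "p \<in> S" for p
  proof -
    have "\<bar>Re (\<phi> p)\<bar> \<le> c * norm p" using bound[OF that] abs_Re_le_cmod order_trans by blast
    then have "\<bar>Re (\<phi> p)\<bar>\<^sup>2 \<le> (c * norm p)\<^sup>2" by (rule power_mono) simp
    then show ?thesis by (simp add: Re_cinner_self power_mult_distrib)
  qed
  obtain p z where p: "\<And>j::nat. p j \<in> S" and z: "(\<lambda>j. id (p j)) \<longlonglongrightarrow> z"
    and approx: "\<And>j r. r \<in> S \<Longrightarrow>
      (Re (\<phi> r) - Re (cinner (p j) r))\<^sup>2 \<le> inverse (real (Suc j)) * Re (cinner r r)"
  proof (rule riesz_sequence[where E = S and b = "\<lambda>p r. Re (cinner p r)" and \<phi> = "\<lambda>p. Re (\<phi> p)"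
        and c = "c\<^sup>2" and J = id])
    show "Re (\<phi> (t *\<^sub>R p)) = t * Re (\<phi> p)" if "p \<in> S" for t p
      using scale[OF that, of "of_real t"] by (simp add: scaleR_scaleC)
  qed (use S add b in \<open>auto simp: complex_subspace_imp_subspace Re_cinner_commute cinner_algebra
      Re_cinner_self linear_id\<close>)
  have Re: "Re (\<phi> r) = Re (cinner z r)" if "r \<in> S" for r
  proof -
    have "(\<lambda>j. (Re (\<phi> r) - Re (cinner (p j) r))\<^sup>2) \<longlonglongrightarrow> (Re (\<phi> r) - Re (cinner z r))\<^sup>2"
      using z by (auto intro!: tendsto_intros tendsto_cinner)
    moreover have "(\<lambda>j. inverse (real (Suc j)) * Re (cinner r r)) \<longlonglongrightarrow> 0 * Re (cinner r r)"
      by (intro tendsto_mult LIMSEQ_inverse_real_of_nat tendsto_const)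
    ultimately have "(Re (\<phi> r) - Re (cinner z r))\<^sup>2 \<le> 0 * Re (cinner r r)"
      using approx[OF that] by (intro LIMSEQ_le) auto
    then show ?thesis by simp
  qed
  have rep: "\<phi> s = cinner z s" if s: "s \<in> S" for s
  proof (rule complex_eqI_Re)
    show "Re (\<phi> s) = Re (cinner z s)" by (rule Re[OF s])
    show "Re (\<i> * \<phi> s) = Re (\<i> * cinner z s)"
      using Re[OF complex_vector.subspace_scale[OF S s, of \<i>]]
      by (simp only: scale[OF s] cinner_scaleC_right)
  qed
  \<comment> \<open>Evaluating \<open>\<phi>\<close> along the sequence that converges to
    \<open>z\<close> gives \<open>norm z ^ 2 \<le> c * norm z\<close>.\<close>
  have "(\<lambda>j. norm (\<phi> (p j))) \<longlonglongrightarrow> norm (cinner z z)"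
    using z by (simp add: rep[OF p] tendsto_norm tendsto_cinner)
  moreover have "(\<lambda>j. c * norm (p j)) \<longlonglongrightarrow> c * norm z"
    using z by (auto intro!: tendsto_intros)
  ultimately have "norm (cinner z z) \<le> c * norm z"
    using bound[OF p] by (intro LIMSEQ_le) auto
  then have "norm z * norm z \<le> c * norm z"
    by (simp add: cinner_self power2_eq_square norm_mult)
  then have "norm z \<le> c" using c by (cases "z = 0") auto
  moreover have "z \<in> closure S"
    using p z unfolding closure_sequential by auto
  ultimately show ?thesis using rep by (intro that)
qed

lemma cinner_closure_eq_zero:
  fixes x y :: "'a::complex_hilbert_space"
  assumes "\<And>s. s \<in> S \<Longrightarrow> cinner x s = 0" and "y \<in> closure S"
  shows "cinner x y = 0"
proof -
  obtain s where s: "\<And>n. s n \<in> S" "s \<longlonglongrightarrow> y" using assms(2) unfolding closure_sequential by blast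
  have "(\<lambda>n. cinner x (s n)) \<longlonglongrightarrow> cinner x y"
    by (auto intro!: tendsto_cinner tendsto_const s)
  then show ?thesis using assms(1)[OF s(1)] LIMSEQ_unique[of "\<lambda>n. 0" "cinner x y" 0] by simp
qed

text \<open>The restriction of \<open>cinner x\<close> to \<open>S\<close> is represented by a
  vector of the closure, and this vector is the orthogonal projection of \<open>x\<close>.\<close>

lemma closure_projection:
  fixes S :: "'a::complex_hilbert_space set"
  assumes S: "complex_vector.subspace S"
  shows "\<exists>p\<in>closure S. \<forall>s\<in>closure S. cinner (x - p) s = 0"
proof -
  obtain k where k: "k \<in> closure S" "\<And>s. s \<in> S \<Longrightarrow> cinner x s = cinner k s"
  proof (rule riesz_subspace[OF S cinner_add_right cinner_scaleC_right norm_cinner_le norm_ge_zero, of x])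
    fix k assume "k \<in> closure S" "\<And>s. s \<in> S \<Longrightarrow> cinner x s = cinner k s"
    then show ?thesis by (rule that)
  qed
  have "cinner (x - k) s = 0" if "s \<in> closure S" for s
    by (rule cinner_closure_eq_zero[OF _ that]) (simp add: cinner_diff_left k(2))
  with k(1) show ?thesis by auto
qed

section \<open>Positive contractions\<close>

lemma symmetric_map_linear:
  fixes B :: "'a::complex_hilbert_space \<Rightarrow> 'a"
  assumes "\<And>x y. cinner x (B y) = cinner (B x) y"
  shows "B (x + y) = B x + B y" and "B (a *\<^sub>C x) = a *\<^sub>C B x" and "B (r *\<^sub>R x) = r *\<^sub>R B x"
proof -
  show "B (x + y) = B x + B y"
    by (rule cinner_eq_zero_imp_eq) (simp only: assms[symmetric] cinner_add_left)
  show "B (a *\<^sub>C x) = a *\<^sub>C B x"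
    by (rule cinner_eq_zero_imp_eq) (simp only: assms[symmetric] cinner_scaleC_left)
  show "B (r *\<^sub>R x) = r *\<^sub>R B x"
    by (rule cinner_eq_zero_imp_eq) (simp only: assms[symmetric] cinner_scaleR_left)
qed

text \<open>For symmetric \<open>B\<close> the second condition says \<open>B^2 \<le> B\<close>,
  that is, \<open>0 \<le> B \<le> 1\<close>. Linearity is not part of the definition because it
  follows from symmetry on the whole space, and the norm bound follows by Cauchy-Schwarz.\<close>

definition positive_contraction :: "('a::complex_hilbert_space \<Rightarrow> 'a) \<Rightarrow> bool" where
  "positive_contraction B \<longleftrightarrow>
     (\<forall>x y. cinner x (B y) = cinner (B x) y) \<and> (\<forall>x. (norm (B x))\<^sup>2 \<le> Re (cinner x (B x)))"

lemma positive_contraction_sym: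
  "positive_contraction B \<Longrightarrow> cinner x (B y) = cinner (B x) y"
  and positive_contraction_norm_le_cinner:
  "positive_contraction B \<Longrightarrow> (norm (B x))\<^sup>2 \<le> Re (cinner x (B x))"
  unfolding positive_contraction_def by blast+

lemma positive_contraction_nonneg: "positive_contraction B \<Longrightarrow> 0 \<le> Re (cinner x (B x))"
  by (meson order_trans positive_contraction_norm_le_cinner zero_le_power2)

lemma positive_contraction_norm_le: "positive_contraction B \<Longrightarrow> norm (B x) \<le> norm x"
proof -
  assume B: "positive_contraction B"
  have "Re (cinner x (B x)) \<le> norm x * norm (B x)"
    by (meson complex_Re_le_cmod norm_cinner_le order_trans)
  then have "norm (B x) * norm (B x) \<le> norm x * norm (B x)"
    using positive_contraction_norm_le_cinner[OF B, of x] by (simp add: power2_eq_square)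
  then show ?thesis by (cases "B x = 0") auto
qed

lemma positive_contraction_bounded_linear: "positive_contraction B \<Longrightarrow> bounded_linear B"
proof -
  assume B: "positive_contraction B"
  note lin = symmetric_map_linear[OF positive_contraction_sym[OF B]]
  show ?thesis
    by (rule bounded_linear_intro[of B 1])
      (auto simp only: lin mult_1_right intro: positive_contraction_norm_le[OF B])
qed

lemma positive_contraction_scaleC: "positive_contraction B \<Longrightarrow> B (a *\<^sub>C x) = a *\<^sub>C B x"
  using symmetric_map_linear(2)[OF positive_contraction_sym] .

lemma positive_contraction_add: "positive_contraction B \<Longrightarrow> B (x + y) = B x + B y"
  using symmetric_map_linear(1)[OF positive_contraction_sym] .

lemma positive_contraction_diff: "positive_contraction B \<Longrightarrow> B (x - y) = B x - B y"
  by (simp add: positive_contraction_bounded_linear bounded_linear.linear linear_diff)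

lemma positive_contraction_zero: "positive_contraction B \<Longrightarrow> B 0 = 0"
  by (simp add: positive_contraction_bounded_linear bounded_linear.linear linear_0)

text \<open>The condition \<open>B^2 \<le> B\<close> is invariant under exchanging \<open>B\<close>
  and \<open>1 - B\<close>, since \<open>B - B^2\<close> is.\<close>

lemma positive_contraction_complement:
  assumes "positive_contraction B"
  shows "positive_contraction (\<lambda>x. x - B x)"
  using assms unfolding positive_contraction_def
  by (auto simp: cinner_diff_left cinner_diff_right norm_diff_square Re_cinner_self)

text \<open>The Cauchy-Schwarz inequality for the semidefinite form \<open>cinner x (B y)\<close> at
  \<open>x\<close> and \<open>B x\<close> bounds the fourth power of \<open>norm (B x)\<close> by
  \<open>cinner x (B x)\<close> times the square of \<open>norm (B x)\<close>; dividing gives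
  \<open>B^2 \<le> B\<close>.\<close>

lemma positive_contractionI:
  assumes sym: "\<And>x y. cinner x (B y) = cinner (B x) y"
    and nonneg: "\<And>x. 0 \<le> Re (cinner x (B x))"
    and norm: "\<And>x. norm (B x) \<le> norm x"
  shows "positive_contraction B"
  unfolding positive_contraction_def
proof (intro conjI allI)
  fix x
  define y where "y = B x"
  have eq: "Re (cinner y (B x)) = (norm y)\<^sup>2" "Re (cinner x (B y)) = (norm y)\<^sup>2"
    unfolding sym[of x y] by (simp_all add: y_def Re_cinner_self)
  have "0 \<le> Re (cinner x (B x)) + 2 * t * (norm y)\<^sup>2 + t\<^sup>2 * Re (cinner y (B y))" for t
    using nonneg[of "x + t *\<^sub>R y"] eq
    by (simp add: symmetric_map_linear[OF sym] cinner_algebra power2_eq_square algebra_simps)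
  from real_quadratic_nonneg(1)[OF this]
  have "((norm y)\<^sup>2)\<^sup>2 \<le> Re (cinner x (B x)) * Re (cinner y (B y))" .
  also have "Re (cinner y (B y)) \<le> norm y * norm (B y)"
    by (meson complex_Re_le_cmod norm_cinner_le order_trans)
  then have "Re (cinner y (B y)) \<le> (norm y)\<^sup>2"
    using norm[of y] by (smt (verit) mult_left_mono norm_ge_zero power2_eq_square)
  then have "Re (cinner x (B x)) * Re (cinner y (B y)) \<le> Re (cinner x (B x)) * (norm y)\<^sup>2"
    using nonneg by (rule mult_left_mono)
  finally have "(norm y)\<^sup>2 * (norm y)\<^sup>2 \<le> Re (cinner x (B x)) * (norm y)\<^sup>2"
    by (simp only: power2_eq_square)
  note le = this
  have "(norm y)\<^sup>2 \<le> Re (cinner x (B x))"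
  proof (cases "y = 0")
    case True
    then show ?thesis using nonneg[of x] by simp
  next
    case False
    then have "0 < (norm y)\<^sup>2" by simp
    with le show ?thesis by (rule mult_right_le_imp_le)
  qed
  then show "(norm (B x))\<^sup>2 \<le> Re (cinner x (B x))" unfolding y_def .
qed (rule sym)

section \<open>Square roots of positive contractions by iteration\<close>

primrec sqrt_iter :: "('a::real_normed_vector \<Rightarrow> 'a) \<Rightarrow> nat \<Rightarrow> 'a \<Rightarrow> 'a" where
  "sqrt_iter C 0 = (\<lambda>x. 0)"
| "sqrt_iter C (Suc n) = (\<lambda>x. (1 / 2) *\<^sub>R (C x + sqrt_iter C n (sqrt_iter C n x)))"

primrec sqrt_iter_bound :: "nat \<Rightarrow> real" where
  "sqrt_iter_bound 0 = 0"
| "sqrt_iter_bound (Suc n) = (1 + (sqrt_iter_bound n)\<^sup>2) / 2"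

lemma sqrt_iter_bound_range: "0 \<le> sqrt_iter_bound n \<and> sqrt_iter_bound n \<le> 1"
  by (induction n) (auto simp: power_le_one)

text \<open>For the graph \<open>G\<close> of an operator, invariance under
  \<open>(f, g) \<mapsto> (C f, C g)\<close> means that \<open>C\<close> commutes with this
  operator. Speaking of subspaces of pairs makes the statement apply to unbounded operators
  too.\<close>

lemma sqrt_iter_commute:
  assumes "subspace G" and "\<And>f g. (f, g) \<in> G \<Longrightarrow> (C f, C g) \<in> G" and "(f, g) \<in> G"
  shows "(sqrt_iter C n f, sqrt_iter C n g) \<in> G"
  using assms(3)
proof (induction n arbitrary: f g)
  case 0
  then show ?case using subspace_0[OF assms(1)] by (simp add: zero_prod_def)
next
  case (Suc n)
  have "(1 / 2) *\<^sub>R ((C f, C g) + (sqrt_iter C n (sqrt_iter C n f), sqrt_iter C n (sqrt_iter C n g))) \<in> G"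
    by (intro subspace_scale subspace_add assms(1,2) Suc)
  then show ?case by simp
qed

lemma linear_sqrt_iter: "linear C \<Longrightarrow> linear (sqrt_iter C n)"
  by (induction n) (auto intro!: linearI simp: linear_add linear_scale algebra_simps)

lemma norm_sqrt_iter_le:
  assumes "\<And>x. norm (C x) \<le> norm x"
  shows "norm (sqrt_iter C n x) \<le> sqrt_iter_bound n * norm x"
proof (induction n arbitrary: x)
  case (Suc n)
  have "norm (sqrt_iter C n (sqrt_iter C n x)) \<le> sqrt_iter_bound n * (sqrt_iter_bound n * norm x)"
    using Suc[of "sqrt_iter C n x"] Suc[of x] sqrt_iter_bound_range[of n]
    by (meson mult_left_mono order_trans)
  then have "norm (C x + sqrt_iter C n (sqrt_iter C n x))
      \<le> norm x + sqrt_iter_bound n * (sqrt_iter_bound n * norm x)"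
    using assms[of x] norm_triangle_le by (smt (verit))
  then show ?case by (simp add: power2_eq_square distrib_right mult.assoc del: scaleR_add_right)
qed simp

lemma subspace_graph: "linear B \<Longrightarrow> subspace {(x, y). y = B x}"
  by (rule subspaceI) (auto simp: linear_0 linear_add linear_scale zero_prod_def)

lemma sqrt_iter_self_commute:
  assumes "linear C"
  shows "sqrt_iter C m (sqrt_iter C n x) = sqrt_iter C n (sqrt_iter C m x)"
proof -
  have "(sqrt_iter C n x, sqrt_iter C n (C x)) \<in> {(x, y). y = C x}" for x
    by (rule sqrt_iter_commute[OF subspace_graph[OF assms]]) auto
  then have "(sqrt_iter C m x, sqrt_iter C m (sqrt_iter C n x)) \<in> {(x, y). y = sqrt_iter C n x}"
    by (intro sqrt_iter_commute[OF subspace_graph[OF linear_sqrt_iter[OF assms]]]) auto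
  then show ?thesis by simp
qed

text \<open>As the iterates commute, the difference of two consecutive squares factors into sum
  times difference. The scalar sequence factors in the same way, so its increments dominate by
  induction.\<close>

lemma sqrt_iter_step:
  assumes lin: "linear C" and C: "\<And>x. norm (C x) \<le> norm x"
  shows "norm (sqrt_iter C (Suc n) x - sqrt_iter C n x)
    \<le> (sqrt_iter_bound (Suc n) - sqrt_iter_bound n) * norm x"
proof (induction n arbitrary: x)
  case 0
  then show ?case using C[of x] by simp
next
  case (Suc n)
  let ?Y = "sqrt_iter C"
  let ?y = sqrt_iter_bound
  define d where "d = ?Y (Suc n) x - ?Y n x"
  have "?Y (Suc (Suc n)) x - ?Y (Suc n) x
      = (1 / 2) *\<^sub>R (?Y (Suc n) (?Y (Suc n) x) - ?Y n (?Y n x))"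
    by (subst (1 2) sqrt_iter.simps(2)) (simp add: algebra_simps del: sqrt_iter.simps)
  also have "\<dots> = (1 / 2) *\<^sub>R (?Y (Suc n) d + ?Y n d)"
    unfolding d_def
    by (simp only: linear_diff[OF linear_sqrt_iter[OF lin]] sqrt_iter_self_commute[OF lin, of "Suc n" n]) simp
  finally have eq: "?Y (Suc (Suc n)) x - ?Y (Suc n) x = (1 / 2) *\<^sub>R (?Y (Suc n) d + ?Y n d)" .
  have "norm (?Y (Suc n) d + ?Y n d) \<le> ?y (Suc n) * norm d + ?y n * norm d"
    by (intro norm_triangle_le add_mono norm_sqrt_iter_le C)
  also have "\<dots> = (?y (Suc n) + ?y n) * norm d" by (simp add: algebra_simps)
  also have "\<dots> \<le> (?y (Suc n) + ?y n) * ((?y (Suc n) - ?y n) * norm x)"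
    using Suc[of x] sqrt_iter_bound_range unfolding d_def
    by (intro mult_left_mono) (auto intro: add_nonneg_nonneg simp del: sqrt_iter_bound.simps)
  finally have "norm (?Y (Suc n) d + ?Y n d) \<le> ((?y (Suc n))\<^sup>2 - (?y n)\<^sup>2) * norm x"
    by (simp only: power2_eq_square algebra_simps)
  also have "(?y (Suc n))\<^sup>2 - (?y n)\<^sup>2 = 2 * (?y (Suc (Suc n)) - ?y (Suc n))"
    unfolding sqrt_iter_bound.simps(2)[of "Suc n"] sqrt_iter_bound.simps(2)[of n]
    by (simp only: diff_divide_distrib[symmetric]) simp
  finally have "norm (?Y (Suc n) d + ?Y n d) \<le> 2 * ((?y (Suc (Suc n)) - ?y (Suc n)) * norm x)"
    by (simp only: mult.assoc)
  then show ?case unfolding eq norm_scaleR by simp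
qed

lemma sqrt_iter_cinner:
  fixes C :: "'a::complex_hilbert_space \<Rightarrow> 'a"
  assumes "\<And>x y. cinner x (C y) = cinner (C x) y"
  shows "cinner x (sqrt_iter C n y) = cinner (sqrt_iter C n x) y"
  by (induction n arbitrary: x y) (simp_all add: cinner_algebra assms)

text \<open>The norms of the increments are dominated by the telescoping increments of a bounded
  monotone real sequence.\<close>

lemma sqrt_iter_convergent:
  fixes C :: "'a::banach \<Rightarrow> 'a"
  assumes lin: "linear C" and C: "\<And>x. norm (C x) \<le> norm x"
  shows "convergent (\<lambda>n. sqrt_iter C n x)"
proof (cases "x = 0")
  case True
  then show ?thesis by (simp add: linear_0[OF linear_sqrt_iter[OF lin]] convergent_const)
next
  case False
  then have x: "norm x > 0" by simp
  have step: "norm (sqrt_iter C (n + k) x - sqrt_iter C n x)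
      \<le> (sqrt_iter_bound (n + k) - sqrt_iter_bound n) * norm x" for n k
  proof (induction k)
    case (Suc k)
    have "norm (sqrt_iter C (n + Suc k) x - sqrt_iter C n x)
        \<le> norm (sqrt_iter C (Suc (n + k)) x - sqrt_iter C (n + k) x)
          + norm (sqrt_iter C (n + k) x - sqrt_iter C n x)"
      by (metis add_Suc_right norm_triangle_ineq diff_add_cancel add_diff_eq)
    also have "\<dots> \<le> (sqrt_iter_bound (Suc (n + k)) - sqrt_iter_bound (n + k)) * norm x
        + (sqrt_iter_bound (n + k) - sqrt_iter_bound n) * norm x"
      by (intro add_mono sqrt_iter_step[OF lin C] Suc)
    finally show ?case by (simp add: algebra_simps)
  qed simp
  \<comment> \<open>That the scalar sequence increases is read off from the estimate of the
    increments, whose left side is a norm; this uses \<open>x \<noteq> 0\<close>.\<close>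
  have "0 \<le> (sqrt_iter_bound (Suc n) - sqrt_iter_bound n) * norm x" for n
    using order_trans[OF norm_ge_zero sqrt_iter_step[OF lin C]] .
  then have "incseq sqrt_iter_bound"
    using x by (intro incseq_SucI) (simp add: zero_le_mult_iff del: sqrt_iter_bound.simps)
  then have "Cauchy sqrt_iter_bound"
    using sqrt_iter_bound_range incseq_convergent[of sqrt_iter_bound 1]
    by (metis convergent_def convergent_Cauchy)
  have "Cauchy (\<lambda>n. sqrt_iter C n x)"
  proof (rule CauchyI')
    fix e :: real assume "e > 0"
    then have "e / norm x > 0" using x by simp
    then obtain M where M: "\<And>m n. M \<le> m \<Longrightarrow> M \<le> n \<Longrightarrow>
        \<bar>sqrt_iter_bound m - sqrt_iter_bound n\<bar> < e / norm x"
      using \<open>Cauchy sqrt_iter_bound\<close> unfolding Cauchy_def dist_real_def by metis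
    have "dist (sqrt_iter C m x) (sqrt_iter C n x) < e" if "M \<le> m" "m < n" for m n
    proof -
      have "dist (sqrt_iter C m x) (sqrt_iter C n x) \<le> (sqrt_iter_bound n - sqrt_iter_bound m) * norm x"
        using step[of m "n - m"] that by (simp add: dist_norm norm_minus_commute)
      moreover have "sqrt_iter_bound n - sqrt_iter_bound m < e / norm x" using M[of n m] that by simp
      ultimately show ?thesis using x by (smt (verit) pos_less_divide_eq)
    qed
    then show "\<exists>M. \<forall>m\<ge>M. \<forall>n>m. dist (sqrt_iter C m x) (sqrt_iter C n x) < e" by blast
  qed
  then show ?thesis by (simp add: Cauchy_convergent_iff)
qed

text \<open>The iteration converges to \<open>1 - sqrt (1 - C)\<close>, the solution \<open>Y\<close> of \<open>2 Y = C + Y\<^sup>2\<close>. The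
  scalar iteration for \<open>C = 1\<close> is a majorant, and each iterate is a polynomial in \<open>C\<close>.\<close>

lemma positive_contraction_sqrt:
  fixes B :: "'a::complex_hilbert_space \<Rightarrow> 'a"
  assumes B: "positive_contraction B"
  shows "\<exists>P. positive_contraction P \<and> (\<forall>x. P (P x) = B x) \<and>
    (\<forall>G. closed G \<and> subspace G \<and> (\<forall>f g. (f, g) \<in> G \<longrightarrow> (B f, B g) \<in> G) \<longrightarrow>
       (\<forall>f g. (f, g) \<in> G \<longrightarrow> (P f, P g) \<in> G))"
proof -
  define C where "C x = x - B x" for x
  have C: "positive_contraction C"
    unfolding C_def by (rule positive_contraction_complement[OF B])
  have lin: "linear C" using C by (simp add: positive_contraction_bounded_linear bounded_linear.linear)
  have Cn: "norm (C x) \<le> norm x" for x by (rule positive_contraction_norm_le[OF C])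
  define Y where "Y x = lim (\<lambda>n. sqrt_iter C n x)" for x
  have lim: "(\<lambda>n. sqrt_iter C n x) \<longlonglongrightarrow> Y x" for x
    unfolding Y_def using sqrt_iter_convergent[OF lin Cn] convergent_LIMSEQ_iff by blast
  have bd: "norm (sqrt_iter C n x) \<le> norm x" for n x
    using norm_sqrt_iter_le[OF Cn, of n x] mult_left_le_one_le[of "norm x" "sqrt_iter_bound n"]
      sqrt_iter_bound_range[of n] norm_ge_zero[of x] by (meson order_trans)
  have Yn: "norm (Y x) \<le> norm x" for x
    by (rule LIMSEQ_le_const2[OF tendsto_norm[OF lim]]) (use bd in blast)
  have Ysym: "cinner x (Y y) = cinner (Y x) y" for x y
  proof (rule LIMSEQ_unique)
    show "(\<lambda>n. cinner x (sqrt_iter C n y)) \<longlonglongrightarrow> cinner x (Y y)"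
      by (intro tendsto_cinner tendsto_const lim)
    show "(\<lambda>n. cinner x (sqrt_iter C n y)) \<longlonglongrightarrow> cinner (Y x) y"
      unfolding sqrt_iter_cinner[OF positive_contraction_sym[OF C]]
      by (intro tendsto_cinner tendsto_const lim)
  qed
  \<comment> \<open>Pointwise convergence passes to the composition because all iterates have norm
    at most 1: replacing the inner iterate by its limit costs at most
    \<open>norm (sqrt_iter C n x - Y x)\<close>.\<close>
  have lim2: "(\<lambda>n. sqrt_iter C n (sqrt_iter C n x)) \<longlonglongrightarrow> Y (Y x)" for x
  proof -
    have "(\<lambda>n. sqrt_iter C n (sqrt_iter C n x - Y x)) \<longlonglongrightarrow> 0"
    proof (rule tendsto_norm_zero_cancel, rule tendsto_sandwich[OF _ _ tendsto_const])
      show "(\<lambda>n. norm (sqrt_iter C n x - Y x)) \<longlonglongrightarrow> 0"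
        using lim[of x] by (simp add: LIM_zero tendsto_norm_zero)
    qed (auto intro: always_eventually bd)
    from tendsto_add[OF this lim[of "Y x"]] show ?thesis
      by (simp add: linear_diff[OF linear_sqrt_iter[OF lin]])
  qed
  have eq: "Y x = (1 / 2) *\<^sub>R (C x + Y (Y x))" for x
  proof (rule LIMSEQ_unique)
    show "(\<lambda>n. sqrt_iter C (Suc n) x) \<longlonglongrightarrow> Y x" using lim by (rule LIMSEQ_Suc)
    show "(\<lambda>n. sqrt_iter C (Suc n) x) \<longlonglongrightarrow> (1 / 2) *\<^sub>R (C x + Y (Y x))"
      unfolding sqrt_iter.simps by (intro tendsto_scaleR tendsto_add tendsto_const lim2)
  qed
  define P where "P x = x - Y x" for x
  have sq: "P (P x) = B x" for x
  proof -
    have Y2: "2 *\<^sub>R Y x = C x + Y (Y x)"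
      by (rule trans[OF arg_cong[OF eq, of "scaleR 2"]]) simp
    have "linear Y" using symmetric_map_linear(1,3)[OF Ysym] by (intro linearI)
    then have "P (P x) = x - Y x - (Y x - Y (Y x))" unfolding P_def by (simp only: linear_diff)
    also have "\<dots> = x - 2 *\<^sub>R Y x + Y (Y x)" by (simp add: scaleR_2)
    also have "\<dots> = B x" unfolding Y2 by (simp add: C_def)
    finally show ?thesis .
  qed
  have Psym: "cinner x (P y) = cinner (P x) y" for x y
    by (simp add: P_def cinner_diff_left cinner_diff_right Ysym)
  have "positive_contraction P"
  proof (rule positive_contractionI[OF Psym])
    fix x
    have "Re (cinner x (Y x)) \<le> norm x * norm (Y x)"
      by (meson complex_Re_le_cmod norm_cinner_le order_trans)
    also have "\<dots> \<le> (norm x)\<^sup>2" using Yn[of x] by (simp add: power2_eq_square mult_left_mono)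
    finally show "0 \<le> Re (cinner x (P x))" by (simp add: P_def cinner_diff_right Re_cinner_self)
    have "(norm (P x))\<^sup>2 = Re (cinner x (B x))"
      by (simp add: Re_cinner_self[symmetric] Psym[symmetric] sq)
    also have "\<dots> \<le> norm x * norm (B x)"
      by (meson complex_Re_le_cmod norm_cinner_le order_trans)
    also have "\<dots> \<le> (norm x)\<^sup>2"
      using positive_contraction_norm_le[OF B, of x] by (simp add: power2_eq_square mult_left_mono)
    finally show "norm (P x) \<le> norm x" by (rule power2_le_imp_le) simp
  qed
  then show ?thesis
  proof (intro exI[of _ P] conjI allI impI; (elim conjE)?)
    fix G f g
    assume G: "closed G" "subspace G"
      "\<forall>f g. (f, g) \<in> G \<longrightarrow> (B f, B g) \<in> G" and fg: "(f, g) \<in> G"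
    \<comment> \<open>\<open>C = 1 - B\<close> inherits the invariance from \<open>B\<close>, then
      the iterates inherit it from \<open>C\<close>, and the limit from the iterates because
      \<open>G\<close> is closed.\<close>
    have "(C f, C g) \<in> G" if "(f, g) \<in> G" for f g
      using subspace_diff[OF G(2) that G(3)[rule_format, OF that]] by (simp add: C_def)
    from sqrt_iter_commute[OF G(2) this fg]
    have "\<And>n. (sqrt_iter C n f, sqrt_iter C n g) \<in> G" .
    moreover have "(\<lambda>n. (sqrt_iter C n f, sqrt_iter C n g)) \<longlonglongrightarrow> (Y f, Y g)"
      by (intro tendsto_Pair lim)
    ultimately have "(Y f, Y g) \<in> G" by (rule closed_sequentially[OF G(1)])
    from subspace_diff[OF G(2) fg this] show "(P f, P g) \<in> G" by (simp add: P_def)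
  qed (simp_all add: sq)
qed

section \<open>Non-negative selfadjoint operators and their square roots\<close>

lemma linear_operator_add:
  "linear_operator T \<Longrightarrow> (f, g) \<in> T \<Longrightarrow> (f', g') \<in> T \<Longrightarrow> (f + f', g + g') \<in> T"
  unfolding linear_operator_def by auto

lemma linear_operator_scaleC: "linear_operator T \<Longrightarrow> (f, g) \<in> T \<Longrightarrow> (c *\<^sub>C f, c *\<^sub>C g) \<in> T"
  unfolding linear_operator_def by auto

lemma linear_operator_zero: "linear_operator T \<Longrightarrow> (0, 0) \<in> T"
  unfolding linear_operator_def by auto

lemma linear_operator_unique:
  "linear_operator T \<Longrightarrow> (f, g) \<in> T \<Longrightarrow> (f, g') \<in> T \<Longrightarrow> g = g'"
  unfolding linear_operator_def single_valued_def by metis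

lemma op_apply_eq: "linear_operator T \<Longrightarrow> (f, g) \<in> T \<Longrightarrow> op_apply T f = g"
  unfolding op_apply_def by (rule the_equality) (auto dest: linear_operator_unique)

lemma op_apply_in: "linear_operator T \<Longrightarrow> f \<in> Domain T \<Longrightarrow> (f, op_apply T f) \<in> T"
  by (auto simp: op_apply_eq)

lemma linear_operator_subspace: "linear_operator T \<Longrightarrow> subspace T"
  by (rule subspaceI)
    (auto simp: zero_prod_def scaleR_scaleC linear_operator_zero linear_operator_add
      linear_operator_scaleC)

lemma linear_operator_diff:
  "linear_operator T \<Longrightarrow> (f, g) \<in> T \<Longrightarrow> (f', g') \<in> T \<Longrightarrow> (f - f', g - g') \<in> T"
  using subspace_diff[OF linear_operator_subspace] by fastforce

lemma linear_operatorI: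
  assumes "\<And>f g g'. (f, g) \<in> T \<Longrightarrow> (f, g') \<in> T \<Longrightarrow> g = g'" and "(0, 0) \<in> T"
    and "\<And>f g f' g'. (f, g) \<in> T \<Longrightarrow> (f', g') \<in> T \<Longrightarrow> (f + f', g + g') \<in> T"
    and "\<And>c f g. (f, g) \<in> T \<Longrightarrow> (c *\<^sub>C f, c *\<^sub>C g) \<in> T"
  shows "linear_operator T"
  unfolding linear_operator_def single_valued_def by (auto intro: assms(2-4) dest: assms(1))

lemma linear_operator_Domain_subspace:
  "linear_operator T \<Longrightarrow> complex_vector.subspace (Domain T)"
  unfolding complex_vector.subspace_def
  using linear_operator_zero linear_operator_add linear_operator_scaleC by blast

section \<open>Non-negative selfadjoint operators and their resolvents\<close>

lemma nonneg_selfadjointI: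
  assumes "linear_operator T" and "closure (Domain T) = UNIV"
    and sym: "\<And>f g f' g'. (f, g) \<in> T \<Longrightarrow> (f', g') \<in> T \<Longrightarrow> cinner f g' = cinner g f'"
    and max: "\<And>f g. (\<And>f' g'. (f', g') \<in> T \<Longrightarrow> cinner f g' = cinner g f') \<Longrightarrow> (f, g) \<in> T"
    and nonneg: "\<And>f g. (f, g) \<in> T \<Longrightarrow> 0 \<le> Re (cinner f g)"
  shows "nonneg_selfadjoint_on UNIV T"
proof -
  have "adjoint_on UNIV T = T"
  proof
    show "adjoint_on UNIV T \<subseteq> T" unfolding adjoint_on_def by (auto intro!: max)
    show "T \<subseteq> adjoint_on UNIV T" unfolding adjoint_on_def by (auto intro: sym)
  qed
  moreover have "cinner f g \<in> \<real>\<^sub>\<ge>\<^sub>0" if "(f, g) \<in> T" for f g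
    using sym[OF that that] nonneg[OF that] Im_cinner_commute[of f g]
    by (simp add: complex_nonneg_Reals_iff complex_eq_iff)
  ultimately show ?thesis
    unfolding nonneg_selfadjoint_on_def using assms(1,2) by auto
qed

lemma nonneg_selfadjointD:
  assumes "nonneg_selfadjoint_on UNIV T"
  shows "linear_operator T" and "closure (Domain T) = UNIV"
    and "(f, g) \<in> T \<Longrightarrow> (f', g') \<in> T \<Longrightarrow> cinner f g' = cinner g f'"
    and "(\<And>f' g'. (f', g') \<in> T \<Longrightarrow> cinner f g' = cinner g f') \<Longrightarrow> (f, g) \<in> T"
    and "(f, g) \<in> T \<Longrightarrow> 0 \<le> Re (cinner f g)"
proof -
  have adj: "adjoint_on UNIV T = T" using assms unfolding nonneg_selfadjoint_on_def by blast
  show "linear_operator T" "closure (Domain T) = UNIV"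
    using assms unfolding nonneg_selfadjoint_on_def by auto
  show "cinner f g' = cinner g f'" if "(f, g) \<in> T" "(f', g') \<in> T"
  proof -
    have "(f, g) \<in> adjoint_on UNIV T" using adj that(1) by simp
    then show ?thesis using that(2) unfolding adjoint_on_def by auto
  qed
  show "(f, g) \<in> T" if "\<And>f' g'. (f', g') \<in> T \<Longrightarrow> cinner f g' = cinner g f'"
  proof -
    have "(f, g) \<in> adjoint_on UNIV T" unfolding adjoint_on_def using that by auto
    then show ?thesis using adj by simp
  qed
  show "0 \<le> Re (cinner f g)" if "(f, g) \<in> T"
    using assms that unfolding nonneg_selfadjoint_on_def by (auto simp: complex_nonneg_Reals_iff)
qed

lemma adjoint_closed: "closed (adjoint_on UNIV A)"
proof (unfold closed_sequential_limits, intro allI impI, elim conjE)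
  fix u :: "nat \<Rightarrow> 'a \<times> 'a" and l
  assume u: "\<forall>n. u n \<in> adjoint_on UNIV A" and l: "u \<longlonglongrightarrow> l"
  have "cinner (fst l) k = cinner (snd l) f" if "(f, k) \<in> A" for f k
  proof (rule LIMSEQ_unique)
    show "(\<lambda>n. cinner (fst (u n)) k) \<longlonglongrightarrow> cinner (fst l) k"
      by (intro tendsto_cinner tendsto_const tendsto_fst l)
    have "cinner (fst (u n)) k = cinner (snd (u n)) f" for n
      using u[rule_format, of n] that by (auto simp: adjoint_on_def)
    then show "(\<lambda>n. cinner (fst (u n)) k) \<longlonglongrightarrow> cinner (snd l) f"
      by (simp only:) (intro tendsto_cinner tendsto_const tendsto_snd l)
  qed
  then show "l \<in> adjoint_on UNIV A" by (auto simp: adjoint_on_def split_beta)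
qed

lemma nonneg_selfadjoint_closed: "nonneg_selfadjoint_on UNIV T \<Longrightarrow> closed T"
  using adjoint_closed[of T] unfolding nonneg_selfadjoint_on_def by simp

lemma dense_of_orthogonal_trivial:
  fixes S :: "'a::complex_hilbert_space set"
  assumes S: "complex_vector.subspace S"
    and "\<And>x. (\<And>s. s \<in> S \<Longrightarrow> cinner x s = 0) \<Longrightarrow> x = 0"
  shows "closure S = UNIV"
proof -
  have "x \<in> closure S" for x
  proof -
    obtain p where p: "p \<in> closure S" "\<forall>s\<in>closure S. cinner (x - p) s = 0"
      using closure_projection[OF S, of x] ..
    have "x - p = 0" by (rule assms(2)) (use p(2) closure_subset in auto)
    then show ?thesis using p(1) by simp
  qed
  then show ?thesis by auto
qed

lemma dense_range_of_injective:
  fixes B :: "'a::complex_hilbert_space \<Rightarrow> 'a"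
  assumes sym: "\<And>x y. cinner x (B y) = cinner (B x) y" and inj: "\<And>x. B x = 0 \<Longrightarrow> x = 0"
  shows "closure (range B) = UNIV"
proof (rule dense_of_orthogonal_trivial)
  note lin = symmetric_map_linear[OF sym]
  have "0 \<in> range B" using lin(2)[of 0 0] by (metis complex_vector.scale_zero_left rangeI)
  then show "complex_vector.subspace (range B)"
    unfolding complex_vector.subspace_def
    using rangeI[of B] by (auto simp: lin(1,2)[symmetric] simp del: rangeI)
next
  fix x assume "\<And>s. s \<in> range B \<Longrightarrow> cinner x s = 0"
  then have "cinner (B x) (B x) = 0" using sym[of x "B x"] by simp
  then have "B x = 0" by (simp add: cinner_self)
  then show "x = 0" by (rule inj)
qed

text \<open>\<open>S\<close> is \<open>(1 + T)^-1\<close>, and \<open>f = S (f + g)\<close> is the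
  equation of the graph of \<open>T\<close> without an inverse. Solvability of
  \<open>f + T f = x\<close> comes from Riesz for the form \<open>cinner f (f + g)\<close> on the
  graph. This form controls only the norm of \<open>f\<close>, so only the first components of a
  minimising sequence converge, and selfadjointness has to place the limit in the domain.\<close>

lemma nonneg_selfadjoint_resolvent:
  fixes T :: "'a::complex_hilbert_space op"
  assumes T: "nonneg_selfadjoint_on UNIV T"
  obtains S where "positive_contraction S" "T = {(f, g). f = S (f + g)}"
proof -
  note D = nonneg_selfadjointD[OF T]
  have ex: "\<exists>f. (f, x - f) \<in> T" for x
  proof -
    obtain p z where p: "\<And>j::nat. p j \<in> T" and z: "(\<lambda>j. fst (p j)) \<longlonglongrightarrow> z"
      and approx: "\<And>j r. r \<in> T \<Longrightarrow>
        (Re (cinner x (fst r)) - Re (cinner (fst (p j)) (fst r + snd r)))\<^sup>2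
          \<le> inverse (real (Suc j)) * Re (cinner (fst r) (fst r + snd r))"
    proof (rule riesz_sequence[where E = T and b = "\<lambda>p r. Re (cinner (fst p) (fst r + snd r))"
          and \<phi> = "\<lambda>r. Re (cinner x (fst r))" and c = "(norm x)\<^sup>2" and J = fst])
      show "subspace T" by (rule linear_operator_subspace[OF D(1)])
      show "Re (cinner (fst p) (fst r + snd r)) = Re (cinner (fst r) (fst p + snd p))"
        if "p \<in> T" "r \<in> T" for p r
        using D(3)[of "fst p" "snd p" "fst r" "snd r"] that
        by (simp add: cinner_add_right Re_cinner_commute)
      have fb: "(norm (fst p))\<^sup>2 \<le> Re (cinner (fst p) (fst p + snd p))" if "p \<in> T" for p
        using D(5)[of "fst p" "snd p"] that by (simp add: cinner_add_right Re_cinner_self)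
      show "(norm (fst p))\<^sup>2 \<le> Re (cinner (fst p) (fst p + snd p))" if "p \<in> T" for p
        by (rule fb[OF that])
      show "(Re (cinner x (fst p)))\<^sup>2 \<le> (norm x)\<^sup>2 * Re (cinner (fst p) (fst p + snd p))"
        if "p \<in> T" for p
      proof -
        have "\<bar>Re (cinner x (fst p))\<bar> \<le> norm x * norm (fst p)"
          by (meson abs_Re_le_cmod norm_cinner_le order_trans)
        then have "\<bar>Re (cinner x (fst p))\<bar>\<^sup>2 \<le> (norm x * norm (fst p))\<^sup>2" by (rule power_mono) simp
        then show ?thesis using mult_left_mono[OF fb[OF that], of "(norm x)\<^sup>2"]
          by (simp add: power_mult_distrib)
      qed
    qed (auto simp: cinner_add_left cinner_add_right cinner_scaleR_left cinner_scaleR_right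
        linear_fst distrib_left)
    have Re: "Re (cinner x (fst r)) = Re (cinner z (fst r + snd r))" if "r \<in> T" for r
    proof -
      have "(\<lambda>j. (Re (cinner x (fst r)) - Re (cinner (fst (p j)) (fst r + snd r)))\<^sup>2)
          \<longlonglongrightarrow> (Re (cinner x (fst r)) - Re (cinner z (fst r + snd r)))\<^sup>2"
        using z by (intro tendsto_intros tendsto_cinner)
      moreover have "(\<lambda>j. inverse (real (Suc j)) * Re (cinner (fst r) (fst r + snd r)))
          \<longlonglongrightarrow> 0 * Re (cinner (fst r) (fst r + snd r))"
        by (intro tendsto_mult LIMSEQ_inverse_real_of_nat tendsto_const)
      ultimately have "(Re (cinner x (fst r)) - Re (cinner z (fst r + snd r)))\<^sup>2
          \<le> 0 * Re (cinner (fst r) (fst r + snd r))"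
        using approx[OF that] by (intro LIMSEQ_le) auto
      then show ?thesis by simp
    qed
    \<comment> \<open>Rewritten as \<open>cinner z g' = cinner (x - z) f'\<close>, this places
      \<open>(z, x - z)\<close> in the graph of the adjoint, which is \<open>T\<close>.\<close>
    have "cinner x f' = cinner z (f' + g')" if fg: "(f', g') \<in> T" for f' g'
    proof (rule complex_eqI_Re)
      show "Re (cinner x f') = Re (cinner z (f' + g'))" using Re[OF fg] by simp
      show "Re (\<i> * cinner x f') = Re (\<i> * cinner z (f' + g'))"
        using Re[OF linear_operator_scaleC[OF D(1) fg, of \<i>]]
        by (simp only: fst_conv snd_conv scaleC_add_right[symmetric] cinner_scaleC_right)
    qed
    then have "(z, x - z) \<in> T"
      by (intro D(4)) (simp add: cinner_add_right cinner_diff_left)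
    then show ?thesis ..
  qed
  have uniq: "f = f'" if "(f, x - f) \<in> T" "(f', x - f') \<in> T" for x f f'
  proof -
    have "(f - f', - (f - f')) \<in> T" using linear_operator_diff[OF D(1) that] by simp
    from D(5)[OF this] have "(norm (f - f'))\<^sup>2 \<le> 0"
      by (simp only: cinner_minus_right Re_cinner_self uminus_complex.sel)
    then show ?thesis by simp
  qed
  define S where "S x = (THE f. (f, x - f) \<in> T)" for x
  have S: "(S x, x - S x) \<in> T" for x
    unfolding S_def using ex[of x] uniq[of _ x] by (metis (mono_tags, lifting) theI)
  have S_eq: "(f, g) \<in> T \<longleftrightarrow> f = S (f + g)" for f g
    using S[of "f + g"] uniq[of f "f + g" "S (f + g)"] by (metis add_diff_cancel_left')
  have "positive_contraction S"
    unfolding positive_contraction_def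
  proof (intro conjI allI)
    show "cinner x (S y) = cinner (S x) y" for x y
      using D(3)[OF S[of x] S[of y]] by (simp add: cinner_diff_left cinner_diff_right)
    show "(norm (S x))\<^sup>2 \<le> Re (cinner x (S x))" for x
      using D(5)[OF S[of x]] by (simp add: cinner_diff_right Re_cinner_self Re_cinner_commute)
  qed
  moreover have "T = {(f, g). f = S (f + g)}" using S_eq by auto
  ultimately show ?thesis by (rule that)
qed

text \<open>The relation is \<open>S^-1 - 1\<close>. Injectivity of \<open>S\<close> makes it
  single-valued and also makes its domain, the range of \<open>S\<close>, dense;
  \<open>S^2 \<le> S\<close> is its non-negativity.\<close>

lemma nonneg_selfadjoint_of_resolvent:
  fixes S :: "'a::complex_hilbert_space \<Rightarrow> 'a"
  assumes S: "positive_contraction S" and inj: "\<And>x. S x = 0 \<Longrightarrow> x = 0"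
  shows "nonneg_selfadjoint_on UNIV {(f, g). f = S (f + g)}"
proof (rule nonneg_selfadjointI)
  note lin = positive_contraction_add[OF S] positive_contraction_scaleC[OF S]
    positive_contraction_diff[OF S] positive_contraction_zero[OF S]
  show "linear_operator {(f, g). f = S (f + g)}"
  proof (rule linear_operatorI; clarify)
    fix f g g' assume "f = S (f + g)" "f = S (f + g')"
    then have "S (g - g') = 0" using lin(3)[of "f + g" "f + g'"] by simp
    then show "g = g'" using inj[of "g - g'"] by simp
  next
    fix f g f' g' assume "f = S (f + g)" "f' = S (f' + g')"
    then show "f + f' = S (f + f' + (g + g'))"
      using lin(1)[of "f + g" "f' + g'"] by (simp add: ac_simps)
  next
    fix c f g assume "f = S (f + g)"
    then show "c *\<^sub>C f = S (c *\<^sub>C f + c *\<^sub>C g)" by (metis lin(2) scaleC_add_right)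
  qed (simp add: lin)
  have "range S \<subseteq> Domain {(f, g). f = S (f + g)}"
  proof
    fix y assume "y \<in> range S"
    then obtain x where "y = S x" by auto
    then have "(y, x - y) \<in> {(f, g). f = S (f + g)}" by simp
    then show "y \<in> Domain {(f, g). f = S (f + g)}" by blast
  qed
  then have "closure (range S) \<subseteq> closure (Domain {(f, g). f = S (f + g)})" by (rule closure_mono)
  moreover have "closure (range S) = UNIV"
    by (rule dense_range_of_injective) (auto intro: inj positive_contraction_sym[OF S])
  ultimately show "closure (Domain {(f, g). f = S (f + g)}) = UNIV" by auto
next
  fix f g f' g'
  assume "(f, g) \<in> {(f, g). f = S (f + g)}" "(f', g') \<in> {(f, g). f = S (f + g)}"
  then have "cinner (f + g) f' = cinner f (f' + g')"
    using positive_contraction_sym[OF S, of "f + g" "f' + g'"] by simp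
  then show "cinner f g' = cinner g f'" by (simp add: cinner_add_left cinner_add_right)
next
  fix f g assume *: "\<And>f' g'. (f', g') \<in> {(f, g). f = S (f + g)} \<Longrightarrow> cinner f g' = cinner g f'"
  have "cinner f x = cinner (S (f + g)) x" for x
    using *[of "S x" "x - S x"]
    by (simp add: cinner_diff_right positive_contraction_sym[OF S, symmetric] cinner_add_left algebra_simps)
  then show "(f, g) \<in> {(f, g). f = S (f + g)}" using cinner_eq_zero_imp_eq by blast
next
  fix f g assume "(f, g) \<in> {(f, g). f = S (f + g)}"
  then have "(norm f)\<^sup>2 \<le> Re (cinner (f + g) f)"
    using positive_contraction_norm_le_cinner[OF S, of "f + g"] by simp
  then show "0 \<le> Re (cinner f g)"
    by (simp add: cinner_add_left Re_cinner_self Re_cinner_commute)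
qed

lemma closed_graph:
  fixes B :: "'a::complex_hilbert_space \<Rightarrow> 'a"
  assumes "positive_contraction B"
  shows "closed {(x, y). y = B x}"
proof -
  have "continuous_on UNIV (\<lambda>p::'a \<times> 'a. B (fst p))"
    by (rule linear_continuous_on[OF bounded_linear_compose[OF
            positive_contraction_bounded_linear[OF assms] bounded_linear_fst]])
  then have "closed {p::'a \<times> 'a. snd p = B (fst p)}"
    by (rule closed_Collect_eq[OF continuous_on_snd[OF continuous_on_id]])
  moreover have "{p::'a \<times> 'a. snd p = B (fst p)} = {(x, y). y = B x}" by auto
  ultimately show ?thesis by simp
qed

lemma positive_contraction_subspace_graph:
  "positive_contraction B \<Longrightarrow> subspace {(x, y). y = B x}"
  by (simp add: subspace_graph positive_contraction_bounded_linear bounded_linear.linear)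

text \<open>A null vector of a non-negative form lies in its kernel: along
  \<open>h + t *\<^sub>C g\<close> the form would be affine in \<open>t\<close> and bounded below,
  so the mixed term vanishes for every \<open>h\<close> in the dense domain.\<close>

lemma nonneg_selfadjoint_null:
  assumes R: "nonneg_selfadjoint_on UNIV R" and ga: "(g, a) \<in> R" "Re (cinner g a) \<le> 0"
  shows "a = 0"
proof -
  note D = nonneg_selfadjointD[OF R]
  have Re0: "Re (cinner a h) = 0" if hk: "(h, k) \<in> R" for h k
  proof -
    have "0 \<le> Re (cinner h k) + 2 * t * Re (cinner a h) + t\<^sup>2 * 0" for t
    proof -
      have "(h + complex_of_real t *\<^sub>C g, k + complex_of_real t *\<^sub>C a) \<in> R"
        by (intro linear_operator_add[OF D(1) hk] linear_operator_scaleC[OF D(1) ga(1)])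
      from D(5)[OF this]
      have "0 \<le> Re (cinner h k) + t * Re (cinner h a) + t * Re (cinner g k) + t * t * Re (cinner g a)"
        by (simp add: cinner_add_left cinner_add_right cinner_scaleC_left cinner_scaleC_right algebra_simps)
      moreover have "Re (cinner g k) = Re (cinner a h)" using D(3)[OF ga(1) hk] by simp
      moreover have "t * t * Re (cinner g a) \<le> 0" using ga(2) by (simp add: mult_nonneg_nonpos)
      ultimately show ?thesis by (simp add: Re_cinner_commute[of h a])
    qed
    from real_quadratic_nonneg(1)[OF this] show ?thesis by simp
  qed
  show "a = 0"
  proof (rule cinner_dense_eq[OF D(2)])
    fix h assume "h \<in> Domain R"
    then obtain k where hk: "(h, k) \<in> R" by blast
    show "cinner a h = cinner 0 h"
    proof (rule complex_eqI_Re)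
      show "Re (cinner a h) = Re (cinner 0 h)" using Re0[OF hk] by simp
      show "Re (\<i> * cinner a h) = Re (\<i> * cinner 0 h)"
        using Re0[OF linear_operator_scaleC[OF D(1) hk, of \<i>]]
        by (simp only: cinner_scaleC_right cinner_zero) simp
    qed
  qed
qed

text \<open>For \<open>P\<^sup>2 = (1 + T)\<^sup>-\<^sup>1\<close> and \<open>Q\<^sup>2 = 1 - P\<^sup>2\<close> the square root of \<open>T\<close> is \<open>Q P\<^sup>-\<^sup>1\<close>, whose graph is
  the range of the isometry \<open>x \<mapsto> (P x, Q x)\<close>.\<close>

locale sqrt_pair =
  fixes P Q :: "'a::complex_hilbert_space \<Rightarrow> 'a"
  assumes P: "positive_contraction P" and Q: "positive_contraction Q"
    and commute: "P (Q x) = Q (P x)"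
    and sum_squares: "P (P x) + Q (Q x) = x"
    and P_injective: "P x = 0 \<Longrightarrow> x = 0"
    and PQ_nonneg: "0 \<le> Re (cinner (P x) (Q x))"
begin

definition root :: "'a op" where "root = {(P x, Q x) | x. True}"

definition square :: "'a op" where "square = {(P (P x), Q (Q x)) | x. True}"

lemma root_iff: "(f, g) \<in> root \<longleftrightarrow> Q f = P g"
proof
  assume "Q f = P g"
  \<comment> \<open>\<open>(f, g) \<mapsto> P f + Q g\<close> is the adjoint of the isometry
    \<open>x \<mapsto> (P x, Q x)\<close>, hence the only candidate for a preimage.\<close>
  then have "P (P f + Q g) = f" "Q (P f + Q g) = g"
    using sum_squares[of f] sum_squares[of g]
    by (simp_all add: positive_contraction_add[OF P] positive_contraction_add[OF Q] commute)
      (simp_all add: commute[symmetric])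
  then show "(f, g) \<in> root" unfolding root_def by (auto intro!: exI[of _ "P f + Q g"])
qed (auto simp: root_def commute)

lemma root_selfadjoint: "nonneg_selfadjoint_on UNIV root"
proof (rule nonneg_selfadjointI)
  show "linear_operator root"
  proof (rule linear_operatorI)
    fix f g g' assume "(f, g) \<in> root" "(f, g') \<in> root"
    then have "P (g - g') = 0" by (simp add: root_iff positive_contraction_diff[OF P])
    then show "g = g'" using P_injective[of "g - g'"] by simp
  qed (auto simp: root_iff positive_contraction_zero[OF P] positive_contraction_zero[OF Q]
      positive_contraction_add[OF P] positive_contraction_add[OF Q]
      positive_contraction_scaleC[OF P] positive_contraction_scaleC[OF Q])
  have "Domain root = range P" unfolding root_def by auto
  then show "closure (Domain root) = UNIV"
    using dense_range_of_injective[OF positive_contraction_sym[OF P] P_injective] by simp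
next
  fix f g f' g' assume "(f, g) \<in> root" "(f', g') \<in> root"
  then show "cinner f g' = cinner g f'"
    unfolding root_def
    by (auto simp: positive_contraction_sym[OF Q, symmetric] positive_contraction_sym[OF P, symmetric] commute)
next
  fix f g assume *: "\<And>f' g'. (f', g') \<in> root \<Longrightarrow> cinner f g' = cinner g f'"
  have "cinner (Q f) x = cinner (P g) x" for x
    using *[of "P x" "Q x"]
    by (auto simp: root_def positive_contraction_sym[OF Q] positive_contraction_sym[OF P])
  then show "(f, g) \<in> root" unfolding root_iff by (rule cinner_eq_zero_imp_eq)
qed (auto simp: root_def PQ_nonneg)

lemma root_square: "root O root = square"
proof (intro subset_antisym subrelI)
  fix f h assume "(f, h) \<in> root O root"
  then obtain g where "(f, g) \<in> root" "(g, h) \<in> root" by blast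
  then obtain x y where x: "f = P x" "g = Q x" and y: "g = P y" "h = Q y" unfolding root_def by blast
  have eq: "Q x = P y" using x(2) y(1) by simp
  have "P (P x + Q y) = x" "Q (P x + Q y) = y"
    using eq sum_squares[of x] sum_squares[of y]
    by (simp_all add: positive_contraction_add[OF P] positive_contraction_add[OF Q] commute)
      (simp_all add: commute[symmetric])
  then have "(f, h) = (P (P (P x + Q y)), Q (Q (P x + Q y)))" using x y by simp
  then show "(f, h) \<in> square" unfolding square_def by blast
next
  fix f h assume "(f, h) \<in> square"
  then obtain x where x: "f = P (P x)" "h = Q (Q x)" unfolding square_def by blast
  have "(P (P x), Q (P x)) \<in> root" "(Q (P x), Q (Q x)) \<in> root"
    by (simp_all add: root_iff commute)
  then show "(f, h) \<in> root O root" unfolding x by blast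
qed

lemma square_iff: "(f, g) \<in> square \<longleftrightarrow> f = P (P (f + g))"
proof
  assume "f = P (P (f + g))"
  moreover from this have "g = Q (Q (f + g))" using sum_squares[of "f + g"] by (metis add_left_cancel)
  ultimately show "(f, g) \<in> square" unfolding square_def by blast
qed (auto simp: square_def sum_squares)

text \<open>Two commuting non-negative roots \<open>R\<close> and \<open>root\<close> of one
  operator satisfy \<open>(R + root) (R - root) = 0\<close>. Here this is applied to vectors
  regularised by the resolvent, where all compositions are defined. The assumption
  \<open>closed_commute\<close> turns commutation with \<open>P^2\<close> into commutation with
  \<open>P\<close> and \<open>Q\<close>.\<close>

lemma root_unique:
  assumes R: "nonneg_selfadjoint_on UNIV R" and RR: "R O R = square"
    and closed_commute: "\<And>G f g. closed G \<Longrightarrow> subspace G \<Longrightarrow>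
      (\<And>f g. (f, g) \<in> G \<Longrightarrow> (P (P f), P (P g)) \<in> G) \<Longrightarrow> (f, g) \<in> G \<Longrightarrow>
      (P f, P g) \<in> G \<and> (Q f, Q g) \<in> G"
  shows "R = root"
proof -
  note D = nonneg_selfadjointD[OF R]
  note E = nonneg_selfadjointD[OF root_selfadjoint]
  note addP = positive_contraction_add[OF P] and addQ = positive_contraction_add[OF Q]
  have closed: "closed R" by (rule nonneg_selfadjoint_closed[OF R])
  \<comment> \<open>\<open>R\<close> commutes with its own square, hence with the resolvent
    \<open>P^2\<close> of that square.\<close>
  have S: "(P (P f), P (P g)) \<in> R" if fg: "(f, g) \<in> R" for f g
  proof -
    define u where "u = P (P f)"
    have "(u, f - u) \<in> square" by (simp add: square_iff u_def)
    then obtain w where w: "(u, w) \<in> R" "(w, f - u) \<in> R" using RR by blast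
    have "(f - u, g - w) \<in> R" by (rule linear_operator_diff[OF D(1) fg w(1)])
    then have "(w, g - w) \<in> square" using w(2) RR by blast
    then have "w = P (P g)" by (simp add: square_iff)
    then show ?thesis using w(1) u_def by simp
  qed
  note comm = closed_commute[OF closed linear_operator_subspace[OF D(1)] S]
  have key: "(P (P (P (P x))), Q (P (P (P x)))) \<in> R" for x
  proof -
    define y where "y = P (P x)"
    have yS: "(y, x - y) \<in> square" by (simp add: square_iff y_def)
    then obtain w where w: "(y, w) \<in> R" using RR by blast
    \<comment> \<open>For \<open>u = P (P y)\<close> the vector \<open>g\<close> is
      \<open>R u - root u\<close>. Commutation gives \<open>R g = a\<close> and
      \<open>root g = - a\<close>, and non-negativity of both roots forces \<open>cinner g a\<close>
      to have real part 0.\<close>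
    define g where "g = P (P w) - Q (P y)"
    define a where "a = y - P (P y) - Q (P w)"
    have Sw: "(P (P y), P (P w)) \<in> R" by (rule S[OF w])
    have "(P (P y), y - P (P y)) \<in> square" by (simp add: square_iff)
    then obtain m where m: "(P (P y), m) \<in> R" "(m, y - P (P y)) \<in> R" using RR by blast
    have "m = P (P w)" by (rule linear_operator_unique[OF D(1) m(1) Sw])
    then have 1: "(P (P w), y - P (P y)) \<in> R" using m(2) by simp
    have 2: "(Q (P y), Q (P w)) \<in> R" using comm w by blast
    have gR: "(g, a) \<in> R" unfolding g_def a_def by (rule linear_operator_diff[OF D(1) 1 2])
    have 3: "(P (P w), Q (P w)) \<in> root" by (simp add: root_iff commute)
    have "y - P (P y) = Q (Q y)" using sum_squares[of y] by (metis add_diff_cancel_left')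
    then have 4: "(Q (P y), y - P (P y)) \<in> root" by (simp add: root_iff commute)
    have groot: "(g, - a) \<in> root"
      using linear_operator_diff[OF E(1) 3 4] unfolding g_def a_def by simp
    have "Re (cinner g a) \<le> 0" using E(5)[OF groot] by (simp add: cinner_minus_right)
    then have a: "a = 0" by (rule nonneg_selfadjoint_null[OF R gR])
    \<comment> \<open>With \<open>a = 0\<close> both roots annihilate \<open>g\<close>, so by
      symmetry \<open>g\<close> is orthogonal to \<open>R u\<close> and to \<open>root u\<close>,
      hence to their difference, which is \<open>g\<close> itself.\<close>
    have "cinner g (P (P w)) = 0" using D(3)[OF gR Sw] a by simp
    moreover have "(P (P y), Q (P y)) \<in> root" by (simp add: root_iff commute)
    then have "cinner g (Q (P y)) = 0" using E(3)[OF groot] a by simp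
    ultimately have "cinner g g = 0" by (subst (2) g_def) (simp add: cinner_diff_right)
    then have "P (P w) = Q (P y)" unfolding g_def by (simp add: cinner_self)
    then show ?thesis using Sw unfolding y_def by simp
  qed
  \<comment> \<open>The pairs found so far are \<open>(P z, Q z)\<close> with \<open>z\<close> in
    the range of \<open>P^3\<close>. This range is dense, and a closed \<open>R\<close> then
    contains the pairs for all \<open>z\<close>.\<close>
  have P3: "closure (range (\<lambda>x. P (P (P x)))) = UNIV"
    by (rule dense_range_of_injective) (auto simp: positive_contraction_sym[OF P] dest!: P_injective)
  have sub: "(P z, Q z) \<in> R" for z
  proof -
    have "z \<in> closure (range (\<lambda>x. P (P (P x))))" using P3 by simp
    then obtain s where s: "\<And>n. s n \<in> range (\<lambda>x. P (P (P x)))" "s \<longlonglongrightarrow> z"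
      unfolding closure_sequential by blast
    have "(P (s n), Q (s n)) \<in> R" for n using s(1)[of n] key by auto
    moreover have "(\<lambda>n. (P (s n), Q (s n))) \<longlonglongrightarrow> (P z, Q z)"
      by (rule tendsto_Pair[OF bounded_linear.tendsto[OF positive_contraction_bounded_linear[OF P] s(2)]
            bounded_linear.tendsto[OF positive_contraction_bounded_linear[OF Q] s(2)]])
    ultimately show ?thesis by (rule closed_sequentially[OF closed])
  qed
  then have "root \<subseteq> R" unfolding root_def by auto
  moreover have "(f, g) \<in> root" if "(f, g) \<in> R" for f g
  proof (rule E(4))
    fix f' g' assume "(f', g') \<in> root"
    then have "(f', g') \<in> R" using \<open>root \<subseteq> R\<close> by auto
    then show "cinner f g' = cinner g f'" by (rule D(3)[OF that])
  qed
  ultimately show ?thesis by auto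
qed

end

text \<open>\<open>P\<close> and \<open>Q\<close> are the roots of the resolvent and of its
  complement. Their commutation, and that needed for uniqueness, comes from the clause on closed
  invariant subspaces of pairs in \<open>positive_contraction_sqrt\<close>.\<close>

lemma nonneg_selfadjoint_sqrt:
  fixes T :: "'a::complex_hilbert_space op"
  assumes T: "nonneg_selfadjoint_on UNIV T"
  obtains P Q where "sqrt_pair P Q" "T = sqrt_pair.square P Q" "op_sqrt T = sqrt_pair.root P Q"
proof -
  obtain S where S: "positive_contraction S" and TS: "T = {(f, g). f = S (f + g)}"
    by (rule nonneg_selfadjoint_resolvent[OF T])
  note D = nonneg_selfadjointD[OF T]
  have inj: "x = 0" if "S x = 0" for x
  proof -
    have "(0, x) \<in> T" unfolding TS using that by simp
    then show "x = 0" using linear_operator_unique[OF D(1) _ linear_operator_zero[OF D(1)]] by blast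
  qed
  obtain P where P_all: "positive_contraction P \<and> (\<forall>x. P (P x) = S x) \<and>
    (\<forall>G. closed G \<and> subspace G \<and> (\<forall>f g. (f, g) \<in> G \<longrightarrow> (S f, S g) \<in> G) \<longrightarrow>
       (\<forall>f g. (f, g) \<in> G \<longrightarrow> (P f, P g) \<in> G))"
    using positive_contraction_sqrt[OF S] ..
  have P: "positive_contraction P" and PP: "P (P x) = S x" for x using P_all by auto
  have Pc: "(P f, P g) \<in> G" if "closed G" "subspace G" "\<And>f g. (f, g) \<in> G \<Longrightarrow> (S f, S g) \<in> G"
    "(f, g) \<in> G" for G f g
    using P_all[THEN conjunct2, THEN conjunct2, rule_format, of G f g] that by simp
  obtain Q where Q_all: "positive_contraction Q \<and> (\<forall>x. Q (Q x) = x - S x) \<and>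
    (\<forall>G. closed G \<and> subspace G \<and> (\<forall>f g. (f, g) \<in> G \<longrightarrow> (f - S f, g - S g) \<in> G) \<longrightarrow>
       (\<forall>f g. (f, g) \<in> G \<longrightarrow> (Q f, Q g) \<in> G))"
    using positive_contraction_sqrt[OF positive_contraction_complement[OF S]] ..
  have Q: "positive_contraction Q" and QQ: "Q (Q x) = x - S x" for x using Q_all by auto
  have Qc: "(Q f, Q g) \<in> G" if "closed G" "subspace G"
    "\<And>f g. (f, g) \<in> G \<Longrightarrow> (f - S f, g - S g) \<in> G" "(f, g) \<in> G" for G f g
    using Q_all[THEN conjunct2, THEN conjunct2, rule_format, of G f g] that by simp
  have SP: "S (P x) = P (S x)" for x by (simp add: PP[symmetric])
  have comm: "P (Q x) = Q (P x)" for x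
  proof -
    have "(Q x, Q (P x)) \<in> {(x, y). y = P x}"
      by (rule Qc[OF closed_graph[OF P] positive_contraction_subspace_graph[OF P]])
        (auto simp: positive_contraction_diff[OF P] SP)
    then show ?thesis by simp
  qed
  \<comment> \<open>The root \<open>P'\<close> of \<open>P\<close> serves to show
    \<open>PQ_nonneg\<close>: as it commutes with \<open>Q\<close>,
    \<open>cinner (P x) (Q x)\<close> equals \<open>cinner (P' x) (Q (P' x))\<close>.\<close>
  obtain P' where P'_all: "positive_contraction P' \<and> (\<forall>x. P' (P' x) = P x) \<and>
    (\<forall>G. closed G \<and> subspace G \<and> (\<forall>f g. (f, g) \<in> G \<longrightarrow> (P f, P g) \<in> G) \<longrightarrow>
       (\<forall>f g. (f, g) \<in> G \<longrightarrow> (P' f, P' g) \<in> G))"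
    using positive_contraction_sqrt[OF P] ..
  have P': "positive_contraction P'" and P'2: "P' (P' x) = P x" for x using P'_all by auto
  have P'c: "(P' f, P' g) \<in> G" if "closed G" "subspace G" "\<And>f g. (f, g) \<in> G \<Longrightarrow> (P f, P g) \<in> G"
    "(f, g) \<in> G" for G f g
    using P'_all[THEN conjunct2, THEN conjunct2, rule_format, of G f g] that by simp
  have comm': "P' (Q x) = Q (P' x)" for x
  proof -
    have "(P' x, P' (Q x)) \<in> {(x, y). y = Q x}"
      by (rule P'c[OF closed_graph[OF Q] positive_contraction_subspace_graph[OF Q]])
        (auto simp: comm)
    then show ?thesis by simp
  qed
  interpret sqrt_pair P Q
  proof
    show "0 \<le> Re (cinner (P x) (Q x))" for x
    proof -
      have "cinner (P x) (Q x) = cinner (P' x) (Q (P' x))"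
        by (simp add: P'2[symmetric] positive_contraction_sym[OF P', symmetric] comm')
      then show ?thesis using positive_contraction_nonneg[OF Q] by simp
    qed
    show "x = 0" if "P x = 0" for x
      by (rule inj) (simp add: PP[symmetric] that positive_contraction_zero[OF P])
  qed (simp_all add: P Q comm PP QQ)
  have sq: "T = square"
    unfolding TS by (auto simp: square_iff PP)
  have Rc: "(P f, P g) \<in> G \<and> (Q f, Q g) \<in> G"
    if G: "closed G" "subspace G" "\<And>f g. (f, g) \<in> G \<Longrightarrow> (P (P f), P (P g)) \<in> G" "(f, g) \<in> G"
    for G f g
  proof -
    have GS: "(S f, S g) \<in> G" if "(f, g) \<in> G" for f g using G(3)[OF that] by (simp add: PP)
    have "(f - S f, g - S g) \<in> G" if "(f, g) \<in> G" for f g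
      using subspace_diff[OF G(2) that GS[OF that]] by simp
    then show ?thesis using Pc[OF G(1,2) GS G(4)] Qc[OF G(1,2) _ G(4)] by simp
  qed
  have "op_sqrt T = root"
    unfolding op_sqrt_on_def
  proof (rule the_equality)
    show "nonneg_selfadjoint_on UNIV root \<and> root O root = T"
      using root_selfadjoint root_square sq by simp
    show "R = root" if R: "nonneg_selfadjoint_on UNIV R \<and> R O R = T" for R
    proof (rule root_unique)
      show "nonneg_selfadjoint_on UNIV R" "R O R = square" using R sq by simp_all
    qed (rule Rc)
  qed
  then show ?thesis by (rule that[OF sqrt_pair_axioms sq])
qed

lemma op_sqrt_selfadjoint:
  assumes "nonneg_selfadjoint_on UNIV T"
  shows "nonneg_selfadjoint_on UNIV (op_sqrt T)" and "op_sqrt T O op_sqrt T = T"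
proof -
  obtain P Q where *: "sqrt_pair P Q" "T = sqrt_pair.square P Q" "op_sqrt T = sqrt_pair.root P Q"
    by (rule nonneg_selfadjoint_sqrt[OF assms])
  show "nonneg_selfadjoint_on UNIV (op_sqrt T)" "op_sqrt T O op_sqrt T = T"
    using sqrt_pair.root_selfadjoint[OF *(1)] sqrt_pair.root_square[OF *(1)] *(2,3) by simp_all
qed

section \<open>The Krein-von Neumann extension\<close>

lemma norm_le_of_Re_le:
  assumes "\<And>u. norm u \<le> 1 \<Longrightarrow> \<bar>Re (u * c)\<bar> \<le> r"
  shows "norm c \<le> r"
proof (cases "c = 0")
  case True
  then show ?thesis using assms[of 0] by simp
next
  case False
  have "cnj (sgn c) * c = of_real (norm c)"
    using False complex_norm_square[of c]
    by (simp add: sgn_div_norm scaleR_conv_of_real power2_eq_square field_simps)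
  then have "\<bar>Re (cnj (sgn c) * c)\<bar> = norm c" by simp
  then show ?thesis using assms[of "cnj (sgn c)"] by (simp add: norm_sgn)
qed

text \<open>The form \<open>Re (cinner (f + g) g)\<close> on the graph of \<open>V\<close> is that of the contraction
  \<open>f + V f \<mapsto> V f\<close>; \<open>Z\<close> is its smallest non-negative extension, the complement of the resolvent
  of the Krein-von Neumann extension.\<close>

lemma minimal_nonneg_extension:
  fixes V :: "'a::complex_hilbert_space op"
  assumes lin: "linear_operator V"
    and sym: "\<And>f g f' g'. (f, g) \<in> V \<Longrightarrow> (f', g') \<in> V \<Longrightarrow> cinner f g' = cinner g f'"
    and nonneg: "\<And>f g. (f, g) \<in> V \<Longrightarrow> 0 \<le> Re (cinner f g)"
  shows "\<exists>Z. positive_contraction Z \<and> (\<forall>f g. (f, g) \<in> V \<longrightarrow> Z (f + g) = g) \<and>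
    (\<forall>x. \<exists>p. (\<forall>j::nat. p j \<in> V) \<and>
       (\<lambda>j. Re (cinner (x - (fst (p j) + snd (p j))) (Z (x - (fst (p j) + snd (p j)))))) \<longlonglongrightarrow> 0)"
proof -
  define \<beta> where "\<beta> p = Re (cinner (fst p + snd p) (snd p))" for p :: "'a \<times> 'a"
  have \<beta>: "(norm (snd p))\<^sup>2 \<le> \<beta> p" if "p \<in> V" for p
    using nonneg[of "fst p" "snd p"] that by (simp add: \<beta>_def cinner_add_left Re_cinner_self)
  have \<beta>0: "0 \<le> \<beta> p" if "p \<in> V" for p using \<beta>[OF that] by (meson order_trans zero_le_power2)
  have \<beta>norm: "norm (snd p) \<le> sqrt (\<beta> p)" if "p \<in> V" for p
    using real_sqrt_le_mono[OF \<beta>[OF that]] by simp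
  \<comment> \<open>\<open>K x z p e\<close> says that \<open>z\<close> is a value of the sought map
    at \<open>x\<close>, witnessed by a sequence \<open>p\<close> in \<open>V\<close> whose vectors
    \<open>f + V f\<close> imitate \<open>x\<close> on the range of \<open>V\<close> up to an error
    of rate \<open>e\<close> in the form norm. That \<open>z\<close> is determined by
    \<open>x\<close> is shown only after symmetry, so \<open>Z\<close> is first picked by
    choice.\<close>
  define K where "K x z p e \<longleftrightarrow> (\<forall>j. p j \<in> V) \<and> e \<longlonglongrightarrow> 0 \<and> (\<lambda>j. snd (p j)) \<longlonglongrightarrow> z \<and>
      (\<forall>j. \<forall>r\<in>V. norm (cinner (x - (fst (p j) + snd (p j))) (snd r)) \<le> e j * sqrt (\<beta> r))"
    for x z and p :: "nat \<Rightarrow> 'a \<times> 'a" and e :: "nat \<Rightarrow> real"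
  have ex: "\<exists>z p e. K x z p e" for x
  proof -
    obtain p z where p: "\<And>j::nat. p j \<in> V" and z: "(\<lambda>j. snd (p j)) \<longlonglongrightarrow> z"
      and approx: "\<And>j r. r \<in> V \<Longrightarrow>
        (Re (cinner x (snd r)) - Re (cinner (fst (p j) + snd (p j)) (snd r)))\<^sup>2
          \<le> inverse (real (Suc j)) * Re (cinner (fst r + snd r) (snd r))"
    proof (rule riesz_sequence[where E = V and b = "\<lambda>p r. Re (cinner (fst p + snd p) (snd r))"
          and \<phi> = "\<lambda>r. Re (cinner x (snd r))" and c = "(norm x)\<^sup>2" and J = snd])
      show "subspace V" by (rule linear_operator_subspace[OF lin])
      show "Re (cinner (fst p + snd p) (snd r)) = Re (cinner (fst r + snd r) (snd p))"
        if "p \<in> V" "r \<in> V" for p r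
        using sym[of "fst p" "snd p" "fst r" "snd r"] that
        by (simp add: cinner_add_left Re_cinner_commute)
      show "(norm (snd p))\<^sup>2 \<le> Re (cinner (fst p + snd p) (snd p))" if "p \<in> V" for p
        using \<beta>[OF that] unfolding \<beta>_def .
      show "(Re (cinner x (snd p)))\<^sup>2 \<le> (norm x)\<^sup>2 * Re (cinner (fst p + snd p) (snd p))"
        if "p \<in> V" for p
      proof -
        have "\<bar>Re (cinner x (snd p))\<bar> \<le> norm x * norm (snd p)"
          by (meson abs_Re_le_cmod norm_cinner_le order_trans)
        then have "\<bar>Re (cinner x (snd p))\<bar>\<^sup>2 \<le> (norm x * norm (snd p))\<^sup>2" by (rule power_mono) simp
        then show ?thesis using mult_left_mono[OF \<beta>[OF that], of "(norm x)\<^sup>2"]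
          by (simp add: power_mult_distrib \<beta>_def)
      qed
    qed (auto simp: cinner_add_left cinner_add_right cinner_scaleR_left cinner_scaleR_right
        linear_snd distrib_left)
    define e where "e j = sqrt (inverse (real (Suc j)))" for j
    have "norm (cinner (x - (fst (p j) + snd (p j))) (snd r)) \<le> e j * sqrt (\<beta> r)" if r: "r \<in> V" for j r
    proof (rule norm_le_of_Re_le)
      fix u :: complex assume u: "norm u \<le> 1"
      let ?r = "(u *\<^sub>C fst r, u *\<^sub>C snd r)"
      have rV: "?r \<in> V" using linear_operator_scaleC[OF lin, of "fst r" "snd r" u] r by simp
      have "\<beta> ?r = (norm u)\<^sup>2 * \<beta> r"
      proof -
        have "cinner (u *\<^sub>C fst r + u *\<^sub>C snd r) (u *\<^sub>C snd r)
            = (u * cnj u) * cinner (fst r + snd r) (snd r)"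
          by (simp add: scaleC_add_right[symmetric] cinner_scaleC_left cinner_scaleC_right)
        then show ?thesis unfolding \<beta>_def fst_conv snd_conv complex_norm_square[symmetric]
          by (simp only: Re_complex_of_real times_complex.sel Im_complex_of_real)
      qed
      moreover have "(norm u)\<^sup>2 * \<beta> r \<le> \<beta> r"
        using u \<beta>0[OF r] by (simp add: mult_left_le_one_le power_le_one)
      ultimately have "inverse (real (Suc j)) * \<beta> ?r \<le> inverse (real (Suc j)) * \<beta> r"
        by (intro mult_left_mono) auto
      with approx[OF rV, of j]
      have "(Re (u * cinner (x - (fst (p j) + snd (p j))) (snd r)))\<^sup>2 \<le> inverse (real (Suc j)) * \<beta> r"
        unfolding \<beta>_def[of ?r, symmetric, unfolded fst_conv snd_conv] fst_conv snd_conv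
        by (simp add: cinner_scaleC_right cinner_diff_left right_diff_distrib \<beta>_def)
      from real_sqrt_le_mono[OF this]
      show "\<bar>Re (u * cinner (x - (fst (p j) + snd (p j))) (snd r))\<bar> \<le> e j * sqrt (\<beta> r)"
        by (simp add: e_def real_sqrt_mult)
    qed
    moreover have "e \<longlonglongrightarrow> 0"
      using tendsto_real_sqrt[OF LIMSEQ_inverse_real_of_nat] unfolding e_def by simp
    ultimately have "K x z p e" unfolding K_def using p z by simp
    then show ?thesis by blast
  qed
  \<comment> \<open>The form norm stays bounded along the sequence, so an error that is relative to
    the form norm tends to 0.\<close>
  have \<beta>_bound: "sqrt (\<beta> (p j)) \<le> norm x + \<bar>e j\<bar>" if K: "K x z p e" for x z p e j
  proof -
    define s where "s = sqrt (\<beta> (p j))"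
    have pV: "p j \<in> V" using K unfolding K_def by blast
    have s0: "0 \<le> s" using \<beta>0[OF pV] unfolding s_def by simp
    have "s * s = Re (cinner (fst (p j) + snd (p j)) (snd (p j)))"
      using \<beta>0[OF pV] unfolding s_def by (simp add: \<beta>_def)
    also have "\<dots> = Re (cinner x (snd (p j)) - cinner (x - (fst (p j) + snd (p j))) (snd (p j)))"
      by (simp add: cinner_diff_left)
    also have "\<dots> \<le> norm (cinner x (snd (p j))) + norm (cinner (x - (fst (p j) + snd (p j))) (snd (p j)))"
      by (meson complex_Re_le_cmod norm_triangle_ineq4 order_trans)
    also have "\<dots> \<le> norm x * s + \<bar>e j\<bar> * s"
    proof (rule add_mono)
      show "norm (cinner x (snd (p j))) \<le> norm x * s"
        using norm_cinner_le[of x "snd (p j)"] \<beta>norm[OF pV] unfolding s_def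
        by (meson mult_left_mono norm_ge_zero order_trans)
      have "norm (cinner (x - (fst (p j) + snd (p j))) (snd (p j))) \<le> e j * s"
        using K pV unfolding K_def s_def by blast
      also have "\<dots> \<le> \<bar>e j\<bar> * s" using s0 by (simp add: mult_right_mono)
      finally show "norm (cinner (x - (fst (p j) + snd (p j))) (snd (p j))) \<le> \<bar>e j\<bar> * s" .
    qed
    finally have le: "s * s \<le> (norm x + \<bar>e j\<bar>) * s" by (simp add: distrib_right)
    show ?thesis
    proof (cases "s = 0")
      case True
      then show ?thesis unfolding s_def by simp
    next
      case False
      with s0 have "0 < s" by simp
      with le have "s \<le> norm x + \<bar>e j\<bar>" by (rule mult_right_le_imp_le)
      then show ?thesis unfolding s_def .
    qed
  qed
  have lim: "(\<lambda>j. cinner (fst (p j) + snd (p j)) (snd (p' j))) \<longlonglongrightarrow> cinner x z'"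
    if K: "K x z p e" and K': "K x' z' p' e'" for x z p e x' z' p' e'
  proof -
    have "(\<lambda>j. cinner (x - (fst (p j) + snd (p j))) (snd (p' j))) \<longlonglongrightarrow> 0"
    proof (rule Lim_null_comparison)
      have "norm (cinner (x - (fst (p j) + snd (p j))) (snd (p' j)))
          \<le> \<bar>e j\<bar> * (norm x' + \<bar>e' j\<bar>)" for j
      proof -
        have p'V: "p' j \<in> V" using K' unfolding K_def by blast
        then have "norm (cinner (x - (fst (p j) + snd (p j))) (snd (p' j))) \<le> e j * sqrt (\<beta> (p' j))"
          using K unfolding K_def by blast
        also have "\<dots> \<le> \<bar>e j\<bar> * sqrt (\<beta> (p' j))"
          using \<beta>0[OF p'V] by (simp add: mult_right_mono)
        also have "\<dots> \<le> \<bar>e j\<bar> * (norm x' + \<bar>e' j\<bar>)"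
          by (rule mult_left_mono[OF \<beta>_bound[OF K']]) simp
        finally show ?thesis .
      qed
      then show "\<forall>\<^sub>F j in sequentially. norm (cinner (x - (fst (p j) + snd (p j))) (snd (p' j)))
          \<le> \<bar>e j\<bar> * (norm x' + \<bar>e' j\<bar>)" by (intro always_eventually allI)
      have e0: "(\<lambda>j. \<bar>e j\<bar>) \<longlonglongrightarrow> 0" "(\<lambda>j. \<bar>e' j\<bar>) \<longlonglongrightarrow> 0"
        using K K' unfolding K_def by (simp_all add: tendsto_rabs_zero)
      show "(\<lambda>j. \<bar>e j\<bar> * (norm x' + \<bar>e' j\<bar>)) \<longlonglongrightarrow> 0"
        using tendsto_mult[OF e0(1) tendsto_add[OF tendsto_const e0(2)]] by simp
    qed
    moreover have "(\<lambda>j. cinner x (snd (p' j))) \<longlonglongrightarrow> cinner x z'"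
      using K' unfolding K_def by (intro tendsto_cinner tendsto_const) auto
    ultimately have "(\<lambda>j. cinner x (snd (p' j)) - cinner (x - (fst (p j) + snd (p j))) (snd (p' j)))
        \<longlonglongrightarrow> cinner x z' - 0" by (intro tendsto_diff)
    then show ?thesis by (simp add: cinner_diff_left)
  qed
  have Ksym: "cinner x z' = cinner z x'" if K: "K x z p e" and K': "K x' z' p' e'" for x z p e x' z' p' e'
  proof -
    have "cnj (cinner (fst (p' j) + snd (p' j)) (snd (p j))) = cinner (fst (p j) + snd (p j)) (snd (p' j))"
      for j
    proof -
      have "(fst (p j), snd (p j)) \<in> V" "(fst (p' j), snd (p' j)) \<in> V"
        using K K' unfolding K_def by auto
      from sym[OF this] show ?thesis
        unfolding cinner_commute[of "snd (p j)" "fst (p' j) + snd (p' j)", symmetric]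
        by (simp add: cinner_add_left cinner_add_right)
    qed
    with tendsto_cnj[OF lim[OF K' K]]
    have "(\<lambda>j. cinner (fst (p j) + snd (p j)) (snd (p' j))) \<longlonglongrightarrow> cnj (cinner x' z)" by simp
    with lim[OF K K'] have "cinner x z' = cnj (cinner x' z)" by (rule LIMSEQ_unique)
    then show ?thesis by (simp only: cinner_commute[symmetric])
  qed
  define Z where "Z x = (SOME z. \<exists>p e. K x z p e)" for x
  have Z: "\<exists>p e. K x (Z x) p e" for x
    unfolding Z_def using ex[of x] by (rule someI_ex)
  have Zsym: "cinner x (Z y) = cinner (Z x) y" for x y
    using Z[of x] Z[of y] Ksym by blast
  \<comment> \<open>Uniqueness follows from symmetry: the inner products of any admissible
    \<open>z\<close> with an arbitrary \<open>y\<close> are already fixed by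
    \<open>Z y\<close>.\<close>
  have Zeq: "Z x = z" if K: "K x z p e" for x z p e
  proof (rule cinner_eq_zero_imp_eq)
    fix y
    obtain p' e' where "K y (Z y) p' e'" using Z by blast
    from Ksym[OF K this] show "cinner (Z x) y = cinner z y" by (simp add: Zsym)
  qed
  have Zpc: "positive_contraction Z"
    unfolding positive_contraction_def
  proof (intro conjI allI)
    fix x
    obtain p e where K: "K x (Z x) p e" using Z by blast
    show "(norm (Z x))\<^sup>2 \<le> Re (cinner x (Z x))"
    proof (rule LIMSEQ_le)
      show "(\<lambda>j. (norm (snd (p j)))\<^sup>2) \<longlonglongrightarrow> (norm (Z x))\<^sup>2"
        using K unfolding K_def by (intro tendsto_power tendsto_norm) auto
      show "(\<lambda>j. Re (cinner (fst (p j) + snd (p j)) (snd (p j)))) \<longlonglongrightarrow> Re (cinner x (Z x))"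
        by (rule tendsto_Re[OF lim[OF K K]])
      show "\<exists>N. \<forall>n\<ge>N. (norm (snd (p n)))\<^sup>2 \<le> Re (cinner (fst (p n) + snd (p n)) (snd (p n)))"
        using \<beta> K unfolding K_def \<beta>_def by blast
    qed
  qed (rule Zsym)
  have ZV: "Z (f + g) = g" if "(f, g) \<in> V" for f g
  proof (rule Zeq)
    show "K (f + g) g (\<lambda>j. (f, g)) (\<lambda>j. 0)" unfolding K_def using that by simp
  qed
  \<comment> \<open>Extremality of \<open>Z\<close>: the vectors \<open>f + V f\<close> are dense
    for the seminorm given by \<open>cinner x (Z x)\<close>. In the expanded square the three limits
    are equal up to the factors 1, -2 and 1.\<close>
  have "\<exists>p. (\<forall>j::nat. p j \<in> V) \<and>
       (\<lambda>j. Re (cinner (x - (fst (p j) + snd (p j))) (Z (x - (fst (p j) + snd (p j)))))) \<longlonglongrightarrow> 0" for x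
  proof -
    obtain p e where K: "K x (Z x) p e" using Z by blast
    have pV: "p j \<in> V" for j using K unfolding K_def by blast
    have eq: "Re (cinner (x - (fst (p j) + snd (p j))) (Z (x - (fst (p j) + snd (p j)))))
        = Re (cinner x (Z x)) - 2 * Re (cinner x (snd (p j)))
          + Re (cinner (fst (p j) + snd (p j)) (snd (p j)))" for j
    proof -
      have Zn: "Z (fst (p j) + snd (p j)) = snd (p j)" using ZV[of "fst (p j)" "snd (p j)"] pV by simp
      have "cinner (fst (p j) + snd (p j)) (Z x) = cinner (snd (p j)) x" by (simp only: Zsym Zn)
      then show ?thesis
        by (simp only: positive_contraction_diff[OF Zpc] Zn cinner_diff_left cinner_diff_right
            minus_complex.sel) (simp add: Re_cinner_commute)
    qed
    have "(\<lambda>j. Re (cinner x (Z x)) - 2 * Re (cinner x (snd (p j)))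
          + Re (cinner (fst (p j) + snd (p j)) (snd (p j)))) \<longlonglongrightarrow>
        Re (cinner x (Z x)) - 2 * Re (cinner x (Z x)) + Re (cinner x (Z x))"
    proof (intro tendsto_add tendsto_diff tendsto_const tendsto_mult)
      show "(\<lambda>j. Re (cinner x (snd (p j)))) \<longlonglongrightarrow> Re (cinner x (Z x))"
        using K unfolding K_def by (intro tendsto_Re tendsto_cinner tendsto_const) auto
      show "(\<lambda>j. Re (cinner (fst (p j) + snd (p j)) (snd (p j)))) \<longlonglongrightarrow> Re (cinner x (Z x))"
        by (rule tendsto_Re[OF lim[OF K K]])
    qed
    then show ?thesis using pV unfolding eq[symmetric] by auto
  qed
  with Zpc ZV show ?thesis by blast
qed

text \<open>Moving one root across gives \<open>cinner v g = cinner k h\<close> with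
  \<open>h\<close> the root applied to \<open>f\<close>, and Cauchy-Schwarz applies. This easy half
  of the form description holds for every non-negative selfadjoint operator, in particular for all
  competing extensions of \<open>V\<close>.\<close>

lemma sqrt_form_bound:
  assumes T: "nonneg_selfadjoint_on UNIV T" and fg: "(f, g) \<in> T" and vk: "(v, k) \<in> op_sqrt T"
  shows "(norm (cinner v g))\<^sup>2 \<le> (norm k)\<^sup>2 * Re (cinner f g)"
proof -
  note R = op_sqrt_selfadjoint[OF T]
  note D = nonneg_selfadjointD[OF R(1)]
  obtain h where h: "(f, h) \<in> op_sqrt T" "(h, g) \<in> op_sqrt T" using fg R(2) by blast
  have "cinner v g = cinner k h" by (rule D(3)[OF vk h(2)])
  then have "(norm (cinner v g))\<^sup>2 \<le> (norm k * norm h)\<^sup>2"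
    by (simp add: norm_cinner_le power_mono)
  moreover have "cinner f g = cinner h h" by (rule D(3)[OF h(1) h(2)])
  ultimately show ?thesis by (simp add: Re_cinner_self power_mult_distrib)
qed

text \<open>The hard half of the form description. For \<open>x = f + V f\<close> the assumption
  reads \<open>norm (cinner v (Q (Q x))) \<le> sqrt c * norm (P (Q x))\<close>. Once this is
  extended to \<open>norm (cinner v (Q y)) \<le> sqrt c * norm (P y)\<close> for all
  \<open>y\<close>, Riesz on the range of \<open>P\<close> yields \<open>k\<close> with
  \<open>Q v = P k\<close>, which is membership in the root.\<close>

lemma krein_sqrt_domain:
  fixes V :: "'a::complex_hilbert_space op"
  assumes pair: "sqrt_pair P Q" and Z: "\<And>x. Q (Q x) = Z x"
    and ZV: "\<And>f g. (f, g) \<in> V \<Longrightarrow> Z (f + g) = g"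
    and approx: "\<And>x. \<exists>p. (\<forall>j::nat. p j \<in> V) \<and>
       (\<lambda>j. Re (cinner (x - (fst (p j) + snd (p j))) (Z (x - (fst (p j) + snd (p j)))))) \<longlonglongrightarrow> 0"
    and c: "0 \<le> c" and bound: "\<And>f g. (f, g) \<in> V \<Longrightarrow> (norm (cinner v g))\<^sup>2 \<le> c * Re (cinner f g)"
  shows "\<exists>k. (v, k) \<in> sqrt_pair.root P Q \<and> (norm k)\<^sup>2 \<le> c"
proof -
  interpret sqrt_pair P Q by (rule pair)
  note addP = positive_contraction_add[OF P] and addQ = positive_contraction_add[OF Q]
  note tP = bounded_linear.tendsto[OF positive_contraction_bounded_linear[OF P]]
  note tQ = bounded_linear.tendsto[OF positive_contraction_bounded_linear[OF Q]]
  \<comment> \<open>Both sides depend on \<open>x\<close> only through \<open>Q x\<close>, and the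
    approximation hypothesis says exactly that \<open>Q\<close> of the vectors
    \<open>f + V f\<close> approaches \<open>Q x\<close>.\<close>
  have range: "norm (cinner v (Q (Q x))) \<le> sqrt c * norm (P (Q x))" for x
  proof -
    obtain p where pV: "\<And>j::nat. p j \<in> V" and
      p: "(\<lambda>j. Re (cinner (x - (fst (p j) + snd (p j))) (Z (x - (fst (p j) + snd (p j)))))) \<longlonglongrightarrow> 0"
      using approx[of x] by blast
    define n where "n j = fst (p j) + snd (p j)" for j
    have nb: "norm (cinner v (Q (Q (n j)))) \<le> sqrt c * norm (P (Q (n j)))" for j
    proof -
      have fg: "(fst (p j), snd (p j)) \<in> V" using pV by simp
      have g: "Q (Q (n j)) = snd (p j)" unfolding n_def by (simp only: Z ZV[OF fg])
      then have f: "P (P (n j)) = fst (p j)"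
        using sum_squares[of "n j"] unfolding n_def by (metis add_right_cancel)
      have "cinner (P (P (n j))) (Q (Q (n j))) = cinner (P (Q (n j))) (P (Q (n j)))"
        by (simp add: positive_contraction_sym[OF P, symmetric] positive_contraction_sym[OF Q, symmetric]
            commute)
      then have "Re (cinner (fst (p j)) (snd (p j))) = (norm (P (Q (n j))))\<^sup>2"
        by (simp add: f g Re_cinner_self)
      with bound[OF fg] have "(norm (cinner v (Q (Q (n j)))))\<^sup>2 \<le> c * (norm (P (Q (n j))))\<^sup>2"
        by (simp add: g)
      from real_sqrt_le_mono[OF this] show ?thesis by (simp add: real_sqrt_mult)
    qed
    have "(\<lambda>j. (norm (Q (x - n j)))\<^sup>2) \<longlonglongrightarrow> 0"
    proof -
      have "(norm (Q y))\<^sup>2 = Re (cinner y (Z y))" for y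
        unfolding Z[symmetric] positive_contraction_sym[OF Q, of y "Q y"] by (simp add: Re_cinner_self)
      then show ?thesis using p by (simp add: n_def)
    qed
    from tendsto_real_sqrt[OF this] have "(\<lambda>j. Q (x - n j)) \<longlonglongrightarrow> 0"
      by (simp add: tendsto_norm_zero_iff)
    from tendsto_diff[OF tendsto_const[of "Q x"] this]
    have lim: "(\<lambda>j. Q (n j)) \<longlonglongrightarrow> Q x"
      by (simp add: positive_contraction_diff[OF Q])
    show ?thesis
    proof (rule LIMSEQ_le)
      show "(\<lambda>j. norm (cinner v (Q (Q (n j))))) \<longlonglongrightarrow> norm (cinner v (Q (Q x)))"
        by (intro tendsto_norm tendsto_cinner tendsto_const tQ[OF lim])
      show "(\<lambda>j. sqrt c * norm (P (Q (n j)))) \<longlonglongrightarrow> sqrt c * norm (P (Q x))"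
        by (intro tendsto_mult tendsto_const tendsto_norm tP[OF lim])
    qed (use nb in auto)
  qed
  \<comment> \<open>Split \<open>y\<close> along the closure of the range of \<open>Q\<close> and
    the kernel of \<open>Q\<close>. On the kernel \<open>P^2\<close> is the identity, so
    \<open>P\<close> keeps the two parts orthogonal, and dropping the kernel part only decreases
    \<open>norm (P y)\<close>.\<close>
  have bound_Q: "norm (cinner v (Q y)) \<le> sqrt c * norm (P y)" for y
  proof -
    have sub: "complex_vector.subspace (range Q)"
      unfolding complex_vector.subspace_def
      using positive_contraction_zero[OF Q] rangeI[of Q 0]
      by (auto simp: addQ[symmetric] positive_contraction_scaleC[OF Q, symmetric])
    obtain y1 where y1: "y1 \<in> closure (range Q)" "\<forall>s\<in>closure (range Q). cinner (y - y1) s = 0"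
      using closure_projection[OF sub, of y] ..
    define y2 where "y2 = y - y1"
    have y: "y = y1 + y2" by (simp add: y2_def)
    have Qy2: "Q y2 = 0"
    proof (rule cinner_eq_zero_imp_eq)
      fix z
      have "Q z \<in> closure (range Q)" by (rule subsetD[OF closure_subset rangeI])
      then have "cinner y2 (Q z) = 0" using y1(2) by (simp add: y2_def)
      then show "cinner (Q y2) z = cinner 0 z" by (simp add: positive_contraction_sym[OF Q])
    qed
    have PPy2: "P (P y2) = y2" using sum_squares[of y2] Qy2 positive_contraction_zero[OF Q] by simp
    obtain s where s: "\<And>n. s n \<in> range Q" "s \<longlonglongrightarrow> y1" using y1(1) unfolding closure_sequential by blast
    have "norm (cinner v (Q y1)) \<le> sqrt c * norm (P y1)"
    proof (rule LIMSEQ_le)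
      show "(\<lambda>j. norm (cinner v (Q (s j)))) \<longlonglongrightarrow> norm (cinner v (Q y1))"
        by (intro tendsto_norm tendsto_cinner tendsto_const tQ[OF s(2)])
      show "(\<lambda>j. sqrt c * norm (P (s j))) \<longlonglongrightarrow> sqrt c * norm (P y1)"
        by (intro tendsto_mult tendsto_const tendsto_norm tP[OF s(2)])
      have "norm (cinner v (Q (s j))) \<le> sqrt c * norm (P (s j))" for j
        using s(1)[of j] range by auto
      then show "\<exists>N. \<forall>n\<ge>N. norm (cinner v (Q (s n))) \<le> sqrt c * norm (P (s n))" by blast
    qed
    moreover have "norm (P y1) \<le> norm (P y)"
    proof -
      have "cinner (P y1) (P y2) = cinner y1 (P (P y2))" by (simp only: positive_contraction_sym[OF P])
      also have "\<dots> = cnj (cinner y2 y1)" by (simp only: PPy2 cinner_commute[symmetric])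
      also have "\<dots> = 0" using y1 by (simp add: y2_def)
      finally have "(norm (P y))\<^sup>2 = (norm (P y1))\<^sup>2 + (norm (P y2))\<^sup>2"
        by (simp add: y addP norm_add_square)
      then have "(norm (P y1))\<^sup>2 \<le> (norm (P y))\<^sup>2" by simp
      then show ?thesis by (rule power2_le_imp_le) simp
    qed
    then have "sqrt c * norm (P y1) \<le> sqrt c * norm (P y)" using c by (simp add: mult_left_mono)
    moreover have "Q y = Q y1" by (simp add: y addQ Qy2)
    ultimately show ?thesis by simp
  qed
  have subP: "complex_vector.subspace (range P)"
    unfolding complex_vector.subspace_def
    using positive_contraction_zero[OF P] rangeI[of P 0]
    by (auto simp: addP[symmetric] positive_contraction_scaleC[OF P, symmetric])
  have "inj P"
  proof (rule injI)
    fix x y assume "P x = P y"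
    then have "P (x - y) = 0" by (simp add: positive_contraction_diff[OF P])
    then show "x = y" using P_injective[of "x - y"] by simp
  qed
  then have inv: "inv P (P x) = x" for x by simp
  \<comment> \<open>Injectivity of \<open>P\<close> makes
    \<open>P y \<mapsto> cinner v (Q y)\<close> a well-defined functional on the range of
    \<open>P\<close>.\<close>
  define \<phi> where "\<phi> x = cinner v (Q (inv P x))" for x
  have \<phi>P: "\<phi> (P x) = cinner v (Q x)" for x by (simp add: \<phi>_def inv)
  have "\<exists>k. (\<forall>y. cinner v (Q y) = cinner k (P y)) \<and> norm k \<le> sqrt c"
  proof (rule riesz_subspace[OF subP, of \<phi> "sqrt c"])
    show "\<phi> (x + y) = \<phi> x + \<phi> y" if "x \<in> range P" "y \<in> range P" for x y
      using that by (auto simp: addP[symmetric] \<phi>P addQ cinner_add_right)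
    show "\<phi> (a *\<^sub>C x) = a * \<phi> x" if "x \<in> range P" for a x
      using that by (auto simp: positive_contraction_scaleC[OF P, symmetric] \<phi>P
          positive_contraction_scaleC[OF Q] cinner_scaleC_right)
    show "norm (\<phi> x) \<le> sqrt c * norm x" if "x \<in> range P" for x
      using that bound_Q by (auto simp: \<phi>P)
    fix k assume "\<And>s. s \<in> range P \<Longrightarrow> \<phi> s = cinner k s" "norm k \<le> sqrt c"
    then show ?thesis by (intro exI[of _ k]) (simp add: \<phi>P[symmetric])
  qed (use c in simp)
  then obtain k where k: "\<And>y. cinner v (Q y) = cinner k (P y)" "norm k \<le> sqrt c" by blast
  have "Q v = P k"
    by (rule cinner_eq_zero_imp_eq)
      (simp only: positive_contraction_sym[OF P, symmetric] positive_contraction_sym[OF Q, symmetric] k(1))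
  moreover have "(norm k)\<^sup>2 \<le> c"
    using power_mono[OF k(2), of 2] c by simp
  ultimately show ?thesis unfolding root_iff[symmetric] by blast
qed

text \<open>The extension has the resolvent \<open>S = 1 - Z\<close>. Since
  \<open>S (f + V f) = f\<close>, the range of \<open>S\<close> contains the dense domain of
  \<open>V\<close>, so \<open>S\<close> is injective.\<close>

lemma krein_extension_exists:
  fixes V :: "'a::complex_hilbert_space op"
  assumes lin: "linear_operator V" and dense: "closure (Domain V) = UNIV"
    and sym: "\<And>f g f' g'. (f, g) \<in> V \<Longrightarrow> (f', g') \<in> V \<Longrightarrow> cinner f g' = cinner g f'"
    and nonneg: "\<And>f g. (f, g) \<in> V \<Longrightarrow> 0 \<le> Re (cinner f g)"
  shows "\<exists>T. nonneg_selfadjoint_on UNIV T \<and> V \<subseteq> T \<and>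
    (\<forall>v c. 0 \<le> c \<longrightarrow> (\<forall>f g. (f, g) \<in> V \<longrightarrow> (norm (cinner v g))\<^sup>2 \<le> c * Re (cinner f g)) \<longrightarrow>
      (\<exists>k. (v, k) \<in> op_sqrt T \<and> (norm k)\<^sup>2 \<le> c))"
proof -
  obtain Z where Z_all: "positive_contraction Z \<and> (\<forall>f g. (f, g) \<in> V \<longrightarrow> Z (f + g) = g) \<and>
    (\<forall>x. \<exists>p. (\<forall>j::nat. p j \<in> V) \<and>
       (\<lambda>j. Re (cinner (x - (fst (p j) + snd (p j))) (Z (x - (fst (p j) + snd (p j)))))) \<longlonglongrightarrow> 0)"
    using minimal_nonneg_extension[OF lin sym nonneg] ..
  have Z: "positive_contraction Z" and ZV: "\<And>f g. (f, g) \<in> V \<Longrightarrow> Z (f + g) = g"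
    using Z_all by auto
  note approx = Z_all[THEN conjunct2, THEN conjunct2, rule_format]
  define S where "S x = x - Z x" for x
  have S: "positive_contraction S" unfolding S_def by (rule positive_contraction_complement[OF Z])
  have SV: "S (f + g) = f" if "(f, g) \<in> V" for f g by (simp add: S_def ZV[OF that])
  have inj: "x = 0" if "S x = 0" for x
  proof (rule cinner_dense_eq[OF dense])
    fix f assume "f \<in> Domain V"
    then obtain g where "(f, g) \<in> V" by blast
    from SV[OF this] show "cinner x f = cinner 0 f"
      using positive_contraction_sym[OF S, of x "f + g"] that by simp
  qed
  define T where "T = {(f, g). f = S (f + g)}"
  have T: "nonneg_selfadjoint_on UNIV T"
    unfolding T_def by (rule nonneg_selfadjoint_of_resolvent[OF S inj])
  have VT: "V \<subseteq> T" unfolding T_def using SV by auto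
  obtain P Q where pair: "sqrt_pair P Q" and sq: "T = sqrt_pair.square P Q"
    and root: "op_sqrt T = sqrt_pair.root P Q"
    by (rule nonneg_selfadjoint_sqrt[OF T])
  have "P (P x) = S x" for x
  proof -
    have "(S x, x - S x) \<in> T" unfolding T_def by simp
    then show ?thesis unfolding sq sqrt_pair.square_iff[OF pair] by simp
  qed
  then have QQ: "Q (Q x) = Z x" for x
    using sqrt_pair.sum_squares[OF pair, of x] unfolding S_def
    by (metis add_diff_cancel_left' diff_diff_eq2 add_diff_cancel_left)
  have "\<exists>k. (v, k) \<in> op_sqrt T \<and> (norm k)\<^sup>2 \<le> c"
    if "0 \<le> c" "\<forall>f g. (f, g) \<in> V \<longrightarrow> (norm (cinner v g))\<^sup>2 \<le> c * Re (cinner f g)" for v c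
    unfolding root
    by (rule krein_sqrt_domain[OF pair QQ ZV approx that(1)]) (use that(2) in auto)
  with T VT show ?thesis by blast
qed

text \<open>Equality of the forms polarises to equality of the inner products of root values. The
  root of \<open>T\<close> being selfadjoint, \<open>h'\<close> then lies in its domain with image
  \<open>g\<close>. This gives uniqueness of the smallest extension.\<close>

lemma form_le_antisym:
  assumes S: "nonneg_selfadjoint_on UNIV S" and T: "nonneg_selfadjoint_on UNIV T"
    and le: "form_le S T" "form_le T S"
  shows "S \<subseteq> T"
proof (rule subrelI)
  note R = op_sqrt_selfadjoint[OF S] and R' = op_sqrt_selfadjoint[OF T]
  note D = nonneg_selfadjointD[OF R(1)] and D' = nonneg_selfadjointD[OF R'(1)]
  have dom: "Domain (op_sqrt S) = Domain (op_sqrt T)" using le unfolding form_le_def by blast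
  have norm: "norm k = norm k'" if "(v, k) \<in> op_sqrt S" "(v, k') \<in> op_sqrt T" for v k k'
  proof -
    have "v \<in> Domain (op_sqrt S)" "v \<in> Domain (op_sqrt T)" using that by blast+
    then have "norm (op_apply (op_sqrt S) v) = norm (op_apply (op_sqrt T) v)"
      using le unfolding form_le_def by (metis order_antisym)
    then show ?thesis by (simp add: op_apply_eq[OF D(1) that(1)] op_apply_eq[OF D'(1) that(2)])
  qed
  have Re: "Re (cinner k l) = Re (cinner k' l')"
    if "(v, k) \<in> op_sqrt S" "(v, k') \<in> op_sqrt T" "(w, l) \<in> op_sqrt S" "(w, l') \<in> op_sqrt T"
    for v k k' w l l'
    using norm[OF linear_operator_add[OF D(1) that(1,3)] linear_operator_add[OF D'(1) that(2,4)]]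
      norm[OF that(1,2)] norm[OF that(3,4)] norm_add_square[of k l] norm_add_square[of k' l']
    by simp
  have cinner: "cinner k l = cinner k' l'"
    if "(v, k) \<in> op_sqrt S" "(v, k') \<in> op_sqrt T" "(w, l) \<in> op_sqrt S" "(w, l') \<in> op_sqrt T"
    for v k k' w l l'
  proof (rule complex_eqI_Re)
    show "Re (cinner k l) = Re (cinner k' l')" by (rule Re[OF that])
    show "Re (\<i> * cinner k l) = Re (\<i> * cinner k' l')"
      using Re[OF that(1,2) linear_operator_scaleC[OF D(1) that(3), of \<i>]
          linear_operator_scaleC[OF D'(1) that(4), of \<i>]]
      by (simp only: cinner_scaleC_right)
  qed
  fix f g assume "(f, g) \<in> S"
  then obtain h where h: "(f, h) \<in> op_sqrt S" "(h, g) \<in> op_sqrt S" using R(2) by blast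
  obtain h' where h': "(f, h') \<in> op_sqrt T" using h(1) dom by blast
  have "(h', g) \<in> op_sqrt T"
  proof (rule D'(4))
    fix w l' assume w: "(w, l') \<in> op_sqrt T"
    then obtain l where l: "(w, l) \<in> op_sqrt S" using dom by blast
    have "cinner h' l' = cinner h l" using cinner[OF h(1) h' l w] by simp
    also have "\<dots> = cinner g w" using D(3)[OF l h(2)] by (metis cinner_commute)
    finally show "cinner h' l' = cinner g w" .
  qed
  then show "(f, g) \<in> T" using h' R'(2) by blast
qed

text \<open>The Ando-Nishio formula: the square of the root at \<open>v\<close> is the least
  \<open>c\<close> with \<open>norm (cinner v (V f))^2 \<le> c * cinner f (V f)\<close> for all
  \<open>f\<close>, and \<open>v\<close> lies outside the domain if there is none. It also
  identifies the operator meant by the definite description.\<close>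

lemma krein_von_neumann_sqrt:
  fixes V :: "'a::complex_hilbert_space op"
  assumes lin: "linear_operator V" and dense: "closure (Domain V) = UNIV"
    and sym: "\<And>f g f' g'. (f, g) \<in> V \<Longrightarrow> (f', g') \<in> V \<Longrightarrow> cinner f g' = cinner g f'"
    and nonneg: "\<And>f g. (f, g) \<in> V \<Longrightarrow> 0 \<le> Re (cinner f g)"
  shows "nonneg_selfadjoint_on UNIV (krein_von_neumann V)" (is ?T1)
    and "0 \<le> c \<Longrightarrow> v \<in> Domain (op_sqrt (krein_von_neumann V)) \<and>
        (norm (op_apply (op_sqrt (krein_von_neumann V)) v))\<^sup>2 \<le> c \<longleftrightarrow>
      (\<forall>(f, g)\<in>V. (norm (cinner v g))\<^sup>2 \<le> c * Re (cinner f g))" (is "_ \<Longrightarrow> ?T2")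
proof -
  obtain T where T_all: "nonneg_selfadjoint_on UNIV T \<and> V \<subseteq> T \<and>
    (\<forall>v c. 0 \<le> c \<longrightarrow> (\<forall>f g. (f, g) \<in> V \<longrightarrow> (norm (cinner v g))\<^sup>2 \<le> c * Re (cinner f g)) \<longrightarrow>
      (\<exists>k. (v, k) \<in> op_sqrt T \<and> (norm k)\<^sup>2 \<le> c))"
    using krein_extension_exists[OF lin dense sym nonneg] ..
  have T: "nonneg_selfadjoint_on UNIV T" and VT: "V \<subseteq> T" using T_all by auto
  note ex = T_all[THEN conjunct2, THEN conjunct2, rule_format]
  note D = nonneg_selfadjointD[OF op_sqrt_selfadjoint(1)[OF T]]
  \<comment> \<open>The easy half for \<open>T'\<close> shows that the constant
    \<open>norm k' ^ 2\<close> is admissible for \<open>v\<close>; the hard half for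
    \<open>T\<close> then yields the domain inclusion and the norm inequality at once.\<close>
  have min: "form_le T T'" if T': "nonneg_selfadjoint_on UNIV T'" "V \<subseteq> T'" for T'
  proof -
    note D' = nonneg_selfadjointD[OF op_sqrt_selfadjoint(1)[OF T'(1)]]
    have "v \<in> Domain (op_sqrt T) \<and> norm (op_apply (op_sqrt T) v) \<le> norm (op_apply (op_sqrt T') v)"
      if v: "v \<in> Domain (op_sqrt T')" for v
    proof -
      obtain k' where k': "(v, k') \<in> op_sqrt T'" using v by blast
      obtain k where k: "(v, k) \<in> op_sqrt T \<and> (norm k)\<^sup>2 \<le> (norm k')\<^sup>2"
        using ex[of "(norm k')\<^sup>2" v] sqrt_form_bound[OF T'(1) _ k'] T'(2) by auto
      then have "norm k \<le> norm k'" using power2_le_imp_le[of "norm k" "norm k'"] by simp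
      then show ?thesis using k k' op_apply_eq[OF D(1)] op_apply_eq[OF D'(1)] by auto
    qed
    then show ?thesis unfolding form_le_def by blast
  qed
  have eq: "krein_von_neumann V = T"
    unfolding krein_von_neumann_def
  proof (rule the_equality)
    show "nonneg_selfadjoint_on UNIV T \<and> V \<subseteq> T \<and>
        (\<forall>T'. nonneg_selfadjoint_on UNIV T' \<and> V \<subseteq> T' \<longrightarrow> form_le T T')"
      using T VT min by simp
    fix T' assume T': "nonneg_selfadjoint_on UNIV T' \<and> V \<subseteq> T' \<and>
        (\<forall>T''. nonneg_selfadjoint_on UNIV T'' \<and> V \<subseteq> T'' \<longrightarrow> form_le T' T'')"
    then have "form_le T T'" "form_le T' T" using min T VT by simp_all
    then show "T' = T"
      using form_le_antisym[OF T, of T'] form_le_antisym[OF _ T, of T'] T' by (intro subset_antisym) simp_all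
  qed
  show ?T1 unfolding eq by (rule T)
  assume c: "0 \<le> c"
  show ?T2 unfolding eq
  proof (intro iffI ballI; (elim conjE)?; clarify?)
    fix k f g assume vk: "(v, k) \<in> op_sqrt T" "(norm (op_apply (op_sqrt T) v))\<^sup>2 \<le> c"
      and fg: "(f, g) \<in> V"
    then have "(norm (cinner v g))\<^sup>2 \<le> (norm k)\<^sup>2 * Re (cinner f g)"
      using sqrt_form_bound[OF T _ vk(1)] VT by blast
    also have "\<dots> \<le> c * Re (cinner f g)"
      using vk op_apply_eq[OF D(1) vk(1)] nonneg[OF fg] by (simp add: mult_right_mono)
    finally show "(norm (cinner v g))\<^sup>2 \<le> c * Re (cinner f g)" .
  next
    assume "\<forall>(f, g)\<in>V. (norm (cinner v g))\<^sup>2 \<le> c * Re (cinner f g)"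
    then obtain k where "(v, k) \<in> op_sqrt T \<and> (norm k)\<^sup>2 \<le> c" using ex[OF c, of v] by auto
    then show "v \<in> Domain (op_sqrt T) \<and> (norm (op_apply (op_sqrt T) v))\<^sup>2 \<le> c"
      using op_apply_eq[OF D(1), of v k] by auto
  qed
qed

section \<open>Forms on finite-dimensional spaces\<close>

definition orthonormal :: "'a::complex_hilbert_space set \<Rightarrow> bool" where
  "orthonormal E \<longleftrightarrow> (\<forall>e\<in>E. \<forall>e'\<in>E. cinner e e' = (if e = e' then 1 else 0))"

lemmas cinner_sum_right = bounded_bilinear.sum_right[OF bounded_bilinear_cinner]

text \<open>For orthonormal \<open>E\<close> this is the operator with eigenvalue \<open>f e\<close>
  at \<open>e\<close> that vanishes on the orthogonal complement. With constant eigenvalue 1 it is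
  the orthogonal projection onto the span, so \<open>diagonal E (\<lambda>e. 1) w = w\<close> says
  that \<open>w\<close> is spanned by \<open>E\<close>.\<close>

definition diagonal :: "'a::complex_hilbert_space set \<Rightarrow> ('a \<Rightarrow> real) \<Rightarrow> 'a \<Rightarrow> 'a" where
  "diagonal E f w = (\<Sum>e\<in>E. (complex_of_real (f e) * cinner e w) *\<^sub>C e)"

lemma cinner_diagonal:
  assumes "finite E" "orthonormal E" "e \<in> E"
  shows "cinner e (diagonal E f w) = complex_of_real (f e) * cinner e w"
proof -
  have "cinner e (diagonal E f w) = (\<Sum>e'\<in>E. if e' = e then complex_of_real (f e) * cinner e w else 0)"
    unfolding diagonal_def cinner_sum_right
    by (rule sum.cong[OF refl]) (use assms(2,3) in \<open>auto simp: orthonormal_def cinner_scaleC_right\<close>)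
  then show ?thesis using assms(1,3) by simp
qed

lemma diagonal_add: "diagonal E f (v + w) = diagonal E f v + diagonal E f w"
  by (simp add: diagonal_def cinner_add_right distrib_left scaleC_add_left sum.distrib)

lemma diagonal_scaleC: "diagonal E f (a *\<^sub>C w) = a *\<^sub>C diagonal E f w"
  by (simp add: diagonal_def cinner_scaleC_right complex_vector.scale_sum_right scaleC_scaleC ac_simps)

lemma diagonal_zero: "diagonal E f 0 = 0"
  using diagonal_scaleC[of E f 0 0] by simp

lemma diagonal_minus: "diagonal E f (- w) = - diagonal E f w"
  using diagonal_scaleC[of E f "-1" w] by simp

lemma diagonal_diff: "diagonal E f (v - w) = diagonal E f v - diagonal E f w"
  using diagonal_add[of E f v "- w"] by (simp add: diagonal_minus)

lemma diagonal_in: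
  assumes "complex_vector.subspace W" "E \<subseteq> W"
  shows "diagonal E f w \<in> W"
  unfolding diagonal_def
  by (rule complex_vector.subspace_sum[OF assms(1)])
    (use assms in \<open>auto intro: complex_vector.subspace_scale\<close>)

lemma orthonormal_independent:
  assumes "finite E" "orthonormal E"
  shows "complex_vector.independent E"
proof
  assume "complex_vector.dependent E"
  then obtain u where u: "\<exists>v\<in>E. u v \<noteq> 0" "(\<Sum>v\<in>E. u v *\<^sub>C v) = 0"
    unfolding complex_vector.dependent_finite[OF assms(1)] by blast
  then obtain v where v: "v \<in> E" "u v \<noteq> 0" by blast
  have "cinner v (\<Sum>v\<in>E. u v *\<^sub>C v) = (\<Sum>w\<in>E. if w = v then u v else 0)"
    unfolding cinner_sum_right
    by (rule sum.cong[OF refl]) (use assms(2) v(1) in \<open>auto simp: orthonormal_def cinner_scaleC_right\<close>)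
  then show False using u(2) v assms(1) by simp
qed

text \<open>Orthonormal families in \<open>W\<close> have at most \<open>card B\<close> elements, so
  one of largest size exists in \<open>X\<close>. A vector not expanded by it leaves a remainder
  orthogonal to it, and \<open>step\<close> would enlarge the family. Taking \<open>W\<close> for
  \<open>X\<close> gives orthonormal bases, taking the eigenvectors gives diagonalisation.\<close>

lemma maximal_orthonormal_expansion:
  fixes W X B :: "'a::complex_hilbert_space set"
  assumes W: "complex_vector.subspace W" and B: "finite B" "W \<subseteq> complex_vector.span B"
    and XW: "X \<subseteq> W"
    and step: "\<And>F w. finite F \<Longrightarrow> F \<subseteq> X \<Longrightarrow> w \<in> W \<Longrightarrow> w \<noteq> 0 \<Longrightarrow>
      (\<And>e. e \<in> F \<Longrightarrow> cinner e w = 0) \<Longrightarrow> \<exists>x\<in>X. norm x = 1 \<and> (\<forall>e\<in>F. cinner e x = 0)"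
  shows "\<exists>E. finite E \<and> E \<subseteq> X \<and> orthonormal E \<and> (\<forall>w\<in>W. diagonal E (\<lambda>e. 1) w = w)"
proof -
  define A where "A E \<longleftrightarrow> finite E \<and> E \<subseteq> X \<and> orthonormal E" for E
  have bound: "card E < card B + 1" if "A E" for E
  proof -
    have "E \<subseteq> complex_vector.span B" using that XW B(2) unfolding A_def by blast
    then show ?thesis
      using complex_vector.independent_span_bound[OF B(1) orthonormal_independent, of E] that
      unfolding A_def by simp
  qed
  have "A {}" unfolding A_def orthonormal_def by simp
  then obtain E where E: "A E" "\<And>F. A F \<Longrightarrow> card F \<le> card E"
    using ex_has_greatest_nat[of A "{}" card "card B + 1"] bound less_imp_le by blast
  have fin: "finite E" and EX: "E \<subseteq> X" and on: "orthonormal E" using E(1) unfolding A_def by auto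
  have "diagonal E (\<lambda>e. 1) w = w" if w: "w \<in> W" for w
  proof (rule ccontr)
    assume ne: "diagonal E (\<lambda>e. 1) w \<noteq> w"
    define w' where "w' = w - diagonal E (\<lambda>e. 1) w"
    have "w' \<in> W" unfolding w'_def
      by (rule complex_vector.subspace_diff[OF W w diagonal_in[OF W]]) (use EX XW in auto)
    moreover have "w' \<noteq> 0" using ne by (simp add: w'_def)
    moreover have "cinner e w' = 0" if "e \<in> E" for e
      by (simp add: w'_def cinner_diff_right cinner_diagonal[OF fin on that])
    ultimately obtain x where x: "x \<in> X" "norm x = 1" "\<forall>e\<in>E. cinner e x = 0"
      using step[OF fin EX] by metis
    have "x \<notin> E" using x(2,3) by (auto simp: cinner_self)
    moreover have "A (insert x E)"
    proof -
      have "cinner x e = 0" if "e \<in> E" for e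
        using x(3) that by (subst cinner_commute) simp
      moreover have "cinner x x = 1" using x(2) by (simp add: cinner_self)
      ultimately have "orthonormal (insert x E)"
        using on x(3) \<open>x \<notin> E\<close> unfolding orthonormal_def by auto
      then show ?thesis unfolding A_def using fin EX x(1) by simp
    qed
    ultimately show False using E(2)[of "insert x E"] fin by simp
  qed
  then show ?thesis using fin EX on by blast
qed

lemma orthonormal_basis_exists:
  fixes W B :: "'a::complex_hilbert_space set"
  assumes W: "complex_vector.subspace W" and B: "finite B" "W \<subseteq> complex_vector.span B"
  shows "\<exists>E. finite E \<and> E \<subseteq> W \<and> orthonormal E \<and> (\<forall>w\<in>W. diagonal E (\<lambda>e. 1) w = w)"
proof (rule maximal_orthonormal_expansion[OF W B order_refl])
  fix F w assume w: "w \<in> W" "w \<noteq> 0" and F: "\<And>e. e \<in> F \<Longrightarrow> cinner e w = 0"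
  have "norm ((complex_of_real (inverse (norm w))) *\<^sub>C w) = 1"
    using w(2) by (simp add: norm_scaleC norm_inverse)
  then show "\<exists>x\<in>W. norm x = 1 \<and> (\<forall>e\<in>F. cinner e x = 0)"
    using complex_vector.subspace_scale[OF W w(1)] F by (auto simp: cinner_scaleC_right)
qed

text \<open>Horner's scheme for \<open>p(m) w\<close>.\<close>

definition poly_apply ::
    "('a::complex_hilbert_space \<Rightarrow> 'a) \<Rightarrow> 'a \<Rightarrow> complex poly \<Rightarrow> 'a" where
  "poly_apply m w p = fold_coeffs (\<lambda>a x. a *\<^sub>C w + m x) p 0"

text \<open>Take a non-zero polynomial \<open>p\<close> of least degree with
  \<open>p(m) w = 0\<close>. It has a root \<open>z\<close>, and for \<open>p = (X - z) r\<close>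
  the vector \<open>r(m) w\<close> is non-zero by minimality and is an eigenvector to
  \<open>z\<close>.\<close>

lemma eigenvector_exists:
  fixes W B :: "'a::complex_hilbert_space set"
  assumes W: "complex_vector.subspace W" and B: "finite B" "W \<subseteq> complex_vector.span B"
    and mW: "\<And>x. x \<in> W \<Longrightarrow> m x \<in> W"
    and add: "\<And>x y. x \<in> W \<Longrightarrow> y \<in> W \<Longrightarrow> m (x + y) = m x + m y"
    and scale: "\<And>a x. x \<in> W \<Longrightarrow> m (a *\<^sub>C x) = a *\<^sub>C m x"
    and w: "w \<in> W" "w \<noteq> 0"
  shows "\<exists>v\<in>W. v \<noteq> 0 \<and> (\<exists>z. m v = z *\<^sub>C v)"
proof -
  let ?e = "poly_apply m w"
  have m0: "m 0 = 0" using scale[OF complex_vector.subspace_0[OF W], of 0] by simp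
  have e0: "?e 0 = 0" by (simp add: poly_apply_def)
  have epCons: "?e (pCons a p) = a *\<^sub>C w + m (?e p)" for a p
  proof (cases "p = 0 \<and> a = 0")
    case True
    then show ?thesis by (simp add: e0 m0)
  next
    case False
    then show ?thesis unfolding poly_apply_def
      by (cases "p = 0") (simp_all add: fold_coeffs_pCons_not_0_0_eq fold_coeffs_pCons_coeff_not_0_eq)
  qed
  have eW: "?e p \<in> W" for p
  proof (induction p)
    case 0
    then show ?case by (simp add: e0 complex_vector.subspace_0[OF W])
  next
    case (pCons a p)
    then show ?case unfolding epCons
      by (intro complex_vector.subspace_add[OF W] complex_vector.subspace_scale[OF W] w mW)
  qed
  have eadd: "?e (p + q) = ?e p + ?e q" for p q
  proof (induction p arbitrary: q)
    case 0
    then show ?case by (simp add: e0)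
  next
    case (pCons a p)
    show ?case
    proof (cases q)
      case (pCons b q')
      then show ?thesis using pCons.IH[of q']
        by (simp add: epCons add[OF eW eW] scaleC_add_left algebra_simps)
    qed
  qed
  have esmult: "?e (smult c p) = c *\<^sub>C ?e p" for c p
    by (induction p) (simp_all add: e0 epCons scale[OF eW] scaleC_add_right scaleC_scaleC)
  have esum: "?e (\<Sum>k\<in>A. f k) = (\<Sum>k\<in>A. ?e (f k))" for f :: "nat \<Rightarrow> complex poly" and A
    by (induction A rule: infinite_finite_induct) (simp_all add: e0 eadd)
  have ediff: "?e (p - q) = ?e p - ?e q" for p q
    using eadd[of "p - q" q] by (simp add: eq_diff_eq)
  \<comment> \<open>If \<open>p \<mapsto> p(m) w\<close> were injective, the images of the powers
    from 0 to \<open>card B\<close> would be \<open>card B + 1\<close> independent vectors in the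
    span of \<open>B\<close>.\<close>
  have "\<exists>p. p \<noteq> 0 \<and> ?e p = 0"
  proof (rule ccontr)
    assume "\<not> ?thesis"
    then have inj: "p = 0" if "?e p = 0" for p using that by blast
    define v where "v k = ?e (monom 1 k)" for k :: nat
    let ?n = "card B"
    have "inj_on v {..?n}"
    proof (rule inj_onI)
      fix i j assume "v i = v j"
      then have "monom 1 i - monom 1 j = (0 :: complex poly)"
        by (intro inj) (simp add: ediff v_def)
      then show "i = j" by (simp add: monom_eq_iff')
    qed
    then have card: "card (v ` {..?n}) = Suc ?n" by (simp add: card_image)
    have "complex_vector.independent (v ` {..?n})"
    proof
      assume "complex_vector.dependent (v ` {..?n})"
      then obtain u where u: "\<exists>x\<in>v ` {..?n}. u x \<noteq> 0" "(\<Sum>x\<in>v ` {..?n}. u x *\<^sub>C x) = 0"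
        unfolding complex_vector.dependent_finite[OF finite_imageI[OF finite_atMost]] by blast
      have "?e (\<Sum>k\<le>?n. smult (u (v k)) (monom 1 k)) = (\<Sum>k\<le>?n. u (v k) *\<^sub>C v k)"
        by (simp only: esum esmult v_def)
      also have "\<dots> = 0" using u(2) by (simp add: sum.reindex[OF \<open>inj_on v {..?n}\<close>])
      finally have z: "(\<Sum>k\<le>?n. smult (u (v k)) (monom 1 k)) = 0" by (rule inj)
      have "u (v j) = 0" if "j \<le> ?n" for j
      proof -
        have "coeff (\<Sum>k\<le>?n. smult (u (v k)) (monom 1 k)) j
            = (\<Sum>k\<le>?n. if k = j then u (v k) else 0)"
          unfolding coeff_sum by (rule sum.cong) auto
        then show ?thesis using that z by simp
      qed
      then show False using u(1) by auto
    qed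
    moreover have "v ` {..?n} \<subseteq> complex_vector.span B" using eW B(2) unfolding v_def by blast
    ultimately have "card (v ` {..?n}) \<le> ?n"
      using complex_vector.independent_span_bound[OF B(1)] by blast
    then show False using card by simp
  qed
  then obtain p where p: "p \<noteq> 0 \<and> ?e p = 0"
    and least: "\<And>p'. p' \<noteq> 0 \<and> ?e p' = 0 \<Longrightarrow> degree p \<le> degree p'"
    using ex_has_least_nat[of "\<lambda>p. p \<noteq> 0 \<and> ?e p = 0" _ degree] by metis
  have "degree p \<noteq> 0"
  proof
    assume "degree p = 0"
    then obtain a where a: "p = [:a:]" by (rule degree_eq_zeroE)
    then have "a *\<^sub>C w = 0" "a \<noteq> 0" using p epCons[of a 0] by (auto simp: e0 m0)
    then show False using w(2) by simp
  qed
  then have "\<not> constant (poly p)" by (simp add: constant_degree)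
  then obtain z where "poly p z = 0" using fundamental_theorem_of_algebra by blast
  then obtain r where r: "p = [:- z, 1:] * r" unfolding poly_eq_0_iff_dvd by (rule dvdE)
  have r0: "r \<noteq> 0" using p r by auto
  have "degree p = degree [:- z, 1:] + degree r"
    unfolding r by (rule degree_mult_eq) (use r0 in auto)
  then have "?e r \<noteq> 0" using least[of r] r0 by auto
  moreover have "m (?e r) - z *\<^sub>C ?e r = 0"
    using p unfolding r by (simp add: eadd esmult epCons ediff)
  ultimately show ?thesis using eW by (intro bexI[of _ "?e r"]) (auto intro!: exI[of _ z])
qed

text \<open>In the expansion of \<open>q (v + c *\<^sub>C w)\<close> at \<open>c = \<i> ^ k\<close>,
  averaging against \<open>(- \<i>) ^ k\<close> leaves only the term \<open>c * s v w\<close>; the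
  other terms carry weights that sum to 0 over the fourth roots of unity.\<close>

lemma polarization_eq:
  assumes W: "complex_vector.subspace W"
    and add: "\<And>u v w. u \<in> W \<Longrightarrow> v \<in> W \<Longrightarrow> w \<in> W \<Longrightarrow> s u (v + w) = s u v + s u w"
    and scale: "\<And>a v w. v \<in> W \<Longrightarrow> w \<in> W \<Longrightarrow> s v (a *\<^sub>C w) = a * s v w"
    and herm: "\<And>v w. v \<in> W \<Longrightarrow> w \<in> W \<Longrightarrow> s v w = cnj (s w v)"
    and q: "\<And>w. w \<in> W \<Longrightarrow> complex_of_real (q w) = s w w"
    and v: "v \<in> W" and w: "w \<in> W"
  shows "polarization q v w = s v w"
proof -
  have exp: "complex_of_real (q (v + c *\<^sub>C w)) = s v v + c * s v w + cnj c * s w v + c * cnj c * s w w"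
    for c
  proof -
    have cw: "c *\<^sub>C w \<in> W" "v + c *\<^sub>C w \<in> W"
      using v w W by (auto intro: complex_vector.subspace_add complex_vector.subspace_scale)
    have "s (v + c *\<^sub>C w) (v + c *\<^sub>C w) = s (v + c *\<^sub>C w) v + c * s (v + c *\<^sub>C w) w"
      by (simp only: add[OF cw(2) v cw(1)] scale[OF cw(2) w])
    also have "s (v + c *\<^sub>C w) v = s v v + cnj c * s w v"
      unfolding herm[OF cw(2) v] add[OF v v cw(1)] scale[OF v w]
      by (simp only: complex_cnj_add complex_cnj_mult herm[OF v v, symmetric] herm[OF w v, symmetric])
    also have "s (v + c *\<^sub>C w) w = s v w + cnj c * s w w"
      unfolding herm[OF cw(2) w] add[OF w v cw(1)] scale[OF w w]
      by (simp only: complex_cnj_add complex_cnj_mult herm[OF v w, symmetric] herm[OF w w, symmetric])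
    finally show ?thesis using q[OF cw(2)] by (simp add: algebra_simps)
  qed
  have "{..<4::nat} = {0, 1, 2, 3}" by auto
  then show ?thesis unfolding polarization_def exp
    by (simp add: exp power3_eq_cube power2_eq_square algebra_simps)
qed

text \<open>The spectral theorem for a hermitian form on a finite-dimensional space. An auxiliary
  orthonormal basis gives the operator \<open>m\<close> that represents the form, and an orthonormal
  family of eigenvectors can always be enlarged.\<close>

lemma form_operator_eigenbasis:
  fixes W B :: "'a::complex_hilbert_space set"
  assumes W: "complex_vector.subspace W" and B: "finite B" "W \<subseteq> complex_vector.span B"
    and add: "\<And>u v w. u \<in> W \<Longrightarrow> v \<in> W \<Longrightarrow> w \<in> W \<Longrightarrow> s u (v + w) = s u v + s u w"
    and scale: "\<And>a v w. v \<in> W \<Longrightarrow> w \<in> W \<Longrightarrow> s v (a *\<^sub>C w) = a * s v w"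
    and herm: "\<And>v w. v \<in> W \<Longrightarrow> w \<in> W \<Longrightarrow> s v w = cnj (s w v)"
    and q: "\<And>w. w \<in> W \<Longrightarrow> complex_of_real (q w) = s w w"
  shows "\<exists>E l. finite E \<and> E \<subseteq> W \<and> orthonormal E \<and> (\<forall>w\<in>W. diagonal E (\<lambda>e. 1) w = w) \<and>
    form_operator W q = {(w, diagonal E l w) | w. w \<in> W} \<and>
    (\<forall>w\<in>W. q w = Re (cinner w (diagonal E l w)))"
proof -
  obtain F where F: "finite F \<and> F \<subseteq> W \<and> orthonormal F \<and> (\<forall>w\<in>W. diagonal F (\<lambda>e. 1) w = w)"
    using orthonormal_basis_exists[OF W B] ..
  define m where "m w = (\<Sum>e\<in>F. s e w *\<^sub>C e)" for w
  have FW: "\<And>e. e \<in> F \<Longrightarrow> e \<in> W" using F by auto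
  have mW: "m x \<in> W" for x
    unfolding m_def by (rule complex_vector.subspace_sum[OF W complex_vector.subspace_scale[OF W FW]])
  have madd: "m (x + y) = m x + m y" if "x \<in> W" "y \<in> W" for x y
    unfolding m_def sum.distrib[symmetric] scaleC_add_left[symmetric]
    by (rule sum.cong[OF refl]) (simp add: add[OF FW that])
  have mscale: "m (a *\<^sub>C x) = a *\<^sub>C m x" if "x \<in> W" for a x
    unfolding m_def complex_vector.scale_sum_right scaleC_scaleC
    by (rule sum.cong[OF refl]) (simp add: scale[OF FW that])
  have ssum: "s w (\<Sum>e\<in>A. c e *\<^sub>C e) = (\<Sum>e\<in>A. c e * s w e)"
    if "finite A" "A \<subseteq> W" "w \<in> W" for w A c
    using that
  proof (induction A)
    case empty
    have "s w (0 *\<^sub>C 0) = 0 * s w 0" using scale[OF that(3) complex_vector.subspace_0[OF W]] .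
    then show ?case by simp
  next
    case (insert x A)
    have "(\<Sum>e\<in>A. c e *\<^sub>C e) \<in> W"
      using insert by (intro complex_vector.subspace_sum[OF W] complex_vector.subspace_scale[OF W]) auto
    with insert show ?case
      by (simp add: add complex_vector.subspace_scale[OF W] scale)
  qed
  have ms: "cinner v (m w) = s v w" if v: "v \<in> W" and w: "w \<in> W" for v w
  proof -
    have "(\<Sum>e\<in>F. cinner e v *\<^sub>C e) = v" using F v by (auto simp: diagonal_def)
    then have "s w v = (\<Sum>e\<in>F. cinner e v * s w e)"
      using ssum[of F w "\<lambda>e. cinner e v"] F w by simp
    then have "s v w = cnj (\<Sum>e\<in>F. cinner e v * s w e)" using herm[OF v w] by simp
    also have "\<dots> = (\<Sum>e\<in>F. cinner v e * s e w)"
      unfolding cnj_sum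
      by (rule sum.cong[OF refl]) (simp only: complex_cnj_mult cinner_commute[symmetric] herm[OF FW w, symmetric])
    also have "\<dots> = cinner v (m w)"
      unfolding m_def cinner_sum_right cinner_scaleC_right by (simp add: mult.commute)
    finally show ?thesis by simp
  qed
  have msym: "cinner v (m w) = cinner (m v) w" if "v \<in> W" "w \<in> W" for v w
    unfolding ms[OF that] herm[OF that] ms[OF that(2,1), symmetric] by (rule cinner_commute[symmetric])
  define X where "X = {v \<in> W. \<exists>z. m v = z *\<^sub>C v}"
  have "\<exists>E. finite E \<and> E \<subseteq> X \<and> orthonormal E \<and> (\<forall>w\<in>W. diagonal E (\<lambda>e. 1) w = w)"
  proof (rule maximal_orthonormal_expansion[OF W B])
    show "X \<subseteq> W" unfolding X_def by auto
    fix G w assume G: "finite G" "G \<subseteq> X" and w: "w \<in> W" "w \<noteq> 0"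
      and orth: "\<And>e. e \<in> G \<Longrightarrow> cinner e w = 0"
    \<comment> \<open>By symmetry \<open>m\<close> leaves the orthogonal complement of the
      eigenvectors found so far invariant, so it has an eigenvector there.\<close>
    define W' where "W' = {x \<in> W. \<forall>e\<in>G. cinner e x = 0}"
    have W': "complex_vector.subspace W'"
      using W unfolding W'_def complex_vector.subspace_def
      by (auto simp: cinner_add_right cinner_scaleC_right)
    have W'W: "x \<in> W" if "x \<in> W'" for x using that unfolding W'_def by simp
    have mW': "m x \<in> W'" if x: "x \<in> W'" for x
    proof -
      have "cinner e (m x) = 0" if e: "e \<in> G" for e
      proof -
        obtain z where z: "m e = z *\<^sub>C e" "e \<in> W" using G(2) e unfolding X_def by auto
        have "cinner e (m x) = cinner (m e) x" by (rule msym[OF z(2) W'W[OF x]])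
        also have "\<dots> = 0" using x e unfolding W'_def by (simp add: z cinner_scaleC_left)
        finally show ?thesis .
      qed
      then show ?thesis unfolding W'_def using mW by simp
    qed
    have "\<exists>v\<in>W'. v \<noteq> 0 \<and> (\<exists>z. m v = z *\<^sub>C v)"
    proof (rule eigenvector_exists[OF W' B(1) _ mW'])
      show "W' \<subseteq> complex_vector.span B" using B(2) W'W by blast
      show "w \<in> W'" unfolding W'_def using w(1) orth by simp
    qed (use w(2) in \<open>auto intro: madd mscale W'W\<close>)
    then obtain v z where v: "v \<in> W'" "v \<noteq> 0" "m v = z *\<^sub>C v" by blast
    define x where "x = complex_of_real (inverse (norm v)) *\<^sub>C v"
    have xW': "x \<in> W'" unfolding x_def by (rule complex_vector.subspace_scale[OF W' v(1)])
    moreover have "m x = z *\<^sub>C x"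
      unfolding x_def mscale[OF W'W[OF v(1)]] v(3) scaleC_scaleC by (simp add: mult.commute)
    moreover have "norm x = 1" unfolding x_def using v(2) by (simp add: norm_scaleC norm_inverse)
    ultimately have "x \<in> X \<and> norm x = 1 \<and> (\<forall>e\<in>G. cinner e x = 0)"
      unfolding X_def W'_def by auto
    then show "\<exists>x\<in>X. norm x = 1 \<and> (\<forall>e\<in>G. cinner e x = 0)" by blast
  qed
  then obtain E where E: "finite E \<and> E \<subseteq> X \<and> orthonormal E \<and> (\<forall>w\<in>W. diagonal E (\<lambda>e. 1) w = w)" ..
  have fin: "finite E" and on: "orthonormal E" and expand: "\<And>w. w \<in> W \<Longrightarrow> diagonal E (\<lambda>e. 1) w = w"
    using E by auto
  have EW: "e \<in> W" if "e \<in> E" for e using E that unfolding X_def by auto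
  \<comment> \<open>At a unit eigenvector the eigenvalue equals the value of the form, hence it is
    real although \<open>X\<close> admits complex eigenvalues.\<close>
  define l where "l e = q e" for e
  have me: "m e = complex_of_real (l e) *\<^sub>C e" if e: "e \<in> E" for e
  proof -
    obtain z where z: "m e = z *\<^sub>C e" using E e unfolding X_def by auto
    have "complex_of_real (q e) = cinner e (m e)" using q[OF EW[OF e]] ms[OF EW[OF e] EW[OF e]] by simp
    also have "\<dots> = z" using on e unfolding z orthonormal_def by (simp add: cinner_scaleC_right)
    finally show ?thesis using z unfolding l_def by simp
  qed
  have coeff: "cinner e (m w) = complex_of_real (l e) * cinner e w" if e: "e \<in> E" and w: "w \<in> W" for e w
    unfolding msym[OF EW[OF e] w] me[OF e] by (simp add: cinner_scaleC_left)
  have md: "m w = diagonal E l w" if w: "w \<in> W" for w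
  proof -
    have "m w = diagonal E (\<lambda>e. 1) (m w)" by (rule expand[OF mW, symmetric])
    also have "\<dots> = diagonal E l w"
      unfolding diagonal_def by (rule sum.cong[OF refl]) (simp add: coeff[OF _ w])
    finally show ?thesis .
  qed
  have pol: "polarization q v w = s v w" if "v \<in> W" "w \<in> W" for v w
    by (rule polarization_eq[where s = s and q = q, OF W add scale herm q that])
  have "form_operator W q = {(w, diagonal E l w) | w. w \<in> W}"
  proof (intro subset_antisym subrelI)
    fix w x assume "(w, x) \<in> form_operator W q"
    then have wx: "w \<in> W" "x \<in> W" and x: "\<And>v. v \<in> W \<Longrightarrow> cinner v x = s v w"
      unfolding form_operator_def using pol by auto
    have "cinner (x - m w) (x - m w) = 0"
      using x[of "x - m w"] ms[of "x - m w" w] wx mW complex_vector.subspace_diff[OF W wx(2) mW]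
      by (simp add: cinner_diff_right)
    then have "x = m w" by (simp add: cinner_self)
    then show "(w, x) \<in> {(w, diagonal E l w) | w. w \<in> W}" using wx md by auto
  next
    fix w x assume "(w, x) \<in> {(w, diagonal E l w) | w. w \<in> W}"
    then have "w \<in> W" "x = m w" using md by auto
    then show "(w, x) \<in> form_operator W q"
      unfolding form_operator_def using mW ms pol by auto
  qed
  moreover have "q w = Re (cinner w (diagonal E l w))" if w: "w \<in> W" for w
    using q[OF w] ms[OF w w] md[OF w] by (metis Re_complex_of_real)
  ultimately show ?thesis using fin on expand EW by (intro exI[of _ E] exI[of _ l]) auto
qed

section \<open>Functions of an operator that is diagonal in an orthonormal basis\<close>

locale diagonal_operator =
  fixes W E :: "'a::complex_hilbert_space set" and l :: "'a \<Rightarrow> real"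
  assumes W: "complex_vector.subspace W" and fin: "finite E" and EW: "E \<subseteq> W"
    and on: "orthonormal E" and expand: "w \<in> W \<Longrightarrow> diagonal E (\<lambda>e. 1) w = w"
begin

lemmas coeff = cinner_diagonal[OF fin on]
lemmas diag_W = diagonal_in[OF W EW]

lemma eqI:
  assumes "v \<in> W" "w \<in> W" "\<And>e. e \<in> E \<Longrightarrow> cinner e v = cinner e w"
  shows "v = w"
proof -
  have "diagonal E (\<lambda>e. 1) v = diagonal E (\<lambda>e. 1) w"
    unfolding diagonal_def by (rule sum.cong[OF refl]) (simp add: assms(3))
  then show ?thesis using assms(1,2) by (simp add: expand)
qed

lemma diagonal_diagonal: "diagonal E f (diagonal E g w) = diagonal E (\<lambda>e. f e * g e) w"
  by (rule eqI) (simp_all add: diag_W coeff ac_simps)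

lemma diagonal_cong: "(\<And>e. e \<in> E \<Longrightarrow> f e = g e) \<Longrightarrow> diagonal E f w = diagonal E g w"
  unfolding diagonal_def by (rule sum.cong[OF refl]) simp

lemma cinner_diagonal_right:
  "cinner v (diagonal E f w) = (\<Sum>e\<in>E. complex_of_real (f e) * (cinner v e * cinner e w))"
  unfolding diagonal_def cinner_sum_right cinner_scaleC_right by (simp add: ac_simps)

lemma diagonal_sym: "cinner v (diagonal E f w) = cinner (diagonal E f v) w"
proof -
  have "cinner (diagonal E f v) w = cnj (cinner w (diagonal E f v))" by (rule cinner_commute)
  also have "\<dots> = (\<Sum>e\<in>E. complex_of_real (f e) * (cinner v e * cinner e w))"
    unfolding cinner_diagonal_right cnj_sum complex_cnj_mult complex_cnj_complex_of_real
      cinner_commute[symmetric] by (simp add: ac_simps)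
  finally show ?thesis by (simp add: cinner_diagonal_right)
qed

lemma Re_cinner_diagonal: "Re (cinner w (diagonal E f w)) = (\<Sum>e\<in>E. f e * (norm (cinner e w))\<^sup>2)"
proof -
  have "cinner w (diagonal E f w) = (\<Sum>e\<in>E. complex_of_real (f e * (norm (cinner e w))\<^sup>2))"
    unfolding cinner_diagonal_right
  proof (rule sum.cong[OF refl])
    fix e
    have "cinner w e * cinner e w = complex_of_real ((norm (cinner e w))\<^sup>2)"
      unfolding complex_norm_square cinner_commute[of e w, symmetric]
      by (subst cinner_commute[of w e]) (rule mult.commute)
    then show "complex_of_real (f e) * (cinner w e * cinner e w)
        = complex_of_real (f e * (norm (cinner e w))\<^sup>2)" by simp
  qed
  also have "\<dots> = complex_of_real (\<Sum>e\<in>E. f e * (norm (cinner e w))\<^sup>2)" by simp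
  finally show ?thesis by (metis Re_complex_of_real)
qed

lemma norm_diagonal: "(norm (diagonal E f w))\<^sup>2 = Re (cinner w (diagonal E (\<lambda>e. f e * f e) w))"
  by (simp add: Re_cinner_self[symmetric] diagonal_sym[symmetric] diagonal_diagonal)

text \<open>The spectral subspace for the eigenvalues that satisfy \<open>I\<close>, described by
  vanishing coefficients so that membership can be tested on the basis.\<close>

definition eigen :: "(real \<Rightarrow> bool) \<Rightarrow> 'a set" where
  "eigen I = {w \<in> W. \<forall>e\<in>E. \<not> I (l e) \<longrightarrow> cinner e w = 0}"

lemma eigen_subspace: "complex_vector.subspace (eigen I)"
  using W unfolding eigen_def complex_vector.subspace_def
  by (auto simp: cinner_add_right cinner_scaleC_right)

lemma span_eigenvectors:
  "complex_vector.span {w. \<exists>r::real. I r \<and>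
      (w, complex_of_real r *\<^sub>C w) \<in> {(w, diagonal E l w) | w. w \<in> W}} = eigen I"
  (is "complex_vector.span ?G = _")
proof
  show "complex_vector.span ?G \<subseteq> eigen I"
  proof (rule complex_vector.span_minimal[OF _ eigen_subspace])
    show "?G \<subseteq> eigen I"
    proof
      fix w assume "w \<in> ?G"
      then obtain r where r: "I r" "w \<in> W" "complex_of_real r *\<^sub>C w = diagonal E l w" by auto
      have "cinner e w = 0" if e: "e \<in> E" "\<not> I (l e)" for e
      proof -
        have "complex_of_real r * cinner e w = complex_of_real (l e) * cinner e w"
          using arg_cong[OF r(3), of "cinner e"] by (simp only: cinner_scaleC_right coeff[OF e(1)])
        moreover have "r \<noteq> l e" using r(1) e(2) by auto
        ultimately show ?thesis by simp
      qed
      then show "w \<in> eigen I" unfolding eigen_def using r(2) by simp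
    qed
  qed
  show "eigen I \<subseteq> complex_vector.span ?G"
  proof
    fix w assume w: "w \<in> eigen I"
    then have "w = diagonal E (\<lambda>e. 1) w" unfolding eigen_def by (simp add: expand)
    also have "\<dots> = (\<Sum>e\<in>E. (complex_of_real 1 * cinner e w) *\<^sub>C e)" by (rule diagonal_def)
    also have "\<dots> \<in> complex_vector.span ?G"
    proof (rule complex_vector.span_sum)
      fix e assume e: "e \<in> E"
      show "(complex_of_real 1 * cinner e w) *\<^sub>C e \<in> complex_vector.span ?G"
      proof (cases "I (l e)")
        case True
        have "diagonal E l e = complex_of_real (l e) *\<^sub>C e"
        proof (rule eqI[OF diag_W])
          show "complex_of_real (l e) *\<^sub>C e \<in> W"
            using e EW by (auto intro: complex_vector.subspace_scale[OF W])
          show "cinner e' (diagonal E l e) = cinner e' (complex_of_real (l e) *\<^sub>C e)"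
            if "e' \<in> E" for e'
            using that e on by (simp add: coeff cinner_scaleC_right orthonormal_def)
        qed
        then have "e \<in> ?G" using True e EW by force
        then show ?thesis by (intro complex_vector.span_scale complex_vector.span_base)
      next
        case False
        then show ?thesis using w e unfolding eigen_def by (simp add: complex_vector.span_zero)
      qed
    qed
    finally show "w \<in> complex_vector.span ?G" .
  qed
qed

lemma kernel_eigen: "op_kernel {(w, diagonal E l w) | w. w \<in> W} = eigen (\<lambda>r. r = 0)"
proof -
  have "diagonal E l w = 0 \<longleftrightarrow> (\<forall>e\<in>E. l e \<noteq> 0 \<longrightarrow> cinner e w = 0)" for w
  proof
    assume "diagonal E l w = 0"
    then have "complex_of_real (l e) * cinner e w = 0" if "e \<in> E" for e
      using coeff[OF that, of l w] by simp
    then show "\<forall>e\<in>E. l e \<noteq> 0 \<longrightarrow> cinner e w = 0" by auto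
  next
    assume "\<forall>e\<in>E. l e \<noteq> 0 \<longrightarrow> cinner e w = 0"
    then show "diagonal E l w = 0" unfolding diagonal_def by (intro sum.neutral) auto
  qed
  then show ?thesis unfolding op_kernel_def eigen_def by auto
qed

lemma proj_eigen: "diagonal E (\<lambda>e. if I (l e) then 1 else 0) w \<in> eigen I"
  unfolding eigen_def using diag_W by (auto simp: coeff)

lemma orth_proj_eigen:
  assumes w: "w \<in> W"
  shows "orth_proj (eigen I) w = diagonal E (\<lambda>e. if I (l e) then 1 else 0) w" (is "_ = ?p")
  unfolding orth_proj_def
proof (rule the_equality)
  have *: "cinner s (w - ?p) = 0" if s: "s \<in> eigen I" for s
  proof -
    have "w - ?p = diagonal E (\<lambda>e. if I (l e) then 0 else 1) w"
      by (rule eqI) (auto simp: w diag_W complex_vector.subspace_diff[OF W] cinner_diff_right coeff)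
    moreover have "diagonal E (\<lambda>e. if I (l e) then 0 else 1) s = 0"
      unfolding diagonal_def by (rule sum.neutral) (use s in \<open>auto simp: eigen_def\<close>)
    ultimately show ?thesis by (simp add: diagonal_sym)
  qed
  then show "?p \<in> eigen I \<and> (\<forall>s\<in>eigen I. cinner s (w - ?p) = 0)" using proj_eigen by blast
  fix p assume p: "p \<in> eigen I \<and> (\<forall>s\<in>eigen I. cinner s (w - p) = 0)"
  then have d: "p - ?p \<in> eigen I" using proj_eigen by (intro complex_vector.subspace_diff[OF eigen_subspace]) auto
  have "cinner (p - ?p) (p - ?p) = cinner (p - ?p) (w - ?p) - cinner (p - ?p) (w - p)"
    by (simp add: cinner_diff_right)
  also have "\<dots> = 0" using *[OF d] p d by simp
  finally show "p = ?p" by (simp add: cinner_self)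
qed

lemma diagonal_graph_linear: "linear_operator {(w, diagonal E f w) | w. w \<in> W}"
proof (rule linear_operatorI)
  show "(0, 0) \<in> {(w, diagonal E f w) | w. w \<in> W}"
    using complex_vector.subspace_0[OF W] by (simp add: diagonal_zero)
next
  fix v v' w w'
  assume "(v, v') \<in> {(w, diagonal E f w) | w. w \<in> W}" "(w, w') \<in> {(w, diagonal E f w) | w. w \<in> W}"
  then show "(v + w, v' + w') \<in> {(w, diagonal E f w) | w. w \<in> W}"
    using complex_vector.subspace_add[OF W] by (simp add: diagonal_add)
next
  fix c v v' assume "(v, v') \<in> {(w, diagonal E f w) | w. w \<in> W}"
  then show "(c *\<^sub>C v, c *\<^sub>C v') \<in> {(w, diagonal E f w) | w. w \<in> W}"
    using complex_vector.subspace_scale[OF W] by (simp add: diagonal_scaleC)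
qed auto

lemma op_apply_diagonal: "w \<in> W \<Longrightarrow> op_apply {(w, diagonal E f w) | w. w \<in> W} w = diagonal E f w"
  by (rule op_apply_eq[OF diagonal_graph_linear]) auto

text \<open>Since the root is a definite description, uniqueness is the main point: every
  non-negative selfadjoint root acts on each basis vector by the scalar root, and hence, by
  linearity, on all of \<open>W\<close>.\<close>

lemma diagonal_sqrt:
  assumes f: "\<And>e. e \<in> E \<Longrightarrow> 0 \<le> f e"
  shows "op_sqrt_on W {(w, diagonal E f w) | w. w \<in> W} = {(w, diagonal E (\<lambda>e. sqrt (f e)) w) | w. w \<in> W}"
    (is "op_sqrt_on W ?T = ?R")
  unfolding op_sqrt_on_def
proof (rule the_equality)
  have "adjoint_on W ?R = ?R"
  proof (intro subset_antisym subrelI)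
    fix g h assume "(g, h) \<in> adjoint_on W ?R"
    then have gh: "g \<in> W" "h \<in> W" and adj: "\<And>x. x \<in> W \<Longrightarrow> cinner g (diagonal E (\<lambda>e. sqrt (f e)) x) = cinner h x"
      unfolding adjoint_on_def by auto
    have "h = diagonal E (\<lambda>e. sqrt (f e)) g"
    proof (rule eqI[OF gh(2) diag_W])
      fix e assume e: "e \<in> E"
      have "cnj (cinner h e) = cnj (cinner (diagonal E (\<lambda>e. sqrt (f e)) g) e)"
        using adj[of e] e EW by (auto simp: diagonal_sym)
      then show "cinner e h = cinner e (diagonal E (\<lambda>e. sqrt (f e)) g)"
        by (simp only: cinner_commute[symmetric])
    qed
    then show "(g, h) \<in> ?R" using gh by auto
  next
    fix g h assume "(g, h) \<in> ?R"
    then show "(g, h) \<in> adjoint_on W ?R" unfolding adjoint_on_def by (auto simp: diag_W diagonal_sym)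
  qed
  moreover have "cinner w (diagonal E (\<lambda>e. sqrt (f e)) w) \<in> \<real>\<^sub>\<ge>\<^sub>0" for w
  proof -
    have "cinner w (diagonal E (\<lambda>e. sqrt (f e)) w) = cnj (cinner w (diagonal E (\<lambda>e. sqrt (f e)) w))"
      by (subst (2) diagonal_sym) (rule cinner_commute)
    then have "Im (cinner w (diagonal E (\<lambda>e. sqrt (f e)) w)) = 0" by (simp add: complex_eq_iff)
    moreover have "0 \<le> Re (cinner w (diagonal E (\<lambda>e. sqrt (f e)) w))"
      unfolding Re_cinner_diagonal using f by (intro sum_nonneg) auto
    ultimately show ?thesis by (simp add: complex_nonneg_Reals_iff)
  qed
  moreover have "W \<subseteq> closure (Domain ?R)" by (rule order_trans[OF _ closure_subset]) auto
  ultimately have "nonneg_selfadjoint_on W ?R"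
    unfolding nonneg_selfadjoint_on_def using diagonal_graph_linear diag_W by auto
  moreover have "diagonal E (\<lambda>e. sqrt (f e)) (diagonal E (\<lambda>e. sqrt (f e)) w) = diagonal E f w" for w
    unfolding diagonal_diagonal by (rule diagonal_cong) (use f in simp)
  then have "?R O ?R = ?T" using diag_W by (auto simp: relcomp_unfold)
  ultimately show "nonneg_selfadjoint_on W ?R \<and> ?R O ?R = ?T" ..
next
  fix R assume R: "nonneg_selfadjoint_on W R \<and> R O R = ?T"
  then have lin: "linear_operator R" and RW: "R \<subseteq> W \<times> W" and adj: "adjoint_on W R = R"
    and pos: "\<And>f g. (f, g) \<in> R \<Longrightarrow> cinner f g \<in> \<real>\<^sub>\<ge>\<^sub>0" and RR: "R O R = ?T"
    unfolding nonneg_selfadjoint_on_def by auto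
  have eR: "(e, complex_of_real (sqrt (f e)) *\<^sub>C e) \<in> R" if e: "e \<in> E" for e
  proof -
    have "diagonal E f e = complex_of_real (f e) *\<^sub>C e"
    proof (rule eqI[OF diag_W])
      show "complex_of_real (f e) *\<^sub>C e \<in> W"
        using e EW by (auto intro: complex_vector.subspace_scale[OF W])
      show "cinner e' (diagonal E f e) = cinner e' (complex_of_real (f e) *\<^sub>C e)"
        if "e' \<in> E" for e'
        using that e on by (simp add: coeff cinner_scaleC_right orthonormal_def)
    qed
    then have "(e, complex_of_real (f e) *\<^sub>C e) \<in> R O R" unfolding RR using e EW by force
    then obtain h where h: "(e, h) \<in> R" "(h, complex_of_real (f e) *\<^sub>C e) \<in> R" by blast
    define r where "r = complex_of_real (sqrt (f e))"
    have rr: "complex_of_real (f e) = r * r"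
      unfolding r_def of_real_mult[symmetric] using f[OF e] by simp
    \<comment> \<open>With \<open>R e = h\<close> and \<open>R h = r * r *\<^sub>C e\<close>, the
      defect \<open>u\<close> satisfies \<open>R u = - r *\<^sub>C u\<close>. For
      \<open>r > 0\<close> this contradicts non-negativity unless \<open>u = 0\<close>; for
      \<open>r = 0\<close> selfadjointness gives \<open>cinner h h = 0\<close>.\<close>
    define u where "u = h - r *\<^sub>C e"
    have "(u, complex_of_real (f e) *\<^sub>C e - r *\<^sub>C h) \<in> R"
      unfolding u_def by (rule linear_operator_diff[OF lin h(2) linear_operator_scaleC[OF lin h(1)]])
    moreover have "complex_of_real (f e) *\<^sub>C e - r *\<^sub>C h = - (r *\<^sub>C u)"
      by (simp add: u_def rr scaleC_scaleC complex_vector.scale_right_diff_distrib)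
    ultimately have uR: "(u, - (r *\<^sub>C u)) \<in> R" by simp
    have "u = 0"
    proof (cases "f e = 0")
      case True
      then have r0: "r = 0" by (simp add: r_def)
      have h0: "(h, 0) \<in> R" using h(2) True by simp
      then have "(h, 0) \<in> adjoint_on W R" by (simp add: adj)
      then have "cinner h h = cinner 0 e" using h(1) unfolding adjoint_on_def by blast
      then show ?thesis by (simp add: u_def r0 cinner_self)
    next
      case False
      then have "0 < sqrt (f e)" using f[OF e] by simp
      moreover have "0 \<le> - (sqrt (f e) * (norm u)\<^sup>2)"
        using pos[OF uR]
        by (simp add: complex_nonneg_Reals_iff cinner_minus_right cinner_scaleC_right r_def cinner_self)
      ultimately have "(norm u)\<^sup>2 \<le> 0" by (simp add: mult_le_0_iff)
      then show ?thesis by simp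
    qed
    then have "h = r *\<^sub>C e" by (simp add: u_def)
    then show ?thesis using h(1) by (simp add: r_def)
  qed
  have sumR: "((\<Sum>e\<in>A. c e *\<^sub>C e), (\<Sum>e\<in>A. (complex_of_real (sqrt (f e)) * c e) *\<^sub>C e)) \<in> R"
    if "finite A" "A \<subseteq> E" for A c
    using that
  proof (induction A)
    case empty
    then show ?case using linear_operator_zero[OF lin] by simp
  next
    case (insert e A)
    have "(c e *\<^sub>C e, (complex_of_real (sqrt (f e)) * c e) *\<^sub>C e) \<in> R"
      using linear_operator_scaleC[OF lin eR[of e], of "c e"] insert.prems
      by (simp add: scaleC_scaleC mult.commute)
    from linear_operator_add[OF lin this insert.IH] insert show ?case by simp
  qed
  have sub: "(w, diagonal E (\<lambda>e. sqrt (f e)) w) \<in> R" if w: "w \<in> W" for w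
    using sumR[OF fin order_refl, of "\<lambda>e. cinner e w"] expand[OF w]
    unfolding diagonal_def by simp
  show "R = ?R"
  proof (intro subset_antisym subrelI)
    fix g h assume gh: "(g, h) \<in> R"
    then have "g \<in> W" using RW by auto
    then show "(g, h) \<in> ?R" using linear_operator_unique[OF lin gh sub] by auto
  qed (use sub in auto)
qed

definition pos_root :: "'a \<Rightarrow> 'a" where
  "pos_root = diagonal E (\<lambda>e. sqrt (max (l e) 0))"

definition neg_root :: "'a \<Rightarrow> 'a" where
  "neg_root = diagonal E (\<lambda>e. sqrt (max (- l e) 0))"

text \<open>The orthogonal projection onto the sum of the positive subspace and the kernel. It
  recovers \<open>w\<close> from a vector \<open>w + x\<close> with \<open>x\<close> in the negative
  subspace.\<close>

definition nonneg_part :: "'a \<Rightarrow> 'a" where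
  "nonneg_part = diagonal E (\<lambda>e. if 0 \<le> l e then 1 else 0)"

lemma positive_part_sqrt:
  "op_sqrt_on W {(w, op_apply {(w, diagonal E l w) | w. w \<in> W} (orth_proj (eigen (\<lambda>r. 0 < r)) w)) | w. w \<in> W}
    = {(w, pos_root w) | w. w \<in> W}"
proof -
  have "op_apply {(w, diagonal E l w) | w. w \<in> W} (orth_proj (eigen (\<lambda>r. 0 < r)) w)
      = diagonal E (\<lambda>e. max (l e) 0) w" if "w \<in> W" for w
    unfolding orth_proj_eigen[OF that] op_apply_diagonal[OF diag_W] diagonal_diagonal
    by (rule diagonal_cong) auto
  then have "{(w, op_apply {(w, diagonal E l w) | w. w \<in> W} (orth_proj (eigen (\<lambda>r. 0 < r)) w)) | w. w \<in> W}
      = {(w, diagonal E (\<lambda>e. max (l e) 0) w) | w. w \<in> W}" by (intro Collect_cong) auto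
  then show ?thesis unfolding pos_root_def by (simp add: diagonal_sqrt)
qed

lemma negative_part_sqrt:
  "op_sqrt_on W {(w, - op_apply {(w, diagonal E l w) | w. w \<in> W} (orth_proj (eigen (\<lambda>r. r < 0)) w)) | w. w \<in> W}
    = {(w, neg_root w) | w. w \<in> W}"
proof -
  have "- op_apply {(w, diagonal E l w) | w. w \<in> W} (orth_proj (eigen (\<lambda>r. r < 0)) w)
      = diagonal E (\<lambda>e. max (- l e) 0) w" if "w \<in> W" for w
    unfolding orth_proj_eigen[OF that] op_apply_diagonal[OF diag_W] diagonal_diagonal
    unfolding diagonal_def sum_negf[symmetric]
    by (rule sum.cong[OF refl]) auto
  then have "{(w, - op_apply {(w, diagonal E l w) | w. w \<in> W} (orth_proj (eigen (\<lambda>r. r < 0)) w)) | w. w \<in> W}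
      = {(w, diagonal E (\<lambda>e. max (- l e) 0) w) | w. w \<in> W}" by (intro Collect_cong) auto
  then show ?thesis unfolding neg_root_def by (simp add: diagonal_sqrt)
qed

lemma form_difference:
  "Re (cinner w (diagonal E l w)) = (norm (pos_root w))\<^sup>2 - (norm (neg_root w))\<^sup>2"
proof -
  have "l e = max (l e) 0 - max (- l e) 0" for e by auto
  then have "Re (cinner w (diagonal E l w))
      = (\<Sum>e\<in>E. max (l e) 0 * (norm (cinner e w))\<^sup>2 - max (- l e) 0 * (norm (cinner e w))\<^sup>2)"
    unfolding Re_cinner_diagonal by (metis (no_types, lifting) left_diff_distrib)
  then show ?thesis
    unfolding pos_root_def neg_root_def norm_diagonal Re_cinner_diagonal
    by (simp add: sum_subtractf)
qed

lemma pos_root_in: "pos_root w \<in> eigen (\<lambda>r. 0 < r)"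
  unfolding eigen_def pos_root_def using diag_W by (auto simp: coeff)

lemma neg_root_in: "neg_root w \<in> eigen (\<lambda>r. r < 0)"
  unfolding eigen_def neg_root_def using diag_W by (auto simp: coeff)

lemma pos_root_proj:
  assumes "w \<in> W"
  shows "pos_root (orth_proj (eigen (\<lambda>r. 0 < r)) w) = pos_root w"
  unfolding orth_proj_eigen[OF assms] pos_root_def diagonal_diagonal
  by (rule diagonal_cong) auto

lemma pos_root_nonneg_part: "pos_root (nonneg_part w) = pos_root w"
  unfolding nonneg_part_def pos_root_def diagonal_diagonal by (rule diagonal_cong) auto

lemma neg_root_nonneg_part: "neg_root (nonneg_part w) = 0"
  unfolding nonneg_part_def neg_root_def diagonal_diagonal
  by (unfold diagonal_def, rule sum.neutral) auto

lemma pos_root_negative: "w \<in> eigen (\<lambda>r. r < 0) \<Longrightarrow> pos_root w = 0"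
  unfolding pos_root_def diagonal_def by (rule sum.neutral) (auto simp: eigen_def max_def)

lemma nonneg_part_negative: "w \<in> eigen (\<lambda>r. r < 0) \<Longrightarrow> nonneg_part w = 0"
  unfolding nonneg_part_def diagonal_def by (rule sum.neutral) (auto simp: eigen_def)

lemma nonneg_part_diff: "w \<in> W \<Longrightarrow> w - nonneg_part w \<in> eigen (\<lambda>r. r < 0)"
  unfolding nonneg_part_def eigen_def
  by (auto simp: coeff cinner_diff_right intro: complex_vector.subspace_diff[OF W] diag_W)

lemma neg_root_bij:
  assumes y: "y \<in> eigen (\<lambda>r. r < 0)"
  shows "\<exists>x\<in>eigen (\<lambda>r. r < 0). neg_root x = y"
proof
  \<comment> \<open>Where \<open>l e \<ge> 0\<close> the quotient has denominator 0 and takes the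
    value 0; this fits because \<open>y\<close> has no such coefficients.\<close>
  let ?x = "diagonal E (\<lambda>e. 1 / sqrt (max (- l e) 0)) y"
  have yW: "y \<in> W" using y unfolding eigen_def by simp
  show "?x \<in> eigen (\<lambda>r. r < 0)" unfolding eigen_def using diag_W y by (auto simp: coeff eigen_def)
  show "neg_root ?x = y"
    unfolding neg_root_def
    by (rule eqI[OF diag_W yW]) (use y in \<open>auto simp: coeff eigen_def max_def\<close>)
qed

lemma neg_root_inj:
  assumes x: "x \<in> eigen (\<lambda>r. r < 0)" and "neg_root x = 0"
  shows "x = 0"
proof (rule eqI)
  fix e assume e: "e \<in> E"
  have "complex_of_real (sqrt (max (- l e) 0)) * cinner e x = 0"
    using coeff[OF e, of "\<lambda>e. sqrt (max (- l e) 0)" x] assms(2) by (simp add: neg_root_def)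
  then show "cinner e x = cinner e 0"
    using x e unfolding eigen_def by (cases "l e < 0") auto
qed (use x complex_vector.subspace_0[OF W] in \<open>auto simp: eigen_def\<close>)

lemma nonneg_eigen_sum: "eigen (\<lambda>r. 0 < r) + eigen (\<lambda>r. r = 0) = {w \<in> W. nonneg_part w = w}"
proof (intro subset_antisym subsetI)
  fix w assume "w \<in> eigen (\<lambda>r. 0 < r) + eigen (\<lambda>r. r = 0)"
  then obtain a b where ab: "w = a + b" "a \<in> eigen (\<lambda>r. 0 < r)" "b \<in> eigen (\<lambda>r. r = 0)"
    unfolding set_plus_def by blast
  have wW: "w \<in> W" using ab by (auto simp: eigen_def intro: complex_vector.subspace_add[OF W])
  have "nonneg_part w = w"
    unfolding nonneg_part_def
    by (rule eqI[OF diag_W wW]) (use ab in \<open>auto simp: coeff eigen_def cinner_add_right\<close>)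
  then show "w \<in> {w \<in> W. nonneg_part w = w}" using wW by simp
next
  fix w assume w: "w \<in> {w \<in> W. nonneg_part w = w}"
  define a where "a = diagonal E (\<lambda>e. if 0 < l e then 1 else 0) w"
  define b where "b = diagonal E (\<lambda>e. if l e = 0 then 1 else 0) w"
  have "a \<in> eigen (\<lambda>r. 0 < r)" "b \<in> eigen (\<lambda>r. r = 0)"
    unfolding a_def b_def by (rule proj_eigen)+
  moreover have "nonneg_part w = a + b"
    unfolding nonneg_part_def a_def b_def
    by (rule eqI) (auto simp: coeff cinner_add_right intro: diag_W complex_vector.subspace_add[OF W])
  then have "w = a + b" using w by simp
  ultimately show "w \<in> eigen (\<lambda>r. 0 < r) + eigen (\<lambda>r. r = 0)" unfolding set_plus_def by blast
qed

end

section \<open>Non-negative subspaces and contractions\<close>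

lemma op_apply_converse_restrict:
  assumes "x \<in> S" "(x, y) \<in> R" and "\<And>x'. x' \<in> S \<Longrightarrow> (x', y) \<in> R \<Longrightarrow> x' = x"
  shows "op_apply ((op_restrict R S)\<inverse>) y = x"
  unfolding op_apply_def
proof (rule the_equality)
  show "(y, x) \<in> (op_restrict R S)\<inverse>" unfolding op_restrict_def using assms(1,2) by simp
  fix x' assume "(y, x') \<in> (op_restrict R S)\<inverse>"
  then have "x' \<in> S" "(x', y) \<in> R" unfolding op_restrict_def by auto
  then show "x' = x" by (rule assms(3))
qed

section \<open>Coordinates for the non-negative subspaces\<close>

context diagonal_operator
begin

abbreviation "pos_space \<equiv> eigen (\<lambda>r. 0 < r)"
abbreviation "null_space \<equiv> eigen (\<lambda>r. r = 0)"
abbreviation "neg_space \<equiv> eigen (\<lambda>r. r < 0)"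
abbreviation "pos_graph \<equiv> {(w, pos_root w) | w. w \<in> W}"
abbreviation "neg_graph \<equiv> {(w, neg_root w) | w. w \<in> W}"
abbreviation "params \<equiv> extension_parameters pos_space null_space neg_space pos_graph"

definition param_space :: "'a set \<Rightarrow> 'a op \<Rightarrow> 'a set" where
  "param_space MM C = {w + op_apply ((op_restrict neg_graph neg_space)\<inverse>)
     (op_apply C (op_apply pos_graph w)) | w. w \<in> MM}"

text \<open>By \<open>form_difference\<close> these are the subspaces of \<open>W\<close> on which
  the form of the diagonal operator is non-negative.\<close>

definition nonneg_subspaces :: "'a set set" where
  "nonneg_subspaces =
     {S. complex_vector.subspace S \<and> S \<subseteq> W \<and> (\<forall>v\<in>S. norm (neg_root v) \<le> norm (pos_root v))}"

lemma root_linear: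
  "pos_root (v + w) = pos_root v + pos_root w" "neg_root (v + w) = neg_root v + neg_root w"
  "nonneg_part (v + w) = nonneg_part v + nonneg_part w"
  "pos_root (a *\<^sub>C w) = a *\<^sub>C pos_root w" "neg_root (a *\<^sub>C w) = a *\<^sub>C neg_root w"
  "nonneg_part (a *\<^sub>C w) = a *\<^sub>C nonneg_part w"
  "pos_root 0 = 0" "neg_root 0 = 0" "nonneg_part 0 = 0"
  "pos_root (v - w) = pos_root v - pos_root w" "neg_root (v - w) = neg_root v - neg_root w"
  "nonneg_part (v - w) = nonneg_part v - nonneg_part w"
  unfolding pos_root_def neg_root_def nonneg_part_def
  by (simp_all only: diagonal_add diagonal_scaleC diagonal_zero diagonal_diff)

lemma eigen_W: "w \<in> eigen I \<Longrightarrow> w \<in> W"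
  unfolding eigen_def by simp

lemma op_apply_pos: "w \<in> W \<Longrightarrow> op_apply pos_graph w = pos_root w"
  unfolding pos_root_def by (rule op_apply_diagonal)

lemma neg_root_eq_imp_eq:
  assumes "x \<in> neg_space" "y \<in> neg_space" "neg_root x = neg_root y"
  shows "x = y"
proof -
  have "x - y \<in> neg_space" by (rule complex_vector.subspace_diff[OF eigen_subspace assms(1,2)])
  moreover have "neg_root (x - y) = 0" using assms(3) by (simp add: root_linear)
  ultimately have "x - y = 0" by (rule neg_root_inj)
  then show ?thesis by simp
qed

lemma neg_inverse:
  assumes "x \<in> neg_space"
  shows "op_apply ((op_restrict neg_graph neg_space)\<inverse>) (neg_root x) = x"
  by (rule op_apply_converse_restrict)
    (use assms eigen_W in \<open>auto intro: neg_root_eq_imp_eq\<close>)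

lemma paramsD:
  assumes "(MM, C) \<in> params"
  shows "complex_vector.subspace MM" "\<And>w. w \<in> MM \<Longrightarrow> w \<in> W \<and> nonneg_part w = w"
    "linear_operator C" "C \<subseteq> pos_space \<times> neg_space" "Domain C = pos_root ` MM"
    "\<And>x y. (x, y) \<in> C \<Longrightarrow> norm y \<le> norm x"
proof -
  have *: "complex_vector.subspace MM" "MM \<subseteq> pos_space + null_space" "linear_operator C"
    "C \<subseteq> pos_space \<times> neg_space" "Domain C = op_apply pos_graph ` orth_proj pos_space ` MM"
    "\<forall>x\<in>Domain C. norm (op_apply C x) \<le> norm x"
    using assms unfolding extension_parameters_def by auto
  show "complex_vector.subspace MM" "linear_operator C" "C \<subseteq> pos_space \<times> neg_space"
    by (fact *)+
  show MM: "w \<in> W \<and> nonneg_part w = w" if "w \<in> MM" for w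
    using *(2) that nonneg_eigen_sum by auto
  have "op_apply pos_graph (orth_proj pos_space w) = pos_root w" if "w \<in> MM" for w
    using MM[OF that] proj_eigen[of "\<lambda>r. 0 < r" w]
    by (simp add: op_apply_pos orth_proj_eigen pos_root_proj[symmetric] eigen_W)
  then show "Domain C = pos_root ` MM" unfolding *(5) image_image by (rule image_cong[OF refl])
  show "norm y \<le> norm x" if "(x, y) \<in> C" for x y
    using *(6) op_apply_eq[OF *(3) that] that by force
qed

lemma paramsI:
  assumes "complex_vector.subspace MM" and MM: "\<And>w. w \<in> MM \<Longrightarrow> w \<in> W \<and> nonneg_part w = w"
    and C: "linear_operator C" "C \<subseteq> pos_space \<times> neg_space" "Domain C = pos_root ` MM"
    and norm: "\<And>x y. (x, y) \<in> C \<Longrightarrow> norm y \<le> norm x"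
  shows "(MM, C) \<in> params"
proof -
  have "op_apply pos_graph (orth_proj pos_space w) = pos_root w" if "w \<in> MM" for w
    using MM[OF that] proj_eigen[of "\<lambda>r. 0 < r" w]
    by (simp add: op_apply_pos orth_proj_eigen pos_root_proj[symmetric] eigen_W)
  then have "op_apply pos_graph ` orth_proj pos_space ` MM = pos_root ` MM"
    unfolding image_image by (rule image_cong[OF refl])
  moreover have "MM \<subseteq> pos_space + null_space" unfolding nonneg_eigen_sum using MM by auto
  moreover have "norm (op_apply C x) \<le> norm x" if "x \<in> Domain C" for x
    using norm[OF op_apply_in[OF C(1) that]] .
  ultimately show ?thesis unfolding extension_parameters_def using assms(1) C by simp
qed

lemma param_space_lift:
  assumes p: "(MM, C) \<in> params" and w: "w \<in> MM" and c: "(pos_root w, c) \<in> C"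
  shows "\<exists>u\<in>param_space MM C. u \<in> W \<and> nonneg_part u = w \<and> pos_root u = pos_root w \<and> neg_root u = c"
proof -
  note P = paramsD[OF p]
  have "c \<in> neg_space" using P(4) c by auto
  then obtain x where x: "x \<in> neg_space" "neg_root x = c" using neg_root_bij by blast
  have wW: "w \<in> W" "nonneg_part w = w" using P(2)[OF w] by auto
  have c_eq: "op_apply C (op_apply pos_graph w) = neg_root x"
    using op_apply_eq[OF P(3) c] x(2) by (simp add: op_apply_pos[OF wW(1)])
  have "w + x \<in> param_space MM C"
    unfolding param_space_def using w c_eq neg_inverse[OF x(1)] by (auto intro!: exI[of _ w])
  moreover have "nonneg_part (w + x) = w"
    by (simp add: root_linear wW nonneg_part_negative[OF x(1)])
  moreover have "pos_root (w + x) = pos_root w"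
    by (simp add: root_linear pos_root_negative[OF x(1)])
  moreover have "neg_root (w + x) = c"
    using neg_root_nonneg_part[of w] by (simp add: root_linear wW x(2))
  moreover have "w + x \<in> W" by (rule complex_vector.subspace_add[OF W wW(1) eigen_W[OF x(1)]])
  ultimately show ?thesis by blast
qed

text \<open>A vector \<open>u = w + x\<close> with \<open>x\<close> in the negative subspace has
  \<open>w\<close> as its \<open>nonneg_part\<close>; \<open>pos_root\<close> sees only
  \<open>w\<close> and \<open>neg_root\<close> only \<open>x\<close>. So the formula with the
  inverse root becomes a condition on these three coordinates, which is the form used from here
  on.\<close>

lemma param_space_iff:
  assumes p: "(MM, C) \<in> params"
  shows "u \<in> param_space MM C \<longleftrightarrow> u \<in> W \<and> nonneg_part u \<in> MM \<and> (pos_root u, neg_root u) \<in> C"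
proof
  note P = paramsD[OF p]
  assume "u \<in> param_space MM C"
  then obtain w where w: "w \<in> MM" and u: "u = w + op_apply ((op_restrict neg_graph neg_space)\<inverse>)
      (op_apply C (op_apply pos_graph w))" unfolding param_space_def by auto
  have wW: "w \<in> W" "nonneg_part w = w" using P(2)[OF w] by auto
  have "pos_root w \<in> Domain C" unfolding P(5) using w by (rule imageI)
  then obtain c where c: "(pos_root w, c) \<in> C" by blast
  then have "c \<in> neg_space" using P(4) by auto
  then obtain x where x: "x \<in> neg_space" "neg_root x = c" using neg_root_bij by blast
  have "op_apply C (op_apply pos_graph w) = neg_root x"
    using op_apply_eq[OF P(3) c] x(2) by (simp add: op_apply_pos[OF wW(1)])
  then have u: "u = w + x" unfolding u by (simp add: neg_inverse[OF x(1)])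
  have "nonneg_part u = w" unfolding u by (simp add: root_linear wW nonneg_part_negative[OF x(1)])
  moreover have "pos_root u = pos_root w"
    unfolding u by (simp add: root_linear pos_root_negative[OF x(1)])
  moreover have "neg_root u = c"
    unfolding u using neg_root_nonneg_part[of w] by (simp add: root_linear wW x(2))
  moreover have "u \<in> W" unfolding u by (rule complex_vector.subspace_add[OF W wW(1) eigen_W[OF x(1)]])
  ultimately show "u \<in> W \<and> nonneg_part u \<in> MM \<and> (pos_root u, neg_root u) \<in> C" using w c by simp
next
  note P = paramsD[OF p]
  assume u: "u \<in> W \<and> nonneg_part u \<in> MM \<and> (pos_root u, neg_root u) \<in> C"
  define x where "x = u - nonneg_part u"
  have x: "x \<in> neg_space" unfolding x_def using nonneg_part_diff u by blast
  have nW: "nonneg_part u \<in> W" using P(2) u by blast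
  have "op_apply C (op_apply pos_graph (nonneg_part u)) = neg_root u"
    unfolding op_apply_pos[OF nW] pos_root_nonneg_part using op_apply_eq[OF P(3)] u by blast
  also have "\<dots> = neg_root x" unfolding x_def root_linear(11) by (simp add: neg_root_nonneg_part)
  finally have "u = nonneg_part u + op_apply ((op_restrict neg_graph neg_space)\<inverse>)
      (op_apply C (op_apply pos_graph (nonneg_part u)))"
    by (simp add: neg_inverse[OF x]) (simp add: x_def)
  then show "u \<in> param_space MM C" unfolding param_space_def using u by blast
qed

lemma param_space_in:
  assumes p: "(MM, C) \<in> params"
  shows "param_space MM C \<in> nonneg_subspaces"
proof -
  note P = paramsD[OF p] and iff = param_space_iff[OF p]
  have "complex_vector.subspace (param_space MM C)"
    unfolding complex_vector.subspace_def
  proof (intro conjI ballI allI)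
    show "0 \<in> param_space MM C"
      unfolding iff root_linear using complex_vector.subspace_0[OF W]
        complex_vector.subspace_0[OF P(1)] linear_operator_zero[OF P(3)] by simp
    show "x + y \<in> param_space MM C" if "x \<in> param_space MM C" "y \<in> param_space MM C" for x y
      using that unfolding iff root_linear
      by (auto intro: complex_vector.subspace_add[OF W] complex_vector.subspace_add[OF P(1)]
          linear_operator_add[OF P(3)])
    show "a *\<^sub>C x \<in> param_space MM C" if "x \<in> param_space MM C" for a x
      using that unfolding iff root_linear
      by (auto intro: complex_vector.subspace_scale[OF W] complex_vector.subspace_scale[OF P(1)]
          linear_operator_scaleC[OF P(3)])
  qed
  moreover have "param_space MM C \<subseteq> W" using iff by blast
  moreover have "norm (neg_root v) \<le> norm (pos_root v)" if "v \<in> param_space MM C" for v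
    using P(6) that unfolding iff by blast
  ultimately show ?thesis unfolding nonneg_subspaces_def by simp
qed

definition space_params :: "'a set \<Rightarrow> 'a set \<times> 'a op" where
  "space_params S = (nonneg_part ` S, {(pos_root v, neg_root v) | v. v \<in> S})"

lemma space_params_param_space:
  assumes p: "(MM, C) \<in> params"
  shows "space_params (param_space MM C) = (MM, C)"
proof -
  note P = paramsD[OF p] and iff = param_space_iff[OF p]
  have "nonneg_part ` param_space MM C = MM"
  proof (intro subset_antisym subsetI)
    fix w assume w: "w \<in> MM"
    then obtain c where "(pos_root w, c) \<in> C" using P(5) by blast
    from param_space_lift[OF p w this] show "w \<in> nonneg_part ` param_space MM C" by force
  qed (use iff in auto)
  moreover have "{(pos_root v, neg_root v) | v. v \<in> param_space MM C} = C"
  proof (intro subset_antisym subrelI)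
    fix a b assume ab: "(a, b) \<in> C"
    then obtain w where w: "w \<in> MM" "a = pos_root w" using P(5) by blast
    with ab have "(pos_root w, b) \<in> C" by simp
    from param_space_lift[OF p w(1) this] obtain u where
      "u \<in> param_space MM C" "pos_root u = a" "neg_root u = b" using w(2) by blast
    then show "(a, b) \<in> {(pos_root v, neg_root v) | v. v \<in> param_space MM C}" by blast
  qed (use iff in auto)
  ultimately show ?thesis unfolding space_params_def by simp
qed

lemma space_params_in:
  assumes S: "S \<in> nonneg_subspaces"
  shows "space_params S \<in> params"
  unfolding space_params_def
proof (rule paramsI)
  have sub: "complex_vector.subspace S" and SW: "S \<subseteq> W"
    and norm: "\<And>v. v \<in> S \<Longrightarrow> norm (neg_root v) \<le> norm (pos_root v)"
    using S unfolding nonneg_subspaces_def by auto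
  show "complex_vector.subspace (nonneg_part ` S)"
    unfolding complex_vector.subspace_def
  proof (intro conjI ballI allI)
    show "0 \<in> nonneg_part ` S"
      using imageI[OF complex_vector.subspace_0[OF sub], of nonneg_part] by (simp add: root_linear)
    show "x + y \<in> nonneg_part ` S" if "x \<in> nonneg_part ` S" "y \<in> nonneg_part ` S" for x y
      using that by (auto simp: root_linear(3)[symmetric] intro: complex_vector.subspace_add[OF sub])
    show "a *\<^sub>C x \<in> nonneg_part ` S" if "x \<in> nonneg_part ` S" for a x
      using that by (auto simp: root_linear(6)[symmetric] intro: complex_vector.subspace_scale[OF sub])
  qed
  show "w \<in> W \<and> nonneg_part w = w" if "w \<in> nonneg_part ` S" for w
  proof -
    have "nonneg_part (nonneg_part v) = nonneg_part v" for v
      unfolding nonneg_part_def diagonal_diagonal by (rule diagonal_cong) auto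
    moreover have "nonneg_part v \<in> W" for v unfolding nonneg_part_def by (rule diag_W)
    ultimately show ?thesis using that by auto
  qed
  show "linear_operator {(pos_root v, neg_root v) | v. v \<in> S}"
  proof (rule linear_operatorI)
    fix a b b' assume "(a, b) \<in> {(pos_root v, neg_root v) | v. v \<in> S}"
      "(a, b') \<in> {(pos_root v, neg_root v) | v. v \<in> S}"
    then obtain v v' where v: "v \<in> S" "v' \<in> S" "a = pos_root v" "b = neg_root v"
      "a = pos_root v'" "b' = neg_root v'" by blast
    \<comment> \<open>Non-negativity on differences is what makes \<open>C\<close> single-valued:
      equal positive roots force equal negative roots.\<close>
    have "norm (neg_root (v - v')) \<le> norm (pos_root (v - v'))"
      by (rule norm[OF complex_vector.subspace_diff[OF sub v(1,2)]])
    then show "b = b'" using v by (simp add: root_linear)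
  next
    show "(0, 0) \<in> {(pos_root v, neg_root v) | v. v \<in> S}"
      using complex_vector.subspace_0[OF sub] by (auto intro!: exI[of _ 0] simp: root_linear)
  next
    fix a b a' b' assume "(a, b) \<in> {(pos_root v, neg_root v) | v. v \<in> S}"
      "(a', b') \<in> {(pos_root v, neg_root v) | v. v \<in> S}"
    then obtain v v' where v: "v \<in> S" "v' \<in> S" "a = pos_root v" "b = neg_root v"
      "a' = pos_root v'" "b' = neg_root v'" by blast
    then show "(a + a', b + b') \<in> {(pos_root v, neg_root v) | v. v \<in> S}"
      using complex_vector.subspace_add[OF sub v(1,2)]
      by (auto intro!: exI[of _ "v + v'"] simp: root_linear)
  next
    fix c a b assume "(a, b) \<in> {(pos_root v, neg_root v) | v. v \<in> S}"
    then obtain v where v: "v \<in> S" "a = pos_root v" "b = neg_root v" by blast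
    then show "(c *\<^sub>C a, c *\<^sub>C b) \<in> {(pos_root v, neg_root v) | v. v \<in> S}"
      using complex_vector.subspace_scale[OF sub v(1)]
      by (auto intro!: exI[of _ "c *\<^sub>C v"] simp: root_linear)
  qed
  show "{(pos_root v, neg_root v) | v. v \<in> S} \<subseteq> pos_space \<times> neg_space"
    using pos_root_in neg_root_in by auto
  show "Domain {(pos_root v, neg_root v) | v. v \<in> S} = pos_root ` nonneg_part ` S"
    by (auto simp: image_image pos_root_nonneg_part)
  show "norm y \<le> norm x" if "(x, y) \<in> {(pos_root v, neg_root v) | v. v \<in> S}" for x y
    using that norm by auto
qed

lemma param_space_space_params:
  assumes S: "S \<in> nonneg_subspaces" and eq: "space_params S = (MM, C)"
  shows "param_space MM C = S"
proof -
  have sub: "complex_vector.subspace S" and SW: "S \<subseteq> W"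
    and norm: "\<And>v. v \<in> S \<Longrightarrow> norm (neg_root v) \<le> norm (pos_root v)"
    using S unfolding nonneg_subspaces_def by auto
  have MM: "MM = nonneg_part ` S" and C: "C = {(pos_root v, neg_root v) | v. v \<in> S}"
    using eq unfolding space_params_def by auto
  have p: "(MM, C) \<in> params" using space_params_in[OF S] eq by simp
  show ?thesis
  proof (intro subset_antisym subsetI)
    fix u assume "u \<in> S"
    then have "u \<in> W \<and> nonneg_part u \<in> MM \<and> (pos_root u, neg_root u) \<in> C"
      unfolding MM C using SW by auto
    then show "u \<in> param_space MM C" unfolding param_space_iff[OF p] .
  next
    fix u assume "u \<in> param_space MM C"
    then have u: "u \<in> W" "nonneg_part u \<in> MM" "(pos_root u, neg_root u) \<in> C"
      unfolding param_space_iff[OF p] by auto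
    \<comment> \<open>A vector \<open>v\<close> of \<open>S\<close> with the same
      \<open>nonneg_part\<close> has the same \<open>pos_root\<close>, hence the same
      \<open>neg_root\<close> because \<open>C\<close> is single-valued. Then \<open>u - v\<close>
      lies in the negative subspace, where \<open>neg_root\<close> is injective.\<close>
    obtain v where v: "v \<in> S" "nonneg_part u = nonneg_part v" using u(2) unfolding MM by auto
    have "pos_root v = pos_root u"
      using pos_root_nonneg_part[of u] pos_root_nonneg_part[of v] v(2) by simp
    moreover have "(pos_root v, neg_root v) \<in> C" unfolding C using v(1) by auto
    ultimately have "neg_root v = neg_root u"
      using linear_operator_unique[OF paramsD(3)[OF p]] u(3) by auto
    then have "neg_root (u - v) = 0" by (simp add: root_linear)
    moreover have "u - v \<in> neg_space"
      using nonneg_part_diff[of "u - v"] complex_vector.subspace_diff[OF W u(1)] v SW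
      by (auto simp: root_linear)
    ultimately have "u - v = 0" using neg_root_inj by blast
    then show "u \<in> S" using v(1) by simp
  qed
qed

lemma param_space_bij:
  "bij_betw (\<lambda>(MM, C). param_space MM C) params nonneg_subspaces"
proof (rule bij_betw_byWitness[where f' = space_params])
  show "\<forall>p\<in>params. space_params (case p of (MM, C) \<Rightarrow> param_space MM C) = p"
    using space_params_param_space by auto
  show "\<forall>S\<in>nonneg_subspaces. (case space_params S of (MM, C) \<Rightarrow> param_space MM C) = S"
    using param_space_space_params by (auto split: prod.split)
  show "(\<lambda>(MM, C). param_space MM C) ` params \<subseteq> nonneg_subspaces"
    using param_space_in by auto
  show "space_params ` nonneg_subspaces \<subseteq> params" using space_params_in by auto
qed

lemma param_extend:
  assumes p: "(MM, C) \<in> params"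
  shows "\<exists>C'. (pos_space + null_space, C') \<in> params \<and>
    param_space MM C \<subseteq> param_space (pos_space + null_space) C'"
proof -
  note P = paramsD[OF p]
  let ?N = "{w \<in> W. nonneg_part w = w}"
  have DC: "complex_vector.subspace (Domain C)" by (rule linear_operator_Domain_subspace[OF P(3)])
  have WE: "W \<subseteq> complex_vector.span E"
  proof
    fix w assume "w \<in> W"
    then have "w = diagonal E (\<lambda>e. 1) w" by (simp add: expand)
    also have "\<dots> \<in> complex_vector.span E"
      unfolding diagonal_def
      by (intro complex_vector.span_sum complex_vector.span_scale complex_vector.span_base)
    finally show "w \<in> complex_vector.span E" .
  qed
  have "Domain C \<subseteq> W" using P(4) eigen_W by blast
  then have "Domain C \<subseteq> complex_vector.span E" using WE by blast
  from orthonormal_basis_exists[OF DC fin this] obtain F where F: "finite F \<and> F \<subseteq> Domain C \<and>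
      orthonormal F \<and> (\<forall>w\<in>Domain C. diagonal F (\<lambda>e. 1) w = w)" ..
  \<comment> \<open>The locale is reused with all eigenvalues 1 on an orthonormal basis of
    \<open>Domain C\<close>, which makes its calculus available for the orthogonal projection onto
    this domain.\<close>
  interpret F: diagonal_operator "Domain C" F "\<lambda>e. 1"
    using DC F by unfold_locales auto
  let ?p = "diagonal F (\<lambda>e. 1)"
  have p_in: "?p x \<in> Domain C" for x by (rule F.diag_W)
  have p_norm: "norm (?p x) \<le> norm x" for x
  proof -
    have "(norm (?p x))\<^sup>2 \<le> norm x * norm (?p x)"
      using F.norm_diagonal[of "\<lambda>e. 1" x] norm_cinner_le[of x "?p x"] complex_Re_le_cmod[of "cinner x (?p x)"]
      by simp
    then have "norm (?p x) * norm (?p x) \<le> norm x * norm (?p x)" by (simp only: power2_eq_square)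
    then show ?thesis by (cases "?p x = 0") auto
  qed
  \<comment> \<open>The second component depends on \<open>w\<close> only through
    \<open>pos_root w\<close>, so \<open>C'\<close> is single-valued; on \<open>Domain C\<close> the
    projection is the identity and \<open>C'\<close> agrees with \<open>C\<close>.\<close>
  define C' where "C' = {(pos_root w, op_apply C (?p (pos_root w))) | w. w \<in> ?N}"
  have app: "(?p x, op_apply C (?p x)) \<in> C" for x by (rule op_apply_in[OF P(3) p_in])
  have N: "complex_vector.subspace ?N"
    using W unfolding complex_vector.subspace_def by (auto simp: root_linear)
  have p': "(?N, C') \<in> params"
  proof (rule paramsI[OF N])
    show "linear_operator C'"
    proof (rule linear_operatorI)
      show "b = b'" if "(a, b) \<in> C'" "(a, b') \<in> C'" for a b b'
        using that unfolding C'_def by auto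
      show "(0, 0) \<in> C'"
        unfolding C'_def using complex_vector.subspace_0[OF N] op_apply_eq[OF P(3) linear_operator_zero[OF P(3)]]
        by (auto intro!: exI[of _ 0] simp: root_linear diagonal_zero)
    next
      fix a b a' b' assume "(a, b) \<in> C'" "(a', b') \<in> C'"
      then obtain v v' where v: "v \<in> ?N" "v' \<in> ?N" "a = pos_root v" "a' = pos_root v'"
        "b = op_apply C (?p a)" "b' = op_apply C (?p a')" unfolding C'_def by auto
      have "op_apply C (?p (a + a')) = b + b'"
        unfolding v(5,6) diagonal_add
        by (rule op_apply_eq[OF P(3) linear_operator_add[OF P(3) app app]])
      moreover have "v + v' \<in> ?N" by (rule complex_vector.subspace_add[OF N v(1,2)])
      ultimately show "(a + a', b + b') \<in> C'"
        unfolding C'_def using v(3,4) by (auto intro!: exI[of _ "v + v'"] simp: root_linear)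
    next
      fix c a b assume "(a, b) \<in> C'"
      then obtain v where v: "v \<in> ?N" "a = pos_root v" "b = op_apply C (?p a)" unfolding C'_def by auto
      have "op_apply C (?p (c *\<^sub>C a)) = c *\<^sub>C b"
        unfolding v(3) diagonal_scaleC
        by (rule op_apply_eq[OF P(3) linear_operator_scaleC[OF P(3) app]])
      moreover have "c *\<^sub>C v \<in> ?N" by (rule complex_vector.subspace_scale[OF N v(1)])
      ultimately show "(c *\<^sub>C a, c *\<^sub>C b) \<in> C'"
        unfolding C'_def using v(2) by (auto intro!: exI[of _ "c *\<^sub>C v"] simp: root_linear)
    qed
    have "op_apply C (?p x) \<in> neg_space" for x using app[of x] P(4) by auto
    then show "C' \<subseteq> pos_space \<times> neg_space" unfolding C'_def using pos_root_in by auto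
    show "Domain C' = pos_root ` ?N" unfolding C'_def by auto
    show "norm y \<le> norm x" if "(x, y) \<in> C'" for x y
    proof -
      have "y = op_apply C (?p x)" using that unfolding C'_def by auto
      then have "norm y \<le> norm (?p x)" using P(6)[OF app] by simp
      then show ?thesis using p_norm[of x] by linarith
    qed
  qed auto
  have "param_space MM C \<subseteq> param_space ?N C'"
  proof
    fix u assume "u \<in> param_space MM C"
    then have u: "u \<in> W" "nonneg_part u \<in> MM" "(pos_root u, neg_root u) \<in> C"
      unfolding param_space_iff[OF p] by auto
    have nN: "nonneg_part u \<in> ?N" using P(2)[OF u(2)] by simp
    have "?p (pos_root u) = pos_root u" using F u(3) by blast
    then have "op_apply C (?p (pos_root u)) = neg_root u" using op_apply_eq[OF P(3) u(3)] by simp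
    then have "(pos_root u, neg_root u) \<in> C'"
      unfolding C'_def using nN by (auto intro!: exI[of _ "nonneg_part u"] simp: pos_root_nonneg_part)
    then show "u \<in> param_space ?N C'" unfolding param_space_iff[OF p'] using u(1) nN by blast
  qed
  then show ?thesis unfolding nonneg_eigen_sum using p' by blast
qed

end

section \<open>Dissipative extensions of a dual pair\<close>

lemma op_adjoint_iff: "(g, h) \<in> op_adjoint B \<longleftrightarrow> (\<forall>f k. (f, k) \<in> B \<longrightarrow> cinner g k = cinner h f)"
  by (auto simp: adjoint_on_def)

lemma adjoint_linear:
  fixes B :: "'a::complex_hilbert_space op"
  assumes dense: "closure (Domain B) = UNIV"
  shows "linear_operator (op_adjoint B)"
proof (rule linear_operatorI)
  fix f g g' assume "(f, g) \<in> op_adjoint B" "(f, g') \<in> op_adjoint B"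
  then have adj: "cinner f k = cinner g x" "cinner f k = cinner g' x" if "(x, k) \<in> B" for x k
    using that unfolding adjoint_on_def by auto
  have "cinner g x = cinner g' x" if x: "x \<in> Domain B" for x
  proof -
    obtain k where "(x, k) \<in> B" using x by blast
    then show ?thesis using adj by metis
  qed
  then show "g = g'" by (rule cinner_dense_eq[OF dense])
qed (auto simp: op_adjoint_iff cinner_add_left cinner_scaleC_left)

lemma fst_closure:
  fixes A :: "'a::complex_hilbert_space op"
  assumes "p \<in> closure A"
  shows "fst p \<in> closure (Domain A)"
proof -
  obtain s where s: "\<And>n. s n \<in> A" "s \<longlonglongrightarrow> p" using assms unfolding closure_sequential by blast
  have "(\<lambda>n. fst (s n)) \<longlonglongrightarrow> fst p" by (rule tendsto_fst[OF s(2)])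
  moreover have "fst (s n) \<in> Domain A" for n using s(1)[of n] by (metis Domain.DomainI prod.collapse)
  ultimately show ?thesis unfolding closure_sequential by (intro exI conjI allI)
qed

text \<open>Each spanning vector \<open>b\<close> of the quotient is replaced by its
  \<open>K\<close>-component \<open>k b\<close>, which differs from it by an element of
  \<open>M\<close>. An element of \<open>K\<close> agrees modulo \<open>M\<close> with a combination
  of the \<open>k b\<close>, hence equals it as \<open>K \<inter> M = {0}\<close>.\<close>

lemma finite_dim_complement:
  fixes N M K :: "'a::complex_hilbert_space set"
  assumes M: "complex_vector.subspace M" and fd: "finite_dim_quotient N M" and K: "complement_in N M K"
  shows "\<exists>B. finite B \<and> K \<subseteq> complex_vector.span B"
proof -
  obtain B where B: "finite B" "B \<subseteq> N" "N \<subseteq> M + complex_vector.span B"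
    using fd unfolding finite_dim_quotient_def by blast
  have Ks: "complex_vector.subspace K" and KN: "K \<subseteq> N" and KM: "K + M = N" and K0: "K \<inter> M = {0}"
    using K unfolding complement_in_def by auto
  have "\<exists>k. k \<in> K \<and> b - k \<in> M" if "b \<in> B" for b
  proof -
    have "b \<in> K + M" using that B(2) KM by auto
    then obtain k m where "b = k + m" "k \<in> K" "m \<in> M" unfolding set_plus_def by blast
    then show ?thesis by (intro exI[of _ k]) simp
  qed
  then obtain k where k: "\<And>b. b \<in> B \<Longrightarrow> k b \<in> K \<and> b - k b \<in> M" by metis
  let ?S = "complex_vector.span (k ` B)"
  have SK: "?S \<subseteq> K" by (rule complex_vector.span_minimal[OF _ Ks]) (use k in auto)
  have sub: "complex_vector.subspace {x + y | x y. x \<in> ?S \<and> y \<in> M}"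
    by (rule complex_vector.subspace_sums[OF complex_vector.subspace_span M])
  have "complex_vector.span B \<subseteq> {x + y | x y. x \<in> ?S \<and> y \<in> M}"
  proof (rule complex_vector.span_minimal[OF _ sub], rule subsetI)
    fix b assume b: "b \<in> B"
    have "k b \<in> ?S" using b by (intro complex_vector.span_base imageI)
    moreover have "b = k b + (b - k b)" by simp
    ultimately show "b \<in> {x + y | x y. x \<in> ?S \<and> y \<in> M}" using k[OF b] by blast
  qed
  note span = this
  have "K \<subseteq> ?S"
  proof
    fix x assume x: "x \<in> K"
    then have "x \<in> M + complex_vector.span B" using KN B(3) by blast
    then obtain m y where my: "x = m + y" "m \<in> M" "y \<in> complex_vector.span B"
      unfolding set_plus_def by blast
    then obtain s m' where s: "y = s + m'" "s \<in> ?S" "m' \<in> M" using span by blast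
    have "x - s \<in> K" using SK s(2) by (intro complex_vector.subspace_diff[OF Ks x]) auto
    moreover have "x - s = m + m'" using my(1) s(1) by simp
    then have "x - s \<in> M" using complex_vector.subspace_add[OF M my(2) s(3)] by simp
    ultimately have "x - s = 0" using K0 by blast
    then show "x \<in> ?S" using s(2) by simp
  qed
  then show ?thesis using B(1) by (intro exI[of _ "k ` B"]) simp
qed

lemma Re_half_imaginary: "Re ((1 / (2 * \<i>)) * z) = Im z / 2"
  by simp

section \<open>The imaginary part of a dual pair and dissipativity of extensions\<close>

locale dissipative_dual_pair =
  fixes A At :: "'a::complex_hilbert_space op" and D :: "'a set"
  assumes pair: "dual_pair A At" and diss: "dissipative A" and core: "common_core A At D"
begin

abbreviation "Ts \<equiv> op_adjoint At"
abbreviation "V \<equiv> imaginary_part A At D"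
abbreviation "R \<equiv> op_sqrt (krein_von_neumann V)"

lemma A_lin: "linear_operator A" and At_lin: "linear_operator At" and A_Ts: "A \<subseteq> Ts"
  and A_dense: "closure (Domain A) = UNIV" and At_dense: "closure (Domain At) = UNIV"
  using pair unfolding dual_pair_def densely_defined_def by auto

lemma Ts_lin: "linear_operator Ts"
  by (rule adjoint_linear[OF At_dense])

lemma D_sub: "complex_vector.subspace D" and D_Domain: "D \<subseteq> Domain A \<inter> Domain At"
  and A_core: "A = closure (op_restrict A D)"
  using core unfolding common_core_def by auto

lemma Ts_cinner: "(v, w) \<in> Ts \<Longrightarrow> (f, h) \<in> At \<Longrightarrow> cinner v h = cinner w f"
  unfolding adjoint_on_def by auto

lemma A_Im_nonneg: "(f, g) \<in> A \<Longrightarrow> 0 \<le> Im (cinner f g)"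
  using diss op_apply_eq[OF A_lin] unfolding dissipative_def by fastforce

lemma V_iff: "(f, u) \<in> V \<longleftrightarrow> f \<in> D \<and> (\<exists>g h. (f, g) \<in> A \<and> (f, h) \<in> At \<and> u = (1 / (2 * \<i>)) *\<^sub>C (g - h))"
proof
  assume "(f, u) \<in> V"
  then have "f \<in> D" "u = (1 / (2 * \<i>)) *\<^sub>C (op_apply A f - op_apply At f)"
    unfolding imaginary_part_def by auto
  moreover from this have "f \<in> Domain A" "f \<in> Domain At" using D_Domain by auto
  then have "(f, op_apply A f) \<in> A" "(f, op_apply At f) \<in> At"
    by (auto intro: op_apply_in[OF A_lin] op_apply_in[OF At_lin])
  ultimately show "f \<in> D \<and> (\<exists>g h. (f, g) \<in> A \<and> (f, h) \<in> At \<and> u = (1 / (2 * \<i>)) *\<^sub>C (g - h))"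
    by blast
next
  assume "f \<in> D \<and> (\<exists>g h. (f, g) \<in> A \<and> (f, h) \<in> At \<and> u = (1 / (2 * \<i>)) *\<^sub>C (g - h))"
  then show "(f, u) \<in> V" unfolding imaginary_part_def
    using op_apply_eq[OF A_lin] op_apply_eq[OF At_lin] by auto
qed

lemma V_lin: "linear_operator V"
proof (rule linear_operatorI)
  show "u = u'" if "(f, u) \<in> V" "(f, u') \<in> V" for f u u'
    using that unfolding imaginary_part_def by auto
  show "(0, 0) \<in> V"
    unfolding V_iff using complex_vector.subspace_0[OF D_sub] linear_operator_zero[OF A_lin]
      linear_operator_zero[OF At_lin] by (intro conjI exI[of _ 0]) auto
  fix f u f' u' assume "(f, u) \<in> V" "(f', u') \<in> V"
  then obtain g h g' h' where *: "f \<in> D" "f' \<in> D" "(f, g) \<in> A" "(f, h) \<in> At" "(f', g') \<in> A" "(f', h') \<in> At"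
    "u = (1 / (2 * \<i>)) *\<^sub>C (g - h)" "u' = (1 / (2 * \<i>)) *\<^sub>C (g' - h')" unfolding V_iff by blast
  have "u + u' = (1 / (2 * \<i>)) *\<^sub>C ((g + g') - (h + h'))"
    unfolding *(7,8) scaleC_add_right[symmetric] by (simp add: algebra_simps)
  then show "(f + f', u + u') \<in> V" unfolding V_iff
    using complex_vector.subspace_add[OF D_sub *(1,2)] linear_operator_add[OF A_lin *(3,5)]
      linear_operator_add[OF At_lin *(4,6)] by blast
next
  fix c f u assume "(f, u) \<in> V"
  then obtain g h where *: "f \<in> D" "(f, g) \<in> A" "(f, h) \<in> At" "u = (1 / (2 * \<i>)) *\<^sub>C (g - h)"
    unfolding V_iff by blast
  have "c *\<^sub>C u = (1 / (2 * \<i>)) *\<^sub>C (c *\<^sub>C g - c *\<^sub>C h)"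
    unfolding *(4) complex_vector.scale_right_diff_distrib[symmetric] scaleC_scaleC
    by (simp add: mult.commute)
  then show "(c *\<^sub>C f, c *\<^sub>C u) \<in> V" unfolding V_iff
    using complex_vector.subspace_scale[OF D_sub *(1)] linear_operator_scaleC[OF A_lin *(2)]
      linear_operator_scaleC[OF At_lin *(3)] by blast
qed

lemma V_dense: "closure (Domain V) = UNIV"
proof -
  have "Domain V = D" unfolding imaginary_part_def by auto
  moreover have "Domain A \<subseteq> closure D"
  proof
    fix f assume "f \<in> Domain A"
    then obtain g where "(f, g) \<in> closure (op_restrict A D)" using A_core by blast
    from fst_closure[OF this] have "f \<in> closure (Domain (op_restrict A D))" by simp
    moreover have "Domain (op_restrict A D) \<subseteq> D" unfolding op_restrict_def by auto
    ultimately show "f \<in> closure D" using closure_mono by blast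
  qed
  then have "closure (Domain A) \<subseteq> closure D" by (simp add: closure_minimal)
  ultimately show ?thesis using A_dense by auto
qed

lemma V_sym:
  assumes "(f, u) \<in> V" "(f', u') \<in> V"
  shows "cinner f u' = cinner u f'"
proof -
  obtain g h g' h' where *: "(f, g) \<in> A" "(f, h) \<in> At" "(f', g') \<in> A" "(f', h') \<in> At"
    "u = (1 / (2 * \<i>)) *\<^sub>C (g - h)" "u' = (1 / (2 * \<i>)) *\<^sub>C (g' - h')"
    using assms unfolding V_iff by blast
  have 1: "cinner f h' = cinner g f'" using Ts_cinner *(1,4) A_Ts by blast
  have "cinner f' h = cinner g' f" using Ts_cinner *(3,2) A_Ts by blast
  then have 2: "cinner h f' = cinner f g'" by (metis cinner_commute)
  show ?thesis
    unfolding *(5,6) cinner_scaleC_left cinner_scaleC_right cinner_diff_left cinner_diff_right 1 2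
    by (simp add: field_simps)
qed

text \<open>Duality makes \<open>cinner f h\<close> the conjugate of \<open>cinner f g\<close>, so
  the form of \<open>V\<close> is the imaginary part of the form of \<open>A\<close>. Dissipativity
  of \<open>A\<close> thus becomes non-negativity of \<open>V\<close>.\<close>

lemma V_form:
  assumes "(f, g) \<in> A" "(f, h) \<in> At"
  shows "Re (cinner f ((1 / (2 * \<i>)) *\<^sub>C (g - h))) = Im (cinner f g)"
proof -
  have "cinner f h = cinner g f" using Ts_cinner assms A_Ts by blast
  then have "cinner f h = cnj (cinner f g)" by (metis cinner_commute)
  then show ?thesis unfolding cinner_scaleC_right cinner_diff_right Re_half_imaginary by simp
qed

lemma V_nonneg: "(f, u) \<in> V \<Longrightarrow> 0 \<le> Re (cinner f u)"
  unfolding V_iff using V_form A_Im_nonneg by auto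

lemma krein:
  shows "nonneg_selfadjoint_on UNIV (krein_von_neumann V)"
    and "0 \<le> c \<Longrightarrow> v \<in> Domain R \<and> (norm (op_apply R v))\<^sup>2 \<le> c \<longleftrightarrow>
      (\<forall>(f, g)\<in>V. (norm (cinner v g))\<^sup>2 \<le> c * Re (cinner f g))"
proof -
  show "nonneg_selfadjoint_on UNIV (krein_von_neumann V)"
    by (rule krein_von_neumann_sqrt(1)[OF V_lin V_dense], erule (1) V_sym, erule V_nonneg)
  assume c: "0 \<le> c"
  show "v \<in> Domain R \<and> (norm (op_apply R v))\<^sup>2 \<le> c \<longleftrightarrow>
      (\<forall>(f, g)\<in>V. (norm (cinner v g))\<^sup>2 \<le> c * Re (cinner f g))"
    by (rule krein_von_neumann_sqrt(2)[OF V_lin V_dense _ _ c], erule (1) V_sym, erule V_nonneg)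
qed

lemma R_lin: "linear_operator R"
  by (rule nonneg_selfadjointD(1)[OF op_sqrt_selfadjoint(1)[OF krein(1)]])

text \<open>As \<open>f\<close> lies in the domain of \<open>At\<close> and \<open>v\<close> in that
  of its adjoint, \<open>cinner f w\<close> is the conjugate of \<open>cinner v h\<close>. The mixed
  terms therefore contribute \<open>Im (cinner v (g - h))\<close>, which is twice the real part of
  \<open>cinner v (V f)\<close>.\<close>

lemma form_sum:
  assumes "(f, g) \<in> A" "(f, h) \<in> At" "(v, w) \<in> Ts"
  shows "Im (cinner (f + v) (g + w))
    = Im (cinner v w) + 2 * Re (cinner v ((1 / (2 * \<i>)) *\<^sub>C (g - h)))
      + Re (cinner f ((1 / (2 * \<i>)) *\<^sub>C (g - h)))"
proof -
  have "cinner v h = cinner w f" by (rule Ts_cinner[OF assms(3,2)])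
  then have "cinner f w = cnj (cinner v h)" by (metis cinner_commute)
  then show ?thesis
    unfolding V_form[OF assms(1,2)] unfolding cinner_scaleC_right Re_half_imaginary
    by (simp add: cinner_add_left cinner_add_right cinner_diff_right)
qed

text \<open>The condition on all translates of \<open>v\<close> by the domain of \<open>A\<close> is
  condensed into a condition on \<open>v\<close> alone. The constant \<open>Im (cinner v w)\<close>
  plays the role of \<open>c\<close> in the description of the Krein-von Neumann form.\<close>

lemma dissipative_vector_iff:
  assumes vw: "(v, w) \<in> Ts"
  shows "(\<forall>(f, g)\<in>A. 0 \<le> Im (cinner (f + v) (g + w))) \<longleftrightarrow>
    v \<in> Domain R \<and> (norm (op_apply R v))\<^sup>2 \<le> Im (cinner v w)"
proof
  assume *: "\<forall>(f, g)\<in>A. 0 \<le> Im (cinner (f + v) (g + w))"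
  have key: "0 \<le> Im (cinner v w) \<and> (norm (cinner v u))\<^sup>2 \<le> Im (cinner v w) * Re (cinner f u)"
    if fu: "(f, u) \<in> V" for f u
  proof -
    obtain g h where fgh: "(f, g) \<in> A" "(f, h) \<in> At" "u = (1 / (2 * \<i>)) *\<^sub>C (g - h)"
      using fu unfolding V_iff by blast
    \<comment> \<open>The graphs of \<open>A\<close> and \<open>At\<close> are invariant under
      scaling, so the assumption may be used at \<open>z *\<^sub>C f\<close> for every complex
      \<open>z\<close>.\<close>
    have "0 \<le> Im (cinner v w) + 2 * Re (z * cinner v u) + (norm z)\<^sup>2 * Re (cinner f u)" for z
    proof -
      note zA = linear_operator_scaleC[OF A_lin fgh(1), of z]
      note zAt = linear_operator_scaleC[OF At_lin fgh(2), of z]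
      have zu: "(1 / (2 * \<i>)) *\<^sub>C (z *\<^sub>C g - z *\<^sub>C h) = z *\<^sub>C u"
        unfolding fgh(3) complex_vector.scale_right_diff_distrib[symmetric] scaleC_scaleC
        by (simp add: mult.commute)
      have "cinner (z *\<^sub>C f) (z *\<^sub>C u) = complex_of_real ((norm z)\<^sup>2) * cinner f u"
        by (simp only: cinner_scaleC_left cinner_scaleC_right complex_norm_square mult.assoc)
      then have "Re (cinner (z *\<^sub>C f) (z *\<^sub>C u)) = (norm z)\<^sup>2 * Re (cinner f u)" by simp
      then show ?thesis
        using * zA form_sum[OF zA zAt vw] unfolding zu cinner_scaleC_right[of v] by auto
    qed
    then show ?thesis
      using complex_quadratic_nonneg[of "Im (cinner v w)" "cinner v u" "Re (cinner f u)"] by simp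
  qed
  have "0 \<le> Im (cinner v w)" using key[OF linear_operator_zero[OF V_lin]] by simp
  moreover have "\<forall>(f, u)\<in>V. (norm (cinner v u))\<^sup>2 \<le> Im (cinner v w) * Re (cinner f u)"
    using key by blast
  ultimately show "v \<in> Domain R \<and> (norm (op_apply R v))\<^sup>2 \<le> Im (cinner v w)"
    using krein(2)[of "Im (cinner v w)" v] by simp
next
  assume *: "v \<in> Domain R \<and> (norm (op_apply R v))\<^sup>2 \<le> Im (cinner v w)"
  then have c: "0 \<le> Im (cinner v w)" by (meson order_trans zero_le_power2)
  have V: "\<forall>(f, u)\<in>V. (norm (cinner v u))\<^sup>2 \<le> Im (cinner v w) * Re (cinner f u)"
    using krein(2)[OF c, of v] * by simp
  have core: "0 \<le> Im (cinner (f + v) (g + w))" if fg: "(f, g) \<in> A" "f \<in> D" for f g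
  proof -
    obtain h where h: "(f, h) \<in> At" using fg(2) D_Domain by blast
    let ?u = "(1 / (2 * \<i>)) *\<^sub>C (g - h)"
    have uV: "(f, ?u) \<in> V" unfolding V_iff using fg h by blast
    then have "(norm (cinner v ?u))\<^sup>2 \<le> Im (cinner v w) * Re (cinner f ?u)" using V by blast
    then have "0 \<le> Im (cinner v w) + 2 * Re (1 * cinner v ?u) + (norm (1::complex))\<^sup>2 * Re (cinner f ?u)"
      using complex_quadratic_nonneg[of "Im (cinner v w)" "cinner v ?u" "Re (cinner f ?u)"] c V_nonneg[OF uV]
      by blast
    then show ?thesis unfolding form_sum[OF fg(1) h vw] by simp
  qed
  \<comment> \<open>\<open>V\<close> gives information only on \<open>D\<close>. As \<open>A\<close>
    is the closure of its restriction to \<open>D\<close>, the inequality passes to all of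
    \<open>A\<close> by continuity of the inner product on graphs.\<close>
  show "\<forall>(f, g)\<in>A. 0 \<le> Im (cinner (f + v) (g + w))"
  proof clarify
    fix f g assume "(f, g) \<in> A"
    then have "(f, g) \<in> closure (op_restrict A D)" using A_core by simp
    then obtain s where s: "\<And>n. s n \<in> op_restrict A D" "s \<longlonglongrightarrow> (f, g)"
      unfolding closure_sequential by blast
    have "(\<lambda>n. Im (cinner (fst (s n) + v) (snd (s n) + w))) \<longlonglongrightarrow> Im (cinner (f + v) (g + w))"
      using tendsto_fst[OF s(2)] tendsto_snd[OF s(2)]
      by (intro tendsto_Im tendsto_cinner tendsto_add tendsto_const) simp_all
    moreover have "0 \<le> Im (cinner (fst (s n) + v) (snd (s n) + w))" for n
      using s(1)[of n] core[of "fst (s n)" "snd (s n)"] unfolding op_restrict_def by auto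
    ultimately show "0 \<le> Im (cinner (f + v) (g + w))"
      by (intro LIMSEQ_le_const) auto
  qed
qed

definition extension :: "'a set \<Rightarrow> 'a op" where
  "extension U = op_restrict Ts (Domain A + U)"

lemma extension_Domain: "U \<subseteq> Domain Ts \<Longrightarrow> Domain (extension U) = Domain A + U"
  using A_Ts complex_vector.subspace_add[OF linear_operator_Domain_subspace[OF Ts_lin]]
  unfolding extension_def op_restrict_def set_plus_def by blast

lemma extension_proper:
  assumes U: "complex_vector.subspace U"
  shows "proper_extension A At (extension U)"
proof -
  have DU: "complex_vector.subspace (Domain A + U)"
  proof -
    have "Domain A + U = {x + y | x y. x \<in> Domain A \<and> y \<in> U}" unfolding set_plus_def by blast
    then show ?thesis
      using complex_vector.subspace_sums[OF linear_operator_Domain_subspace[OF A_lin] U] by simp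
  qed
  have "linear_operator (extension U)"
  proof (rule linear_operatorI)
    show "g = g'" if "(f, g) \<in> extension U" "(f, g') \<in> extension U" for f g g'
      using that linear_operator_unique[OF Ts_lin] unfolding extension_def op_restrict_def by blast
    show "(0, 0) \<in> extension U"
      unfolding extension_def op_restrict_def
      using linear_operator_zero[OF Ts_lin] complex_vector.subspace_0[OF DU] by simp
    show "(f + f', g + g') \<in> extension U" if "(f, g) \<in> extension U" "(f', g') \<in> extension U" for f g f' g'
      using that linear_operator_add[OF Ts_lin] complex_vector.subspace_add[OF DU]
      unfolding extension_def op_restrict_def by simp
    show "(c *\<^sub>C f, c *\<^sub>C g) \<in> extension U" if "(f, g) \<in> extension U" for c f g
      using that linear_operator_scaleC[OF Ts_lin] complex_vector.subspace_scale[OF DU]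
      unfolding extension_def op_restrict_def by simp
  qed
  moreover have "A \<subseteq> extension U"
  proof (rule subrelI)
    fix f g assume fg: "(f, g) \<in> A"
    have "f + 0 \<in> Domain A + U" by (rule set_plus_intro) (use fg complex_vector.subspace_0[OF U] in auto)
    then show "(f, g) \<in> extension U" unfolding extension_def op_restrict_def using fg A_Ts by auto
  qed
  moreover have "extension U \<subseteq> Ts" unfolding extension_def op_restrict_def by auto
  ultimately show ?thesis unfolding proper_extension_def by simp
qed

lemma extension_dissipative_iff:
  assumes U: "complex_vector.subspace U" and UT: "U \<subseteq> Domain Ts"
  shows "dissipative (extension U) \<longleftrightarrow>
    (\<forall>v\<in>U. v \<in> Domain R \<and> (norm (op_apply R v))\<^sup>2 \<le> Im (cinner v (op_apply Ts v)))"
proof -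
  have proper: "linear_operator (extension U)" "A \<subseteq> extension U" "extension U \<subseteq> Ts"
    using extension_proper[OF U] unfolding proper_extension_def by auto
  have "closure (Domain A) \<subseteq> closure (Domain (extension U))"
    using proper(2) by (intro closure_mono) auto
  then have dense: "closure (Domain (extension U)) = UNIV" using A_dense by auto
  have vT: "(v, op_apply Ts v) \<in> Ts" if "v \<in> U" for v
    using that UT op_apply_in[OF Ts_lin] by blast
  have app: "op_apply (extension U) x = op_apply Ts x" if "x \<in> Domain (extension U)" for x
    using op_apply_in[OF proper(1) that] proper(3) op_apply_eq[OF Ts_lin] by fastforce
  have sum: "op_apply Ts (f + v) = g + op_apply Ts v" if "(f, g) \<in> A" "v \<in> U" for f g v
    using op_apply_eq[OF Ts_lin linear_operator_add[OF Ts_lin _ vT[OF that(2)]]] that(1) A_Ts by blast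
  have "dissipative (extension U) \<longleftrightarrow>
      (\<forall>x\<in>Domain A + U. 0 \<le> Im (cinner x (op_apply Ts x)))"
    unfolding dissipative_def densely_defined_def
    using proper(1) dense app extension_Domain[OF UT] by simp
  also have "\<dots> \<longleftrightarrow> (\<forall>v\<in>U. \<forall>(f, g)\<in>A. 0 \<le> Im (cinner (f + v) (g + op_apply Ts v)))"
  proof
    assume *: "\<forall>x\<in>Domain A + U. 0 \<le> Im (cinner x (op_apply Ts x))"
    show "\<forall>v\<in>U. \<forall>(f, g)\<in>A. 0 \<le> Im (cinner (f + v) (g + op_apply Ts v))"
    proof clarify
      fix v f g assume v: "v \<in> U" and fg: "(f, g) \<in> A"
      have "f + v \<in> Domain A + U" by (rule set_plus_intro) (use v fg in auto)
      with * have "0 \<le> Im (cinner (f + v) (op_apply Ts (f + v)))" by blast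
      then show "0 \<le> Im (cinner (f + v) (g + op_apply Ts v))" unfolding sum[OF fg v] .
    qed
  next
    assume *: "\<forall>v\<in>U. \<forall>(f, g)\<in>A. 0 \<le> Im (cinner (f + v) (g + op_apply Ts v))"
    show "\<forall>x\<in>Domain A + U. 0 \<le> Im (cinner x (op_apply Ts x))"
    proof
      fix x assume "x \<in> Domain A + U"
      then obtain f v where x: "x = f + v" "f \<in> Domain A" "v \<in> U" unfolding set_plus_def by blast
      then obtain g where "(f, g) \<in> A" by blast
      then show "0 \<le> Im (cinner x (op_apply Ts x))" using * x(3) unfolding x(1) by (auto simp: sum)
    qed
  qed
  also have "\<dots> \<longleftrightarrow>
      (\<forall>v\<in>U. v \<in> Domain R \<and> (norm (op_apply R v))\<^sup>2 \<le> Im (cinner v (op_apply Ts v)))"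
    by (rule ball_cong[OF refl]) (rule dissipative_vector_iff[OF vT])
  finally show ?thesis .
qed

end

section \<open>Extensions as subspaces of the complement, and the sesquilinear boundary form\<close>

context dissipative_dual_pair
begin

text \<open>The inverse map is \<open>A' \<mapsto> Domain A' \<inter> K\<close>: since
  \<open>K\<close> is a complement, every domain between that of \<open>A\<close> and that of the
  adjoint is the direct sum of \<open>Domain A\<close> and its part in \<open>K\<close>.
  Dissipativity then forces this part into the domain of the root, hence into
  \<open>W\<close>.\<close>

lemma extension_bij:
  assumes K: "complement_in (Domain Ts) (Domain A) K" and W: "W = K \<inter> Domain R"
    and q: "\<And>w. w \<in> W \<Longrightarrow> q w = Im (cinner w (op_apply Ts w)) - (norm (op_apply R w))\<^sup>2"
  shows "bij_betw extension {S. complex_vector.subspace S \<and> S \<subseteq> W \<and> (\<forall>v\<in>S. 0 \<le> q v)}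
    {A'. proper_extension A At A' \<and> dissipative A'}"
proof -
  have Ks: "complex_vector.subspace K" and KN: "K \<subseteq> Domain Ts" and KA: "K + Domain A = Domain Ts"
    and K0: "K \<inter> Domain A = {0}"
    using K unfolding complement_in_def by auto
  have As: "complex_vector.subspace (Domain A)" by (rule linear_operator_Domain_subspace[OF A_lin])
  have trace: "Domain (extension S) \<inter> K = S" if S: "complex_vector.subspace S" "S \<subseteq> K" for S
  proof -
    have "S \<subseteq> Domain Ts" using S(2) KN by (rule order_trans)
    note dom = extension_Domain[OF this]
    show ?thesis
    proof (intro subset_antisym subsetI)
      fix x assume "x \<in> Domain (extension S) \<inter> K"
      then obtain f s where x: "x = f + s" "f \<in> Domain A" "s \<in> S" "x \<in> K"
        unfolding dom set_plus_def by blast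
      have "x - s \<in> K" by (rule complex_vector.subspace_diff[OF Ks x(4)]) (use x(3) S(2) in auto)
      then have "f \<in> K" using x(1) by simp
      then have "f = 0" using x(2) K0 by blast
      then show "x \<in> S" using x(1,3) by simp
    next
      fix x assume x: "x \<in> S"
      have "0 + x \<in> Domain A + S"
        by (rule set_plus_intro[OF complex_vector.subspace_0[OF As] x])
      then show "x \<in> Domain (extension S) \<inter> K" unfolding dom using x S(2) by auto
    qed
  qed
  have proper: "complex_vector.subspace (Domain A' \<inter> K)" "extension (Domain A' \<inter> K) = A'"
    if A': "proper_extension A At A'" for A'
  proof -
    have lin: "linear_operator A'" and sub: "A \<subseteq> A'" "A' \<subseteq> Ts"
      using A' unfolding proper_extension_def by auto
    have A's: "complex_vector.subspace (Domain A')" by (rule linear_operator_Domain_subspace[OF lin])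
    then show "complex_vector.subspace (Domain A' \<inter> K)"
      using Ks by (rule complex_vector.subspace_inter)
    have "Domain A + (Domain A' \<inter> K) = Domain A'"
    proof (intro subset_antisym subsetI)
      fix x assume "x \<in> Domain A + (Domain A' \<inter> K)"
      then obtain f k where x: "x = f + k" "f \<in> Domain A" "k \<in> Domain A'"
        unfolding set_plus_def by blast
      have "f \<in> Domain A'" using x(2) sub(1) by blast
      then show "x \<in> Domain A'" unfolding x(1) using x(3) by (rule complex_vector.subspace_add[OF A's])
    next
      fix x assume x: "x \<in> Domain A'"
      then have "x \<in> K + Domain A" unfolding KA using sub(2) by blast
      then obtain k f where kf: "x = k + f" "k \<in> K" "f \<in> Domain A" unfolding set_plus_def by blast
      have "f \<in> Domain A'" using kf(3) sub(1) by blast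
      then have "x - f \<in> Domain A'" by (rule complex_vector.subspace_diff[OF A's x])
      then have "f + k \<in> Domain A + (Domain A' \<inter> K)"
        using kf by (intro set_plus_intro) auto
      then show "x \<in> Domain A + (Domain A' \<inter> K)" using kf(1) by (simp add: add.commute)
    qed
    then have "extension (Domain A' \<inter> K) = op_restrict Ts (Domain A')" unfolding extension_def by simp
    also have "\<dots> = A'"
    proof (intro subset_antisym subrelI)
      fix f g assume fg: "(f, g) \<in> op_restrict Ts (Domain A')"
      then obtain g' where g': "(f, g') \<in> A'" unfolding op_restrict_def by blast
      have "g = g'"
        using fg g' sub(2) linear_operator_unique[OF Ts_lin] unfolding op_restrict_def by blast
      then show "(f, g) \<in> A'" using g' by simp
    qed (use sub(2) in \<open>auto simp: op_restrict_def\<close>)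
    finally show "extension (Domain A' \<inter> K) = A'" .
  qed
  have iff: "dissipative (extension S) \<longleftrightarrow> S \<subseteq> W \<and> (\<forall>v\<in>S. 0 \<le> q v)"
    if S: "complex_vector.subspace S" "S \<subseteq> K" for S
  proof -
    have "S \<subseteq> Domain Ts" using S(2) KN by (rule order_trans)
    note diss_iff = extension_dissipative_iff[OF S(1) this]
    show ?thesis
    proof
      assume "dissipative (extension S)"
      then have *: "\<forall>v\<in>S. v \<in> Domain R \<and> (norm (op_apply R v))\<^sup>2 \<le> Im (cinner v (op_apply Ts v))"
        unfolding diss_iff .
      then have "S \<subseteq> W" unfolding W using S(2) by blast
      moreover have "0 \<le> q v" if v: "v \<in> S" for v
      proof -
        have "v \<in> W" using v \<open>S \<subseteq> W\<close> by blast
        from q[OF this] show ?thesis using * v by auto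
      qed
      ultimately show "S \<subseteq> W \<and> (\<forall>v\<in>S. 0 \<le> q v)" by blast
    next
      assume *: "S \<subseteq> W \<and> (\<forall>v\<in>S. 0 \<le> q v)"
      have "v \<in> Domain R \<and> (norm (op_apply R v))\<^sup>2 \<le> Im (cinner v (op_apply Ts v))"
        if v: "v \<in> S" for v
      proof -
        have vW: "v \<in> W" using v * by blast
        then have "v \<in> Domain R" unfolding W by blast
        then show ?thesis using q[OF vW] * v by auto
      qed
      then show "dissipative (extension S)" unfolding diss_iff by blast
    qed
  qed
  have WK: "W \<subseteq> K" unfolding W by simp
  show ?thesis
  proof (rule bij_betw_byWitness[where f' = "\<lambda>A'. Domain A' \<inter> K"])
    show "\<forall>S\<in>{S. complex_vector.subspace S \<and> S \<subseteq> W \<and> (\<forall>v\<in>S. 0 \<le> q v)}. Domain (extension S) \<inter> K = S"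
      using trace WK by (simp add: order_trans[of _ W K])
    show "\<forall>A'\<in>{A'. proper_extension A At A' \<and> dissipative A'}. extension (Domain A' \<inter> K) = A'"
      using proper(2) by simp
    show "extension ` {S. complex_vector.subspace S \<and> S \<subseteq> W \<and> (\<forall>v\<in>S. 0 \<le> q v)}
        \<subseteq> {A'. proper_extension A At A' \<and> dissipative A'}"
    proof (rule image_subsetI)
      fix S assume S: "S \<in> {S. complex_vector.subspace S \<and> S \<subseteq> W \<and> (\<forall>v\<in>S. 0 \<le> q v)}"
      then have "complex_vector.subspace S" "S \<subseteq> K" using WK by auto
      with S show "extension S \<in> {A'. proper_extension A At A' \<and> dissipative A'}"
        by (simp add: extension_proper iff)
    qed
    show "(\<lambda>A'. Domain A' \<inter> K) ` {A'. proper_extension A At A' \<and> dissipative A'}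
        \<subseteq> {S. complex_vector.subspace S \<and> S \<subseteq> W \<and> (\<forall>v\<in>S. 0 \<le> q v)}"
    proof (rule image_subsetI)
      fix A' assume "A' \<in> {A'. proper_extension A At A' \<and> dissipative A'}"
      then have A': "proper_extension A At A'" "dissipative A'" by auto
      have "dissipative (extension (Domain A' \<inter> K))" unfolding proper(2)[OF A'(1)] by (rule A'(2))
      then show "Domain A' \<inter> K \<in> {S. complex_vector.subspace S \<and> S \<subseteq> W \<and> (\<forall>v\<in>S. 0 \<le> q v)}"
        using iff[OF proper(1)[OF A'(1)]] proper(1)[OF A'(1)] by simp
    qed
  qed
qed

text \<open>The hermitian form whose diagonal is \<open>q\<close>. Writing it down explicitly
  supplies the sesquilinear form that \<open>form_operator_eigenbasis\<close> expects, whereas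
  \<open>q\<close> is given only as a real function.\<close>

definition boundary_form :: "'a \<Rightarrow> 'a \<Rightarrow> complex" where
  "boundary_form v w = (1 / (2 * \<i>)) * (cinner v (op_apply Ts w) - cinner (op_apply Ts v) w)
     - cinner (op_apply R v) (op_apply R w)"

lemma boundary_form_add:
  assumes "v \<in> Domain Ts" "w \<in> Domain Ts" "v \<in> Domain R" "w \<in> Domain R"
  shows "boundary_form u (v + w) = boundary_form u v + boundary_form u w"
proof -
  have "op_apply Ts (v + w) = op_apply Ts v + op_apply Ts w"
    by (rule op_apply_eq[OF Ts_lin linear_operator_add[OF Ts_lin op_apply_in[OF Ts_lin assms(1)]
            op_apply_in[OF Ts_lin assms(2)]]])
  moreover have "op_apply R (v + w) = op_apply R v + op_apply R w"
    by (rule op_apply_eq[OF R_lin linear_operator_add[OF R_lin op_apply_in[OF R_lin assms(3)]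
            op_apply_in[OF R_lin assms(4)]]])
  ultimately show ?thesis
    unfolding boundary_form_def by (simp only: cinner_add_right) (simp add: algebra_simps)
qed

lemma boundary_form_scaleC:
  assumes "w \<in> Domain Ts" "w \<in> Domain R"
  shows "boundary_form v (a *\<^sub>C w) = a * boundary_form v w"
proof -
  have "op_apply Ts (a *\<^sub>C w) = a *\<^sub>C op_apply Ts w"
    by (rule op_apply_eq[OF Ts_lin linear_operator_scaleC[OF Ts_lin op_apply_in[OF Ts_lin assms(1)]]])
  moreover have "op_apply R (a *\<^sub>C w) = a *\<^sub>C op_apply R w"
    by (rule op_apply_eq[OF R_lin linear_operator_scaleC[OF R_lin op_apply_in[OF R_lin assms(2)]]])
  ultimately show ?thesis
    unfolding boundary_form_def by (simp only: cinner_scaleC_right) (simp add: algebra_simps)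
qed

lemma boundary_form_hermitian: "boundary_form v w = cnj (boundary_form w v)"
proof -
  have "cnj (boundary_form w v) = - (1 / (2 * \<i>)) * (cinner (op_apply Ts v) w - cinner v (op_apply Ts w))
     - cinner (op_apply R v) (op_apply R w)"
    unfolding boundary_form_def complex_cnj_diff complex_cnj_mult cinner_commute[symmetric] by simp
  then show ?thesis unfolding boundary_form_def by (simp add: algebra_simps)
qed

lemma boundary_form_diagonal:
  "boundary_form w w
    = complex_of_real (Im (cinner w (op_apply Ts w)) - (norm (op_apply R w))\<^sup>2)"
proof -
  have "cinner (op_apply Ts w) w = cnj (cinner w (op_apply Ts w))" by (rule cinner_commute)
  then have "(1 / (2 * \<i>)) * (cinner w (op_apply Ts w) - cinner (op_apply Ts w) w)
      = complex_of_real (Im (cinner w (op_apply Ts w)))"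
    by (simp add: complex_eq_iff)
  then show ?thesis unfolding boundary_form_def cinner_self by simp
qed

end

theorem theorem4p12:
  fixes A At V VK M Mp Mm Rp Rm :: "'a::complex_hilbert_space op"
    and D K W Wp W0 Wm :: "'a set"
    and q :: "'a \<Rightarrow> real"
    and U :: "'a set \<Rightarrow> 'a op \<Rightarrow> 'a set"
    and Ext :: "'a set \<Rightarrow> 'a op \<Rightarrow> 'a op"
  assumes pair: "dual_pair A At"
    and closed: "closed A" "closed At"
    and ccp: "common_core_property A At"
    and diss: "dissipative A"
    and core: "common_core A At D"
    and V: "V = imaginary_part A At D"
    and VK: "VK = krein_von_neumann V"
    and findim: "finite_dim_quotient (Domain (op_adjoint At)) (Domain A)"
    and K: "complement_in (Domain (op_adjoint At)) (Domain A) K"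
    and W: "W = K \<inter> Domain (op_sqrt VK)"
    and q: "\<And>w. w \<in> W \<Longrightarrow>
              q w = Im (cinner w (op_apply (op_adjoint At) w)) - (norm (op_apply (op_sqrt VK) w))\<^sup>2"
    and M: "M = form_operator W q"
    and Wp: "Wp = positive_spectral_subspace M"
    and W0: "W0 = op_kernel M"
    and Wm: "Wm = negative_spectral_subspace M"
    and Mp: "Mp = {(w, op_apply M (orth_proj Wp w)) | w. w \<in> W}"
    and Mm: "Mm = {(w, - op_apply M (orth_proj Wm w)) | w. w \<in> W}"
    and Rp: "Rp = op_sqrt_on W Mp"
    and Rm: "Rm = op_sqrt_on W Mm"
    and U: "\<And>MM C. U MM C =
              {w + op_apply ((op_restrict Rm Wm)\<inverse>) (op_apply C (op_apply Rp w)) | w. w \<in> MM}"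
    and Ext: "\<And>MM C. Ext MM C = op_restrict (op_adjoint At) (Domain A + U MM C)"
  shows "bij_betw (\<lambda>(MM, C). Ext MM C)
           (extension_parameters Wp W0 Wm Rp)
           {A'. proper_extension A At A' \<and> dissipative A'} \<and>
         (\<forall>(MM, C)\<in>extension_parameters Wp W0 Wm Rp.
           Domain A \<inter> U MM C = {0} \<and> Domain (Ext MM C) = Domain A + U MM C) \<and>
         (\<forall>(MM, C)\<in>extension_parameters Wp W0 Wm Rp.
           maximally_dissipative (Ext MM C) \<longrightarrow> MM = Wp + W0)"
proof -
  interpret dissipative_dual_pair A At D
    using pair diss core by unfold_locales
  have KVN: "VK = krein_von_neumann (imaginary_part A At D)" unfolding VK V ..
  have Ks: "complex_vector.subspace K" and KN: "K \<subseteq> Domain (op_adjoint At)"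
    and K0: "K \<inter> Domain A = {0}"
    using K unfolding complement_in_def by auto
  have As: "complex_vector.subspace (Domain A)" by (rule linear_operator_Domain_subspace[OF A_lin])
  obtain B where B: "finite B" "K \<subseteq> complex_vector.span B"
    using finite_dim_complement[OF As findim K] by blast
  note WR = W[unfolded KVN] and qR = q[unfolded KVN]
  have Ws: "complex_vector.subspace W"
    unfolding WR by (rule complex_vector.subspace_inter[OF Ks linear_operator_Domain_subspace[OF R_lin]])
  have WB: "W \<subseteq> complex_vector.span B" unfolding WR using B(2) by blast
  have dom: "w \<in> Domain (op_adjoint At)" "w \<in> Domain (op_sqrt (krein_von_neumann (imaginary_part A At D)))"
    if "w \<in> W" for w
    using that KN unfolding WR by auto
  have "\<exists>E l. finite E \<and> E \<subseteq> W \<and> orthonormal E \<and> (\<forall>w\<in>W. diagonal E (\<lambda>e. 1) w = w) \<and>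
      form_operator W q = {(w, diagonal E l w) | w. w \<in> W} \<and>
      (\<forall>w\<in>W. q w = Re (cinner w (diagonal E l w)))"
  proof (rule form_operator_eigenbasis[OF Ws B(1) WB, of boundary_form])
    show "boundary_form u (v + w) = boundary_form u v + boundary_form u w"
      if "u \<in> W" "v \<in> W" "w \<in> W" for u v w
      by (rule boundary_form_add[OF dom(1)[OF that(2)] dom(1)[OF that(3)] dom(2)[OF that(2)] dom(2)[OF that(3)]])
    show "boundary_form v (a *\<^sub>C w) = a * boundary_form v w" if "v \<in> W" "w \<in> W" for a v w
      by (rule boundary_form_scaleC[OF dom[OF that(2)]])
    show "boundary_form v w = cnj (boundary_form w v)" if "v \<in> W" "w \<in> W" for v w
      by (rule boundary_form_hermitian)
    show "complex_of_real (q w) = boundary_form w w" if "w \<in> W" for w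
      unfolding boundary_form_diagonal qR[OF that] ..
  qed
  then obtain E l where El: "finite E \<and> E \<subseteq> W \<and> orthonormal E \<and> (\<forall>w\<in>W. diagonal E (\<lambda>e. 1) w = w) \<and>
      form_operator W q = {(w, diagonal E l w) | w. w \<in> W} \<and>
      (\<forall>w\<in>W. q w = Re (cinner w (diagonal E l w)))" by (elim exE)
  interpret d: diagonal_operator W E l
    using El Ws by unfold_locales auto
  have M_eq: "M = {(w, diagonal E l w) | w. w \<in> W}" unfolding M using El by blast
  have Wp_eq: "Wp = d.pos_space"
    unfolding Wp positive_spectral_subspace_def M_eq by (rule d.span_eigenvectors)
  have Wm_eq: "Wm = d.neg_space"
    unfolding Wm negative_spectral_subspace_def M_eq by (rule d.span_eigenvectors)
  have W0_eq: "W0 = d.null_space" unfolding W0 M_eq by (rule d.kernel_eigen)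
  have Rp_eq: "Rp = d.pos_graph" unfolding Rp Mp Wp_eq M_eq by (rule d.positive_part_sqrt)
  have Rm_eq: "Rm = d.neg_graph" unfolding Rm Mm Wm_eq M_eq by (rule d.negative_part_sqrt)
  have U_eq: "U MM C = d.param_space MM C" for MM C
    unfolding U d.param_space_def Rp_eq Rm_eq Wm_eq ..
  have Ext_eq: "Ext MM C = extension (d.param_space MM C)" for MM C
    unfolding Ext extension_def U_eq ..
  have params: "extension_parameters Wp W0 Wm Rp = d.params"
    unfolding Wp_eq W0_eq Wm_eq Rp_eq ..
  have q_roots: "0 \<le> q v \<longleftrightarrow> norm (d.neg_root v) \<le> norm (d.pos_root v)" if "v \<in> W" for v
  proof -
    have "q v = (norm (d.pos_root v))\<^sup>2 - (norm (d.neg_root v))\<^sup>2"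
      using El that d.form_difference[of v] by simp
    then show ?thesis by (simp add: abs_le_square_iff[symmetric])
  qed
  have subspaces: "{S. complex_vector.subspace S \<and> S \<subseteq> W \<and> (\<forall>v\<in>S. 0 \<le> q v)} = d.nonneg_subspaces"
    unfolding d.nonneg_subspaces_def using q_roots by (intro Collect_cong) (auto simp: subset_iff)
  have "bij_betw extension d.nonneg_subspaces {A'. proper_extension A At A' \<and> dissipative A'}"
    using extension_bij[OF K WR qR] unfolding subspaces .
  \<comment> \<open>Parameters correspond to non-negative subspaces of \<open>W\<close>, and these
    to dissipative extensions; the correspondence is the composition.\<close>
  from bij_betw_trans[OF d.param_space_bij this]
  have bij: "bij_betw (\<lambda>(MM, C). Ext MM C) d.params {A'. proper_extension A At A' \<and> dissipative A'}"
    by (simp add: Ext_eq comp_def case_prod_unfold)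
  have space: "d.param_space MM C \<subseteq> K" "complex_vector.subspace (d.param_space MM C)"
    if "(MM, C) \<in> d.params" for MM C
    using d.param_space_in[OF that] WR unfolding d.nonneg_subspaces_def by blast+
  have direct: "Domain A \<inter> U MM C = {0} \<and> Domain (Ext MM C) = Domain A + U MM C"
    if p: "(MM, C) \<in> d.params" for MM C
  proof
    have "0 \<in> Domain A \<inter> d.param_space MM C"
      using complex_vector.subspace_0[OF As] complex_vector.subspace_0[OF space(2)[OF p]] by simp
    then show "Domain A \<inter> U MM C = {0}" unfolding U_eq using space(1)[OF p] K0 by blast
    show "Domain (Ext MM C) = Domain A + U MM C"
      unfolding Ext_eq U_eq by (rule extension_Domain[OF order_trans[OF space(1)[OF p] KN]])
  qed
  have maximal: "MM = Wp + W0"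
    if p: "(MM, C) \<in> d.params" and max: "maximally_dissipative (Ext MM C)" for MM C
  proof -
    obtain C' where C': "(Wp + W0, C') \<in> d.params"
      "d.param_space MM C \<subseteq> d.param_space (Wp + W0) C'"
      using d.param_extend[OF p] unfolding Wp_eq W0_eq by blast
    have "Domain A + d.param_space MM C \<subseteq> Domain A + d.param_space (Wp + W0) C'"
      by (rule set_plus_mono2[OF order_refl C'(2)])
    then have "Ext MM C \<subseteq> Ext (Wp + W0) C'"
      unfolding Ext_eq extension_def op_restrict_def by auto
    moreover have "dissipative (Ext (Wp + W0) C')"
      using bij_betwE[OF bij] C'(1) by auto
    ultimately have "Ext (Wp + W0) C' = Ext MM C"
      using max unfolding maximally_dissipative_def by blast
    \<comment> \<open>Maximality identifies two extensions, and injectivity of the correspondence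
      carries this back to the parameters.\<close>
    then have "(Wp + W0, C') = (MM, C)"
      using inj_onD[OF bij_betw_imp_inj_on[OF bij] _ C'(1) p] by simp
    then show ?thesis by simp
  qed
  show ?thesis unfolding params
  proof (intro conjI)
    show "\<forall>(MM, C)\<in>d.params. Domain A \<inter> U MM C = {0} \<and> Domain (Ext MM C) = Domain A + U MM C"
      by (intro ballI) (simp only: split_paired_all prod.case, rule direct)
    show "\<forall>(MM, C)\<in>d.params. maximally_dissipative (Ext MM C) \<longrightarrow> MM = Wp + W0"
      by (intro ballI) (simp only: split_paired_all prod.case, intro impI, rule maximal)
  qed (rule bij)
qed

end
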